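(* There is an algorithm that, given a polynomial $p=p_1p_2$ where $p_1$ is a $\Pi_m\Sigma_2\Pi_t$ polynomial and $p_2$ is a $\Pi_k\Sigma_3$ polynomial, decides in $O((mk)^2 3^k)$ time whether $p$ has a multilinear monomial in its sum-product expansion.
   Context: Polynomials are in variables $x_1,\dots,x_n$. A monomial is multilinear if every variable occurring in it has exponent $1$. A $\Pi_m\Sigma_2\Pi_t$ polynomial is given as a product of $m$ clauses, each a sum of at most $2$ terms, each term a product of variables of degree at most $t$. A $\Pi_k\Sigma_3$ polynomial is a product of $k$ clauses, each a sum of at most $3$ single variables. The sum-product expansion of $p=p_1p_2$ consists of the products obtained by choosing one term from each clause of $p_1$ and of $p_2$; $p$ has a multilinear monomial in its sum-product expansion if some such product is multilinear.
   Formalization: The constant in O((mk)^2 3^k) may depend on the degree bound t (for m=k=1 a bound free of t would not even allow reading a degree-t term), and the time bound is claimed only for m,k≥1, since it is 0 otherwise; correctness is claimed for all m,k. *)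

theory Defs
  imports Main "HOL-Library.Multiset"
begin

text \<open>
  A variable \<open>x\<^sub>i\<close> is its index \<open>i\<close>.  A term is written as the list of its variable factors, so
  that its length is its degree; a clause (a sum) is the list of its terms, and a polynomial in
  product form is the list of its clauses.  In a \<open>\<Pi>\<^sub>k\<Sigma>\<^sub>3\<close> polynomial the summands are single
  variables, and a clause is the list of these.
\<close>

type_synonym sigma_pi_poly = "nat list list list"
type_synonym sigma_poly = "nat list list"

definition is_Pi_Sigma2_Pi :: "nat \<Rightarrow> nat \<Rightarrow> nat \<Rightarrow> sigma_pi_poly \<Rightarrow> bool" where
  "is_Pi_Sigma2_Pi n m t p \<longleftrightarrow>
     length p = m \<and>
     (\<forall>c \<in> set p. length c \<le> 2 \<and> (\<forall>s \<in> set c. length s \<le> t \<and> set s \<subseteq> {1..n}))"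

definition is_Pi_Sigma3 :: "nat \<Rightarrow> nat \<Rightarrow> sigma_poly \<Rightarrow> bool" where
  "is_Pi_Sigma3 n k p \<longleftrightarrow>
     length p = k \<and> (\<forall>c \<in> set p. length c \<le> 3 \<and> set c \<subseteq> {1..n})"

text \<open>
  Monomials are multisets of variables; the multiplicity of a variable is its exponent.
  The expansion is formal: products are collected without cancellation.
\<close>

definition expansion :: "sigma_pi_poly \<Rightarrow> sigma_poly \<Rightarrow> nat multiset set" where
  "expansion p1 p2 =
     {mset (concat ss) + mset xs | ss xs.
        ss \<in> listset (map set p1) \<and> xs \<in> listset (map set p2)}"

definition multilinear :: "nat multiset \<Rightarrow> bool" where
  "multilinear M \<longleftrightarrow> (\<forall>x \<in># M. count M x = 1)"

definition has_multilinear_monomial :: "sigma_pi_poly \<Rightarrow> sigma_poly \<Rightarrow> bool" where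
  "has_multilinear_monomial p1 p2 \<longleftrightarrow> (\<exists>M \<in> expansion p1 p2. multilinear M)"


text \<open>
  Algorithms are programs of a random access machine in structured form: registers and an
  addressable memory, both holding natural numbers, with addition, truncated subtraction, and
  indirect reading and writing.  Every operation, including the evaluation of every node of an
  expression, costs one time unit.  There is deliberately no multiplication or shift, so unit cost
  cannot be abused by packing long computations into single large numbers.
\<close>

datatype expr =
    Const nat
  | Reg nat
  | Mem expr
  | Add expr expr
  | Sub expr expr

datatype prog =
    Skip
  | Assign nat expr
  | Store expr expr
  | Seq prog prog
  | If expr prog prog
  | While expr prog

type_synonym state = "(nat \<Rightarrow> nat) \<times> (nat \<Rightarrow> nat)"  \<comment> \<open>registers, memory\<close>

fun val :: "expr \<Rightarrow> state \<Rightarrow> nat" where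
  "val (Const c) s = c"
| "val (Reg r) s = fst s r"
| "val (Mem e) s = snd s (val e s)"
| "val (Add e f) s = val e s + val f s"
| "val (Sub e f) s = val e s - val f s"

fun cost :: "expr \<Rightarrow> nat" where
  "cost (Const c) = 1"
| "cost (Reg r) = 1"
| "cost (Mem e) = 1 + cost e"
| "cost (Add e f) = 1 + cost e + cost f"
| "cost (Sub e f) = 1 + cost e + cost f"

text \<open>
  \<open>exec P s \<tau> s'\<close>: started in state \<open>s\<close>, the program \<open>P\<close> halts in state \<open>s'\<close> after exactly
  \<open>\<tau>\<close> time units.  A test succeeds if its value is nonzero.
\<close>

inductive exec :: "prog \<Rightarrow> state \<Rightarrow> nat \<Rightarrow> state \<Rightarrow> bool" where
  exec_Skip: "exec Skip s 1 s"
| exec_Assign: "exec (Assign r e) s (1 + cost e) ((fst s)(r := val e s), snd s)"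
| exec_Store: "exec (Store a e) s (1 + cost a + cost e) (fst s, (snd s)(val a s := val e s))"
| exec_Seq: "exec P s \<tau>1 s1 \<Longrightarrow> exec Q s1 \<tau>2 s2 \<Longrightarrow> exec (Seq P Q) s (\<tau>1 + \<tau>2) s2"
| exec_If_true: "val b s \<noteq> 0 \<Longrightarrow> exec P s \<tau> s1 \<Longrightarrow> exec (If b P Q) s (1 + cost b + \<tau>) s1"
| exec_If_false: "val b s = 0 \<Longrightarrow> exec Q s \<tau> s1 \<Longrightarrow> exec (If b P Q) s (1 + cost b + \<tau>) s1"
| exec_While_false: "val b s = 0 \<Longrightarrow> exec (While b P) s (1 + cost b) s"
| exec_While_true:
    "val b s \<noteq> 0 \<Longrightarrow> exec P s \<tau>1 s1 \<Longrightarrow> exec (While b P) s1 \<tau>2 s2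
     \<Longrightarrow> exec (While b P) s (1 + cost b + \<tau>1 + \<tau>2) s2"

inductive_cases exec_SkipE: "exec Skip s \<tau> s'"
inductive_cases exec_AssignE: "exec (Assign r e) s \<tau> s'"
inductive_cases exec_StoreE: "exec (Store a e) s \<tau> s'"
inductive_cases exec_SeqE: "exec (Seq P Q) s \<tau> s'"
inductive_cases exec_IfE: "exec (If b P Q) s \<tau> s'"
inductive_cases exec_WhileE: "exec (While b P) s \<tau> s'"

lemma exec_deterministic:
  "exec P s \<tau> s' \<Longrightarrow> exec P s \<sigma> s'' \<Longrightarrow> \<sigma> = \<tau> \<and> s'' = s'"
proof (induction arbitrary: \<sigma> s'' rule: exec.induct)
  case exec_Skip
  then show ?case by (rule exec_SkipE) simp
next
  case exec_Assign
  then show ?case by (rule exec_AssignE) simp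
next
  case exec_Store
  then show ?case by (rule exec_StoreE) simp
next
  case (exec_Seq P s \<tau>1 s1 Q \<tau>2 s2)
  from exec_Seq.prems show ?case
    by (rule exec_SeqE) (use exec_Seq.IH in metis)
next
  case (exec_If_true b s P \<tau> s1 Q)
  from exec_If_true.prems show ?case
    by (rule exec_IfE) (use exec_If_true.hyps in \<open>auto dest: exec_If_true.IH\<close>)
next
  case (exec_If_false b s Q \<tau> s1 P)
  from exec_If_false.prems show ?case
    by (rule exec_IfE) (use exec_If_false.hyps in \<open>auto dest: exec_If_false.IH\<close>)
next
  case exec_While_false
  from exec_While_false.prems show ?case
    by (rule exec_WhileE) (use exec_While_false.hyps in auto)
next
  case (exec_While_true b s P \<tau>1 s1 \<tau>2 s2)
  from exec_While_true.prems show ?case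
  proof (rule exec_WhileE)
    fix \<sigma>1 r \<sigma>2
    assume eq: "\<sigma> = Suc (cost b + \<sigma>1 + \<sigma>2)"
      and "exec P s \<sigma>1 r" and rest: "exec (While b P) r \<sigma>2 s''"
    then have "\<sigma>1 = \<tau>1" "r = s1"
      using exec_While_true.IH(1) by blast+
    then show ?thesis
      using exec_While_true.IH(2) rest eq by simp
  qed (use exec_While_true.hyps in simp)
qed

text \<open>
  The input is the number of variables followed by the two polynomials, every list being preceded
  by its length.  It is placed at the memory cells \<open>0, 1, \<dots>\<close>; all other cells and all registers
  start with \<open>0\<close>.  The answer is left in register \<open>0\<close>.
\<close>

definition enc_list :: "('a \<Rightarrow> nat list) \<Rightarrow> 'a list \<Rightarrow> nat list" where
  "enc_list f xs = length xs # concat (map f xs)"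

definition encode :: "nat \<Rightarrow> sigma_pi_poly \<Rightarrow> sigma_poly \<Rightarrow> nat list" where
  "encode n p1 p2 =
     n # enc_list (enc_list (enc_list (\<lambda>x. [x]))) p1 @ enc_list (enc_list (\<lambda>x. [x])) p2"

definition init_state :: "nat list \<Rightarrow> state" where
  "init_state w = (\<lambda>_. 0, \<lambda>i. if i < length w then w ! i else 0)"

definition answer :: "state \<Rightarrow> nat" where
  "answer s = fst s 0"

end

theory Submission
  imports Defs
begin

text \<open>
  Let \<open>X\<close> be the term formed by one variable from every clause of the second polynomial; there are
  at most \<open>3\<^sup>k\<close> of them.  Given \<open>X\<close>, choosing one of at most two terms per clause of the first
  polynomial such that all variables are distinct is a 2-SAT problem: a chosen term excludes every
  other term containing one of its variables and thereby forces the mates of these terms.  It is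
  solvable iff for every clause one of its terms survives unit propagation from \<open>X\<close> and that term
  alone, because two conflict-free closed sets of terms can be merged.  With lists of the
  occurrences of each variable, propagation takes time linear in the number of occurrences, since
  every occurrence list is walked at most once.  For fixed \<open>t\<close> this takes time
  \<open>O(m\<^sup>2 k)\<close> per selection \<open>X\<close>.
\<close>


section \<open>Weakest preconditions with running times\<close>

definition runs :: "prog \<Rightarrow> state \<Rightarrow> (nat \<Rightarrow> state \<Rightarrow> bool) \<Rightarrow> bool" where
  "runs P s Q \<longleftrightarrow> (\<exists>\<tau> s'. exec P s \<tau> s' \<and> Q \<tau> s')"

notation Seq (infixr ";;" 60)

lemma runs_exec: "exec P s \<tau> s' \<Longrightarrow> runs P s Q \<longleftrightarrow> Q \<tau> s'"
  unfolding runs_def by (blast dest: exec_deterministic)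

lemmas runs_Skip = runs_exec[OF exec_Skip]
  and runs_Assign = runs_exec[OF exec_Assign]
  and runs_Store = runs_exec[OF exec_Store]

lemma runs_Seq: "runs (P ;; R) s Q \<longleftrightarrow> runs P s (\<lambda>\<tau> s'. runs R s' (\<lambda>\<sigma>. Q (\<tau> + \<sigma>)))"
  unfolding runs_def by (blast intro: exec_Seq elim: exec_SeqE)

lemma runs_If:
  "runs (If b P R) s Q \<longleftrightarrow>
     (if val b s \<noteq> 0 then runs P s (\<lambda>\<tau>. Q (1 + cost b + \<tau>)) else runs R s (\<lambda>\<tau>. Q (1 + cost b + \<tau>)))"
proof (cases "val b s = 0")
  case True
  have "(\<exists>\<tau> s'. exec (If b P R) s \<tau> s' \<and> Q \<tau> s') \<longleftrightarrow> (\<exists>\<tau> s'. exec R s \<tau> s' \<and> Q (1 + cost b + \<tau>) s')"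
    using exec_If_false[OF True, of R] True by (auto elim!: exec_IfE) (metis add_Suc plus_1_eq_Suc)
  then show ?thesis using True by (simp add: runs_def)
next
  case False
  have "(\<exists>\<tau> s'. exec (If b P R) s \<tau> s' \<and> Q \<tau> s') \<longleftrightarrow> (\<exists>\<tau> s'. exec P s \<tau> s' \<and> Q (1 + cost b + \<tau>) s')"
    using exec_If_true[OF False, of P] False by (auto elim!: exec_IfE) (metis add_Suc plus_1_eq_Suc)
  then show ?thesis using False by (simp add: runs_def)
qed

lemmas runs_simps = runs_Skip runs_Assign runs_Store runs_Seq runs_If

text \<open>The running time is paid for by the decrease of the potential \<open>\<Phi>\<close>, which also yields
  termination.\<close>

lemma runs_While:
  assumes "I s"
    and step: "\<And>s. I s \<Longrightarrow> val b s \<noteq> 0 \<Longrightarrow>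
           runs P s (\<lambda>\<tau> s'. I s' \<and> \<tau> + (1 + cost b) + \<Phi> s' \<le> (\<Phi> s :: nat))"
    and post: "\<And>\<tau> s'. I s' \<Longrightarrow> val b s' = 0 \<Longrightarrow> \<tau> + \<Phi> s' \<le> \<Phi> s + (1 + cost b) \<Longrightarrow> Q \<tau> s'"
  shows "runs (While b P) s Q"
proof -
  have "\<exists>\<tau> s'. exec (While b P) s \<tau> s' \<and> I s' \<and> val b s' = 0 \<and> \<tau> + \<Phi> s' \<le> \<Phi> s + (1 + cost b)"
    using \<open>I s\<close>
  proof (induction "\<Phi> s" arbitrary: s rule: less_induct)
    case less
    show ?case
    proof (cases "val b s = 0")
      case True
      then show ?thesis using exec_While_false[OF True] less.prems by fastforce
    next
      case False
      from step[OF less.prems False] obtain \<tau>1 s1 where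
        1: "exec P s \<tau>1 s1" "I s1" "\<tau>1 + (1 + cost b) + \<Phi> s1 \<le> \<Phi> s"
        unfolding runs_def by blast
      then have "\<Phi> s1 < \<Phi> s" by simp
      from less.hyps[OF this 1(2)] obtain \<tau>2 s2 where
        2: "exec (While b P) s1 \<tau>2 s2" "I s2" "val b s2 = 0" "\<tau>2 + \<Phi> s2 \<le> \<Phi> s1 + (1 + cost b)"
        by blast
      show ?thesis
        using exec_While_true[OF False 1(1) 2(1)] 1(3) 2(2-4) by fastforce
    qed
  qed
  then show ?thesis unfolding runs_def using post by blast
qed

fun wr :: "prog \<Rightarrow> nat set" where
  "wr Skip = {}"
| "wr (Assign r e) = {r}"
| "wr (Store a e) = {}"
| "wr (P ;; Q) = wr P \<union> wr Q"
| "wr (If b P Q) = wr P \<union> wr Q"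
| "wr (While b P) = wr P"

lemma exec_wr: "exec P s \<tau> s' \<Longrightarrow> r \<notin> wr P \<Longrightarrow> fst s' r = fst s r"
  by (induction rule: exec.induct) auto

text \<open>
  Tables live above the input, interleaved: entry \<open>i\<close> of table \<open>c\<close> is at address \<open>ix B c i\<close>, where
  \<open>B\<close> is the length of the input.
\<close>

definition ix :: "nat \<Rightarrow> nat \<Rightarrow> nat \<Rightarrow> nat" where
  "ix B c i = B + c + 16 * i"

lemma ix_eq_iff [simp]:
  assumes "c < 16" "d < 16"
  shows "ix B c i = ix B d j \<longleftrightarrow> c = d \<and> i = j"
proof
  assume "ix B c i = ix B d j"
  then have "(c + 16 * i) mod 16 = (d + 16 * j) mod 16" "(c + 16 * i) div 16 = (d + 16 * j) div 16"
    by (simp_all add: ix_def)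
  with \<open>c < 16\<close> \<open>d < 16\<close> show "c = d \<and> i = j" by simp
qed auto

lemma ix_low [simp]: "a < B \<Longrightarrow> ix B c i \<noteq> a" "a < B \<Longrightarrow> a \<noteq> ix B c i" "\<not> ix B c i < B"
  by (auto simp: ix_def)

abbreviation (input) "rAns \<equiv> 0 :: nat"
abbreviation (input) "rB \<equiv> 2 :: nat"
abbreviation (input) "rK \<equiv> 3 :: nat"
abbreviation (input) "rX \<equiv> 4 :: nat"
abbreviation (input) "rStamp \<equiv> 5 :: nat"
abbreviation (input) "rConf \<equiv> 6 :: nat"
abbreviation (input) "rQh \<equiv> 7 :: nat"
abbreviation (input) "rQt \<equiv> 8 :: nat"
abbreviation (input) "rP \<equiv> 9 :: nat"
abbreviation (input) "rE \<equiv> 10 :: nat"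
abbreviation (input) "rV \<equiv> 11 :: nat"
abbreviation (input) "rQ \<equiv> 12 :: nat"
abbreviation (input) "rO \<equiv> 13 :: nat"
abbreviation (input) "rH \<equiv> 14 :: nat"
abbreviation (input) "rI \<equiv> 15 :: nat"
abbreviation (input) "rF \<equiv> 16 :: nat"
abbreviation (input) "rOk \<equiv> 17 :: nat"
abbreviation (input) "rR \<equiv> 18 :: nat"
abbreviation (input) "rT \<equiv> 19 :: nat"
abbreviation (input) "rJ \<equiv> 20 :: nat"
abbreviation (input) "rC \<equiv> 21 :: nat"
abbreviation (input) "rA \<equiv> 22 :: nat"
abbreviation (input) "rU \<equiv> 23 :: nat"
abbreviation (input) "rW \<equiv> 24 :: nat"
abbreviation (input) "rM \<equiv> 25 :: nat"
abbreviation (input) "rN \<equiv> 26 :: nat"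

abbreviation (input) "aOpp \<equiv> 2 :: nat"
abbreviation (input) "aNext \<equiv> 3 :: nat"
abbreviation (input) "aHead \<equiv> 4 :: nat"
abbreviation (input) "aVar \<equiv> 5 :: nat"
abbreviation (input) "aDig \<equiv> 8 :: nat"
abbreviation (input) "aMark \<equiv> 9 :: nat"
abbreviation (input) "aInq \<equiv> 10 :: nat"
abbreviation (input) "aQueue \<equiv> 11 :: nat"
abbreviation (input) "aFst \<equiv> 12 :: nat"
abbreviation (input) "aSnd \<equiv> 13 :: nat"

definition twice :: "expr \<Rightarrow> expr" where "twice e = Add e e"

definition addr :: "nat \<Rightarrow> expr \<Rightarrow> expr" where
  "addr c e = Add (Add (Reg rB) (Const c)) (twice (twice (twice (twice e))))"

lemma val_addr [simp]: "val (addr c e) s = ix (fst s rB) c (val e s)"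
  by (simp add: addr_def twice_def ix_def)

lemma cost_addr [simp]: "cost (addr c e) = 19 + 16 * cost e"
  by (simp add: addr_def twice_def)

definition neq :: "expr \<Rightarrow> expr \<Rightarrow> expr" where
  "neq e f = Add (Sub e f) (Sub f e)"

lemma val_neq [simp]: "val (neq e f) s = 0 \<longleftrightarrow> val e s = val f s"
  "0 < val (neq e f) s \<longleftrightarrow> val e s \<noteq> val f s"
  by (auto simp: neq_def)

lemma cost_neq [simp]: "cost (neq e f) = 3 + 2 * cost e + 2 * cost f"
  by (simp add: neq_def)

definition inc :: "nat \<Rightarrow> prog" where
  "inc r = Assign r (Add (Reg r) (Const 1))"

definition loop :: "nat \<Rightarrow> nat \<Rightarrow> prog \<Rightarrow> prog" where
  "loop r h P = While (Sub (Reg h) (Reg r)) (P ;; inc r)"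

lemma runs_inc: "runs (inc r) s Q \<longleftrightarrow> Q 4 ((fst s)(r := Suc (fst s r)), snd s)"
  by (simp add: inc_def runs_simps eval_nat_numeral)

lemma wr_inc [simp]: "wr (inc r) = {r}" by (simp add: inc_def)
lemma wr_loop [simp]: "wr (loop r h P) = insert r (wr P)" by (auto simp: loop_def)

text \<open>
  \<open>wr\<close> and \<open>sto\<close> bound syntactically which registers and tables a program changes; frame
  conditions then need no invariants of their own.
\<close>

fun sto :: "nat set \<Rightarrow> prog \<Rightarrow> bool" where
  "sto A Skip = True"
| "sto A (Assign r e) = True"
| "sto A (Store a e) = (\<exists>c e'. c \<in> A \<and> c < 16 \<and> a = addr c e')"
| "sto A (P ;; Q) = (sto A P \<and> sto A Q)"
| "sto A (If b P Q) = (sto A P \<and> sto A Q)"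
| "sto A (While b P) = sto A P"

lemma sto_addr [simp]: "sto A (Store (addr c e) f) \<longleftrightarrow> c \<in> A \<and> c < 16"
  by (auto simp: addr_def)

lemma sto_inc [simp]: "sto A (inc r)" by (simp add: inc_def)
lemma sto_loop [simp]: "sto A (loop r h P) = sto A P" by (simp add: loop_def)

declare sto.simps(3) [simp del]

lemma exec_sto:
  "exec P s \<tau> s' \<Longrightarrow> sto A P \<Longrightarrow> rB \<notin> wr P \<Longrightarrow>
   (\<forall>a < fst s rB. snd s' a = snd s a) \<and>
   (\<forall>c i. c < 16 \<longrightarrow> c \<notin> A \<longrightarrow> snd s' (ix (fst s rB) c i) = snd s (ix (fst s rB) c i))"
proof (induction rule: exec.induct)
  case (exec_Seq P s \<tau>1 s1 Q \<tau>2 s2)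
  then show ?case using exec_wr[OF exec_Seq.hyps(1), of rB] by auto
next
  case (exec_While_true b s P \<tau>1 s1 \<tau>2 s2)
  then show ?case using exec_wr[OF exec_While_true.hyps(2), of rB] by auto
qed (auto simp: sto.simps(3))

definition frame :: "nat set \<Rightarrow> nat set \<Rightarrow> state \<Rightarrow> state \<Rightarrow> bool" where
  "frame W A s s' \<longleftrightarrow> (\<forall>r. r \<notin> W \<longrightarrow> fst s' r = fst s r) \<and>
     (\<forall>a < fst s rB. snd s' a = snd s a) \<and>
     (\<forall>c i. c < 16 \<longrightarrow> c \<notin> A \<longrightarrow> snd s' (ix (fst s rB) c i) = snd s (ix (fst s rB) c i))"

lemma runs_frame:
  assumes "runs P s Q" "sto A P" "wr P \<subseteq> W" "rB \<notin> W"
    and "\<And>\<tau> s'. Q \<tau> s' \<Longrightarrow> frame W A s s' \<Longrightarrow> Q' \<tau> s'"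
  shows "runs P s Q'"
proof -
  from assms(1) obtain \<tau> s' where e: "exec P s \<tau> s'" "Q \<tau> s'" by (auto simp: runs_def)
  have "frame W A s s'"
    unfolding frame_def using exec_wr[OF e(1)] exec_sto[OF e(1) assms(2)] assms(3,4) by blast
  then show ?thesis using assms(5) e unfolding runs_def by blast
qed

lemma runs_mono:
  assumes "runs P s Q" "\<And>\<tau> s'. Q \<tau> s' \<Longrightarrow> Q' \<tau> s'"
  shows "runs P s Q'"
  using assms unfolding runs_def by blast

lemma runs_loop:
  assumes lo: "fst s r = l" "fst s h = H" "l \<le> H" and I: "I l s"
    and wr: "r \<notin> wr P" "h \<notin> wr P" "r \<noteq> h"
    and step: "\<And>j s. l \<le> j \<Longrightarrow> j < H \<Longrightarrow> fst s r = j \<Longrightarrow> fst s h = H \<Longrightarrow> I j s \<Longrightarrow>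
        runs P s (\<lambda>\<tau> s'. \<tau> \<le> K \<and> I (Suc j) ((fst s')(r := Suc j), snd s'))"
    and post: "\<And>\<tau> s'. fst s' r = H \<Longrightarrow> fst s' h = H \<Longrightarrow> I H s' \<Longrightarrow>
        \<tau> \<le> (H - l) * (K + 8) + 4 \<Longrightarrow> Q \<tau> s'"
  shows "runs (loop r h P) s Q"
  unfolding loop_def
proof (rule runs_While[where I = "\<lambda>s. \<exists>j. l \<le> j \<and> j \<le> H \<and> fst s r = j \<and> fst s h = H \<and> I j s"
      and \<Phi> = "\<lambda>s. (H - fst s r) * (K + 8)"])
  show "\<exists>j. l \<le> j \<and> j \<le> H \<and> fst s r = j \<and> fst s h = H \<and> I j s"
    using lo I by auto
next
  fix s assume "\<exists>j. l \<le> j \<and> j \<le> H \<and> fst s r = j \<and> fst s h = H \<and> I j s"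
    and "val (Sub (Reg h) (Reg r)) s \<noteq> 0"
  then obtain j where j: "l \<le> j" "j < H" "fst s r = j" "fst s h = H" "I j s" by auto
  obtain \<tau> s' where e: "exec P s \<tau> s'" "\<tau> \<le> K" "I (Suc j) ((fst s')(r := Suc j), snd s')"
    using step[OF j] by (auto simp: runs_def)
  have f: "fst s' r = j" "fst s' h = H"
    using exec_wr[OF e(1)] wr j by auto
  have "(H - j) * (K + 8) = (H - Suc j) * (K + 8) + (K + 8)"
    using \<open>j < H\<close> by (metis Suc_diff_Suc add.commute mult_Suc)
  then show "runs (P;; inc r) s
          (\<lambda>\<tau> s'. (\<exists>j. l \<le> j \<and> j \<le> H \<and> fst s' r = j \<and> fst s' h = H \<and> I j s') \<and>
                  \<tau> + (1 + cost (Sub (Reg h) (Reg r))) + (H - fst s' r) * (K + 8)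
                  \<le> (H - fst s r) * (K + 8))"
    unfolding runs_Seq runs_inc
    by (subst runs_exec[OF e(1)]) (use e f j wr(3) in auto)
next
  fix \<tau> s' assume "\<exists>j. l \<le> j \<and> j \<le> H \<and> fst s' r = j \<and> fst s' h = H \<and> I j s'"
    "val (Sub (Reg h) (Reg r)) s' = 0"
    "\<tau> + (H - fst s' r) * (K + 8) \<le> (H - fst s r) * (K + 8) + (1 + cost (Sub (Reg h) (Reg r)))"
  then have "fst s' r = H" "fst s' h = H" "I H s'" "\<tau> \<le> (H - l) * (K + 8) + 4"
    using lo(1) by auto
  then show "Q \<tau> s'" by (rule post)
qed

lemma runs_While_unfold:
  "runs (While b P) s Q \<longleftrightarrow>
     (if val b s \<noteq> 0 then runs P s (\<lambda>\<tau> s'. runs (While b P) s' (\<lambda>\<sigma>. Q (1 + cost b + \<tau> + \<sigma>)))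
      else Q (1 + cost b) s)"
proof (cases "val b s = 0")
  case True
  then show ?thesis by (simp add: runs_exec[OF exec_While_false])
next
  case False
  have "(\<exists>\<tau> s'. exec (While b P) s \<tau> s' \<and> Q \<tau> s') \<longleftrightarrow>
     (\<exists>\<tau> s1. exec P s \<tau> s1 \<and> (\<exists>\<sigma> s'. exec (While b P) s1 \<sigma> s' \<and> Q (1 + cost b + \<tau> + \<sigma>) s'))"
    (is "?l = ?r")
  proof
    assume ?l
    then obtain \<tau> s' where "exec (While b P) s \<tau> s'" "Q \<tau> s'" by blast
    from this(1) show ?r
    proof (rule exec_WhileE)
      fix \<tau>1 s1 \<tau>2
      assume "\<tau> = Suc (cost b + \<tau>1 + \<tau>2)" "exec P s \<tau>1 s1" "exec (While b P) s1 \<tau>2 s'"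
      moreover from this have "Q (1 + cost b + \<tau>1 + \<tau>2) s'" using \<open>Q \<tau> s'\<close> by simp
      ultimately show ?r by blast
    qed (use False in simp)
  next
    assume ?r
    then show ?l using exec_While_true[OF False] by blast
  qed
  then show ?thesis using False by (simp add: runs_def)
qed

section \<open>Closed sets of terms\<close>

text \<open>
  A term is represented by the address \<open>h\<close> of its length cell, an occurrence of a variable by its
  address in the input.  The absent second term of a clause is \<open>h = 0\<close>, where after
  preprocessing a term consisting of the single variable \<open>0\<close> is stored; this variable counts as
  used from the start.
\<close>

definition ad :: "(nat \<Rightarrow> nat) \<Rightarrow> nat \<Rightarrow> nat set" where
  "ad M h = {Suc h..h + M h}"

fun chain :: "(nat \<Rightarrow> nat) \<Rightarrow> nat \<Rightarrow> nat list \<Rightarrow> bool" where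
  "chain f q [] \<longleftrightarrow> q = 0"
| "chain f q (p # L) \<longleftrightarrow> q = p \<and> p \<noteq> 0 \<and> chain f (f p) L"

definition push :: prog where
  "push = If (neq (Mem (addr aInq (Reg rO))) (Reg rStamp))
     (Store (addr aInq (Reg rO)) (Reg rStamp) ;;
      Store (addr aQueue (Reg rQt)) (Reg rO) ;; inc rQt) Skip"

definition visit :: prog where
  "visit = While (Reg rQ)
     (If (neq (Reg rQ) (Reg rP)) (Assign rO (Mem (addr aOpp (Reg rQ))) ;; push) Skip ;;
      Assign rQ (Mem (addr aNext (Reg rQ))))"

definition mark_var :: prog where
  "mark_var = Assign rV (Mem (Reg rP)) ;;
     If (neq (Mem (addr aMark (Reg rV))) (Reg rStamp))
       (Store (addr aMark (Reg rV)) (Reg rStamp) ;; Assign rQ (Mem (addr aHead (Reg rV))) ;; visit)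
       (Assign rConf (Const 1))"

definition mark_term :: prog where
  "mark_term = Assign rP (Mem (addr aQueue (Reg rQh))) ;;
     Assign rE (Add (Add (Mem (Reg rP)) (Reg rP)) (Const 1)) ;; inc rP ;; loop rP rE mark_var"

definition propagate :: prog where
  "propagate = While (Sub (Reg rQt) (Reg rQh)) (mark_term ;; inc rQh)"

text \<open>
  Marks and queue membership are recorded as the current value of a stamp that grows with every
  run, so the tables are never cleared.
\<close>

definition check :: prog where
  "check = inc rStamp ;; Assign rConf (Const 0) ;; Assign rQh (Const 0) ;; Assign rQt (Const 0) ;;
     Store (addr aMark (Const 0)) (Reg rStamp) ;; Assign rO (Reg rX) ;; push ;;
     Assign rO (Reg rH) ;; push ;; propagate"

lemma wr_push [simp]: "wr push = {rQt}" by (simp add: push_def)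
lemma sto_push [simp]: "{aInq, aQueue} \<subseteq> A \<Longrightarrow> sto A push" by (simp add: push_def)
lemma wr_visit [simp]: "wr visit = {rO, rQt, rQ}" by (auto simp: visit_def)
lemma sto_visit [simp]: "{aInq, aQueue} \<subseteq> A \<Longrightarrow> sto A visit" by (simp add: visit_def)
lemma wr_mark_var [simp]: "wr mark_var = {rConf, rO, rQt, rQ, rV}" by (auto simp: mark_var_def)
lemma sto_mark_var [simp]: "{aMark, aInq, aQueue} \<subseteq> A \<Longrightarrow> sto A mark_var" by (simp add: mark_var_def)
lemma wr_mark_term [simp]: "wr mark_term = {rP, rE, rConf, rO, rQt, rQ, rV}"
  by (auto simp: mark_term_def)
lemma sto_mark_term [simp]: "{aMark, aInq, aQueue} \<subseteq> A \<Longrightarrow> sto A mark_term"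
  by (simp add: mark_term_def)
lemma wr_propagate [simp]: "wr propagate = {rQh, rP, rE, rConf, rO, rQt, rQ, rV}"
  by (auto simp: propagate_def)
lemma sto_propagate [simp]: "{aMark, aInq, aQueue} \<subseteq> A \<Longrightarrow> sto A propagate"
  by (simp add: propagate_def)
lemma wr_check [simp]: "wr check = {rStamp, rQh, rP, rE, rConf, rO, rQt, rQ, rV}"
  by (auto simp: check_def)
lemma sto_check [simp]: "{aMark, aInq, aQueue} \<subseteq> A \<Longrightarrow> sto A check"
  by (simp add: check_def)

definition ins :: "'a \<Rightarrow> 'a list \<Rightarrow> 'a list" where
  "ins x Q = (if x \<in> set Q then Q else Q @ [x])"

definition qinv :: "state \<Rightarrow> nat list \<Rightarrow> bool" where
  "qinv s Q \<longleftrightarrow> fst s rQt = length Q \<and> (\<forall>i < length Q. snd s (ix (fst s rB) aQueue i) = Q ! i) \<and>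
     (\<forall>h. snd s (ix (fst s rB) aInq h) = fst s rStamp \<longleftrightarrow> h \<in> set Q) \<and>
     (\<forall>h. snd s (ix (fst s rB) aInq h) \<le> fst s rStamp) \<and> distinct Q"

definition minv :: "state \<Rightarrow> nat set \<Rightarrow> bool" where
  "minv s K \<longleftrightarrow> (\<forall>x. snd s (ix (fst s rB) aMark x) = fst s rStamp \<longleftrightarrow> x \<in> K) \<and>
     (\<forall>x. snd s (ix (fst s rB) aMark x) \<le> fst s rStamp)"

lemma runs_push:
  assumes "qinv s Q"
  shows "runs push s (\<lambda>\<tau> s'. \<tau> \<le> 160 \<and> qinv s' (ins (fst s rO) Q))"
  using assms unfolding push_def
  by (auto simp: runs_simps runs_inc qinv_def ins_def nth_append less_Suc_eq)

locale inst =
  fixes M :: "nat \<Rightarrow> nat" and B X :: nat and Tm :: "nat set" and mate opp :: "nat \<Rightarrow> nat"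
  assumes finTm: "finite Tm" and zero_Tm: "0 \<notin> Tm" and X_Tm: "X \<notin> Tm" and X_pos: "X \<noteq> 0"
    and disj: "\<And>h h'. h \<in> insert 0 (insert X Tm) \<Longrightarrow> h' \<in> insert 0 (insert X Tm) \<Longrightarrow> h \<noteq> h' \<Longrightarrow>
                  ad M h \<inter> ad M h' = {}"
    and low: "\<And>h. h \<in> insert 0 (insert X Tm) \<Longrightarrow> h + M h < B"
    and M0: "M 0 = Suc 0" and M1: "M (Suc 0) = 0"
    and mate: "\<And>h. h \<in> Tm \<Longrightarrow> mate h \<in> insert 0 Tm"
    and mate_mate: "\<And>h. h \<in> Tm \<Longrightarrow> mate h \<noteq> 0 \<Longrightarrow> mate (mate h) = h"
    and opp: "\<And>h q. h \<in> Tm \<Longrightarrow> q \<in> ad M h \<Longrightarrow> opp q = mate h"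
begin

abbreviation cells :: "nat set \<Rightarrow> nat set" where "cells G \<equiv> (\<Union>h\<in>G. ad M h)"

abbreviation "Hdr \<equiv> insert 0 (insert X Tm)"
abbreviation "Occ \<equiv> cells Tm"

definition good :: "nat set \<Rightarrow> bool" where
  "good G \<longleftrightarrow> G \<subseteq> insert X Tm \<and> X \<in> G \<and> inj_on M (cells G) \<and> 0 \<notin> M ` cells G \<and>
     (\<forall>p\<in>cells G. \<forall>q\<in>Occ. q \<noteq> p \<longrightarrow> M q = M p \<longrightarrow> opp q \<in> G)"

lemma ad0: "ad M 0 = {Suc 0}" by (auto simp: ad_def M0)

lemma opp_Occ: "q \<in> Occ \<Longrightarrow> opp q \<in> insert 0 Tm"
proof -
  assume "q \<in> Occ"
  then obtain h where "h \<in> Tm" "q \<in> ad M h" by blast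
  then show ?thesis using opp[of h q] mate[of h] by simp
qed

lemma finOcc: "finite Occ" using finTm by (auto simp: ad_def)

lemma zero_notin_good: "good G \<Longrightarrow> 0 \<notin> G"
  using zero_Tm X_pos by (auto simp: good_def)

lemma good_inj: "good G \<Longrightarrow> g \<in> G \<Longrightarrow> p \<in> ad M g \<Longrightarrow> g' \<in> G \<Longrightarrow> q \<in> ad M g' \<Longrightarrow> M p = M q \<Longrightarrow> p = q"
  unfolding good_def inj_on_def by blast

lemma good_nonzero: "good G \<Longrightarrow> g \<in> G \<Longrightarrow> p \<in> ad M g \<Longrightarrow> M p \<noteq> 0"
  unfolding good_def by fastforce

lemma good_mate:
  assumes "good G" "g \<in> G" "p \<in> ad M g" "h \<in> Tm" "q \<in> ad M h" "q \<noteq> p" "M q = M p"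
  shows "mate h \<in> G"
proof -
  have "p \<in> cells G" "q \<in> Occ" using assms by blast+
  then have "opp q \<in> G" using assms unfolding good_def by simp
  then show ?thesis using opp assms by simp
qed

lemma goodI:
  assumes "G \<subseteq> insert X Tm" "X \<in> G"
    and "\<And>g p g' q. g \<in> G \<Longrightarrow> p \<in> ad M g \<Longrightarrow> g' \<in> G \<Longrightarrow> q \<in> ad M g' \<Longrightarrow> M p = M q \<Longrightarrow> p = q"
    and "\<And>g p. g \<in> G \<Longrightarrow> p \<in> ad M g \<Longrightarrow> M p \<noteq> 0"
    and "\<And>g p h q. g \<in> G \<Longrightarrow> p \<in> ad M g \<Longrightarrow> h \<in> Tm \<Longrightarrow> q \<in> ad M h \<Longrightarrow> q \<noteq> p \<Longrightarrow> M q = M p \<Longrightarrow> mate h \<in> G"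
  shows "good G"
  unfolding good_def
proof (intro conjI ballI impI)
  show "inj_on M (cells G)" by (rule inj_onI) (use assms(3) in blast)
  show "0 \<notin> M ` cells G" using assms(4) by fastforce
  fix p q assume "p \<in> cells G" "q \<in> Occ" and pq: "q \<noteq> p" "M q = M p"
  then obtain g h where gh: "g \<in> G" "p \<in> ad M g" "h \<in> Tm" "q \<in> ad M h" by blast
  show "opp q \<in> G" using assms(5)[OF gh pq] opp[OF gh(3,4)] by simp
qed (rule assms)+

text \<open>Terms of \<open>R\<close> whose mate already lies in the closed set \<open>S\<close> are dropped; whatever remains
  cannot clash with \<open>S\<close>, since a clash would force that mate into \<open>S\<close>.\<close>

lemma good_merge:
  assumes S: "good S" and R: "good R"
  shows "good (S \<union> {g\<in>R. mate g \<notin> S})" (is "good ?U")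
proof -
  have sub: "S \<subseteq> insert X Tm" "R \<subseteq> insert X Tm" "X \<in> S" using S R by (simp_all add: good_def)
  have Tm: "g \<in> Tm" if "g \<in> R" "g \<notin> S" for g using that sub by blast
  have clash: False if g: "g \<in> S" "p \<in> ad M g" "g' \<in> R" "q \<in> ad M g'" "mate g' \<notin> S" "g' \<notin> S"
      "M p = M q" for p q g g'
  proof -
    have "g \<noteq> g'" using g by blast
    then have "ad M g \<inter> ad M g' = {}" using sub g by (intro disj) blast+
    then have "q \<noteq> p" using g by blast
    then show False using good_mate[OF S g(1,2) Tm[OF g(3,6)] g(4)] g by simp
  qed
  show ?thesis
  proof (rule goodI)
    fix g p g' q
    assume g: "g \<in> ?U" "p \<in> ad M g" "g' \<in> ?U" "q \<in> ad M g'" "M p = M q"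
    consider "g \<in> S" "g' \<in> S" | "g \<in> R" "g' \<in> R" | "g \<in> S" "g' \<in> R" "mate g' \<notin> S" "g' \<notin> S"
      | "g' \<in> S" "g \<in> R" "mate g \<notin> S" "g \<notin> S"
      using g(1,3) by blast
    then show "p = q"
    proof cases
      case 1 then show ?thesis using good_inj[OF S _ g(2) _ g(4,5)] by blast
    next
      case 2 then show ?thesis using good_inj[OF R _ g(2) _ g(4,5)] by blast
    next
      case 3 then show ?thesis using clash[OF 3(1) g(2) 3(2) g(4) 3(3,4) g(5)] by blast
    next
      case 4 then show ?thesis using clash[OF 4(1) g(4) 4(2) g(2) 4(3,4) g(5)[symmetric]] by blast
    qed
  next
    fix g p assume g: "g \<in> ?U" "p \<in> ad M g"
    then show "M p \<noteq> 0" using good_nonzero[OF S _ g(2)] good_nonzero[OF R _ g(2)] by blast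
  next
    fix g p h q assume g: "g \<in> ?U" "p \<in> ad M g" "h \<in> Tm" "q \<in> ad M h" "q \<noteq> p" "M q = M p"
    show "mate h \<in> ?U"
    proof (cases "g \<in> S")
      case True
      then show ?thesis using good_mate[OF S _ g(2-6)] by blast
    next
      case False
      then have gR: "g \<in> R" "mate g \<notin> S" using g(1) by auto
      have hR: "mate h \<in> R" by (rule good_mate[OF R gR(1) g(2-6)])
      then have "mate h \<noteq> 0" using zero_notin_good[OF R] by metis
      moreover have "h \<notin> S"
        using good_mate[OF S _ g(4) Tm[OF gR(1) False] g(2)] g(5,6) gR(2) by auto
      ultimately show ?thesis using hR mate_mate[OF g(3)] by simp
    qed
  qed (use sub in auto)
qed

lemma good_all:
  assumes "good S0"
    and "\<And>u v. (u, v) \<in> set ps \<Longrightarrow> \<exists>R. good R \<and> (u \<in> R \<or> v \<in> R)"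
    and "\<And>u v. (u, v) \<in> set ps \<Longrightarrow> {u, v} \<subseteq> insert 0 Tm \<and> (u \<in> Tm \<longrightarrow> mate u = v) \<and> (v \<in> Tm \<longrightarrow> mate v = u)"
  shows "\<exists>S. good S \<and> (\<forall>(u, v)\<in>set ps. u \<in> S \<or> v \<in> S)"
  using assms(2,3)
proof (induction ps)
  case Nil
  show ?case using assms(1) by (intro exI[of _ S0]) simp
next
  case (Cons c ps)
  obtain u v where c: "c = (u, v)" by fastforce
  then have uv: "(u, v) \<in> set (c # ps)" by simp
  have "\<exists>S. good S \<and> (\<forall>(u, v)\<in>set ps. u \<in> S \<or> v \<in> S)"
    by (rule Cons.IH) (rule Cons.prems(1) Cons.prems(2), rule list.set_intros(2), assumption)+
  then obtain S where S: "good S" "\<forall>(u, v)\<in>set ps. u \<in> S \<or> v \<in> S" by blast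
  show ?case
  proof (cases "u \<in> S \<or> v \<in> S")
    case True
    then show ?thesis using S c by auto
  next
    case False
    obtain R where R: "good R" "u \<in> R \<or> v \<in> R" using Cons.prems(1)[OF uv] by blast
    let ?U = "S \<union> {g\<in>R. mate g \<notin> S}"
    have "0 \<notin> R" using R by (simp add: zero_notin_good)
    note m = Cons.prems(2)[OF uv, THEN conjunct2]
    have Tm: "x \<in> Tm" if "x \<in> R" "x = u \<or> x = v" for x
      using Cons.prems(2)[OF uv, THEN conjunct1] that \<open>0 \<notin> R\<close> by blast
    have "u \<in> ?U" if "u \<in> R"
      using m[THEN conjunct1, rule_format, OF Tm[OF that]] that False by simp
    moreover have "v \<in> ?U" if "v \<in> R"
      using m[THEN conjunct2, rule_format, OF Tm[OF that]] that False by simp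
    ultimately have "u \<in> ?U \<or> v \<in> ?U" using R(2) by blast
    then have "\<forall>(u, v)\<in>set (c # ps). u \<in> ?U \<or> v \<in> ?U" using S(2) unfolding c by fastforce
    moreover have "good ?U" using good_merge S R by blast
    ultimately show ?thesis by blast
  qed
qed

end

section \<open>Unit propagation\<close>

context inst begin

definition occ_list :: "state \<Rightarrow> nat \<Rightarrow> nat list \<Rightarrow> bool" where
  "occ_list s x L \<longleftrightarrow> chain (\<lambda>p. snd s (ix B aNext p)) (snd s (ix B aHead x)) L \<and>
     distinct L \<and> set L = {q\<in>Occ. M q = x}"

definition env :: "state \<Rightarrow> bool" where
  "env s \<longleftrightarrow> fst s rB = B \<and> fst s rX = X \<and> (\<forall>a<B. snd s a = M a) \<and>
     (\<forall>p\<in>Occ. snd s (ix B aOpp p) = opp p) \<and> (\<forall>x. x \<noteq> 0 \<longrightarrow> (\<exists>L. occ_list s x L))"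

lemma env_cong:
  assumes "env s" "fst s' rB = B" "fst s' rX = X" "\<And>a. a < B \<Longrightarrow> snd s' a = snd s a"
    "\<And>c i. c \<in> {aOpp, aNext, aHead} \<Longrightarrow> snd s' (ix B c i) = snd s (ix B c i)"
  shows "env s'"
proof -
  have "occ_list s' x L = occ_list s x L" for x L
    using assms(5) by (simp add: occ_list_def)
  then show ?thesis using assms by (simp add: env_def)
qed

lemma env_frame:
  assumes "frame W A s s'" "env s" "rB \<notin> W" "rX \<notin> W" "aOpp \<notin> A" "aNext \<notin> A" "aHead \<notin> A"
  shows "env s'"
  by (rule env_cong[OF assms(2)]) (use assms in \<open>auto simp: frame_def env_def\<close>)

lemma env_reg [simp]: "r \<noteq> rB \<Longrightarrow> r \<noteq> rX \<Longrightarrow> env (f(r := v), m) \<longleftrightarrow> env (f, m)"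
  by (simp add: env_def occ_list_def)

lemma env_mem [simp]:
  "f rB = B \<Longrightarrow> c < 16 \<Longrightarrow> c \<notin> {aOpp, aNext, aHead} \<Longrightarrow> env (f, m(ix B c i := v)) \<longleftrightarrow> env (f, m)"
  by (simp add: env_def occ_list_def)

lemma runs_visit:
  assumes "env s" "qinv s Q" "chain (\<lambda>p. snd s (ix B aNext p)) (fst s rQ) L" "set L \<subseteq> Occ"
  shows "runs visit s (\<lambda>\<tau> s'. \<tau> \<le> 250 * length L + 10 \<and>
           (\<exists>E. qinv s' (Q @ E) \<and> set (Q @ E) = set Q \<union> opp ` (set L - {fst s rP})))"
  using assms
proof (induction L arbitrary: s Q)
  case Nil
  then show ?case unfolding visit_def
    by (subst runs_While_unfold) (auto intro!: exI[of _ "[]"])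
next
  case (Cons p L)
  have p: "fst s rQ = p" "p \<noteq> 0" "chain (\<lambda>p. snd s (ix B aNext p)) (snd s (ix B aNext p)) L"
    "p \<in> Occ" "set L \<subseteq> Occ" using Cons.prems by auto
  let ?body = "If (neq (Reg rQ) (Reg rP)) (Assign rO (Mem (addr aOpp (Reg rQ))) ;; push) Skip ;;
      Assign rQ (Mem (addr aNext (Reg rQ)))"
  have B: "fst s rB = B" "snd s (ix B aOpp p) = opp p" using Cons.prems(1) p by (auto simp: env_def)
  have q1: "qinv ((fst s)(rO := v), snd s) Q" for v using Cons.prems(2) by (simp add: qinv_def)
  have q2: "qinv ((fst s')(rQ := v), snd s') Q' = qinv s' Q'" for s' Q' v by (simp add: qinv_def)
  have body: "runs ?body s (\<lambda>\<tau> s'. \<tau> \<le> 245 \<and> fst s' rQ = snd s (ix B aNext p) \<and>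
     (\<exists>E. qinv s' (Q @ E) \<and> set (Q @ E) = set Q \<union> opp ` ({p} - {fst s rP})))"
  proof (cases "p = fst s rP")
    case True
    then show ?thesis using p B Cons.prems(2)
      by (auto simp: runs_simps q2 intro!: exI[of _ "[]"])
  next
    case False
    have "\<exists>E. ins (opp p) Q = Q @ E \<and> set (Q @ E) = set Q \<union> {opp p}" by (auto simp: ins_def)
    then obtain E where E: "ins (opp p) Q = Q @ E" "set (Q @ E) = set Q \<union> {opp p}" by blast
    have "runs push ((fst s)(rO := opp p), snd s)
       (\<lambda>\<tau> s'. \<tau> \<le> 160 \<and> qinv s' (Q @ E) \<and> fst s' rB = B \<and> fst s' rQ = p \<and>
          snd s' (ix B aNext p) = snd s (ix B aNext p))"
      by (rule runs_frame[OF runs_push[OF q1], where W = "{rQt}" and A = "{aInq, aQueue}"])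
        (use p B E(1) in \<open>auto simp: frame_def\<close>)
    then show ?thesis
      using False p B E(2) by (auto simp: runs_simps q2 elim!: runs_mono intro!: exI[of _ E])
  qed
  have step: "runs visit s' (\<lambda>\<sigma> s''. 1 + cost (Reg rQ) + \<tau> + \<sigma> \<le> 250 * length (p # L) + 10 \<and>
      (\<exists>E. qinv s'' (Q @ E) \<and> set (Q @ E) = set Q \<union> opp ` (set (p # L) - {fst s rP})))"
    if *: "\<tau> \<le> 245" "fst s' rQ = snd s (ix B aNext p)" "qinv s' (Q @ E)"
      "set (Q @ E) = set Q \<union> opp ` ({p} - {fst s rP})"
      "frame {rO, rQt, rQ} {aInq, aQueue} s s'" for \<tau> s' E
  proof -
    have "env s'" using env_frame[OF *(5) Cons.prems(1)] by simp
    moreover have "snd s' (ix B aNext q) = snd s (ix B aNext q)" for q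
      using *(5) B by (simp add: frame_def)
    ultimately have "runs visit s' (\<lambda>\<tau> s''. \<tau> \<le> 250 * length L + 10 \<and>
           (\<exists>F. qinv s'' ((Q @ E) @ F) \<and> set ((Q @ E) @ F) = set (Q @ E) \<union> opp ` (set L - {fst s' rP})))"
      using Cons.IH[of s' "Q @ E"] *(2,3) p by simp
    moreover have "fst s' rP = fst s rP" using *(5) by (simp add: frame_def)
    ultimately show ?thesis
    proof (elim runs_mono, elim conjE exE, intro conjI exI)
      fix \<sigma> s'' F
      assume a: "\<sigma> \<le> 250 * length L + 10" "qinv s'' ((Q @ E) @ F)" "fst s' rP = fst s rP"
        "set ((Q @ E) @ F) = set (Q @ E) \<union> opp ` (set L - {fst s' rP})"
      show "1 + cost (Reg rQ) + \<tau> + \<sigma> \<le> 250 * length (p # L) + 10" using a *(1) by simp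
      show "qinv s'' (Q @ (E @ F))" using a by simp
      show "set (Q @ (E @ F)) = set Q \<union> opp ` (set (p # L) - {fst s rP})"
        using a(3,4) *(4) by auto
    qed
  qed
  show ?case
    unfolding visit_def
    apply (subst runs_While_unfold)
    using p
    apply simp
    apply (rule runs_frame[OF body, where W = "{rO, rQt, rQ}" and A = "{aInq, aQueue}"])
    using step[unfolded visit_def] by auto
qed

definition invar :: "nat \<Rightarrow> nat set \<Rightarrow> nat set \<Rightarrow> nat set \<Rightarrow> nat \<Rightarrow> bool" where
  "invar h S P K c \<longleftrightarrow> {X, h} \<subseteq> S \<and> S \<subseteq> Hdr \<and> P \<subseteq> cells S \<and> 0 \<in> K \<and>
     (c = 0 \<longrightarrow> K = insert 0 (M ` P) \<and> inj_on M P \<and> 0 \<notin> M ` P \<and>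
        (\<forall>p\<in>P. \<forall>q\<in>Occ. q \<noteq> p \<longrightarrow> M q = M p \<longrightarrow> opp q \<in> S)) \<and>
     (\<forall>G. good G \<longrightarrow> h \<in> G \<longrightarrow> S \<subseteq> G \<and> c = 0)"

lemma invar_clash:
  assumes J: "invar h S P K c" and g: "g \<in> S" "p \<in> ad M g" "p \<notin> P" "M p \<in> K"
  shows "invar h S (insert p P) K 1"
proof -
  have "\<not> (good G \<and> h \<in> G)" for G
  proof
    assume G: "good G \<and> h \<in> G"
    then have S: "S \<subseteq> G" and "K = insert 0 (M ` P)" and P: "P \<subseteq> cells S"
      using J by (auto simp: invar_def)
    then consider "M p = 0" | p' where "p' \<in> P" "M p = M p'" using g(4) by auto
    then show False
    proof cases
      case 1
      then show ?thesis using good_nonzero[OF conjunct1[OF G], of g p] S g by blast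
    next
      case 2
      then obtain g' where "g' \<in> S" "p' \<in> ad M g'" using P by blast
      then have "p = p'" using good_inj[OF conjunct1[OF G], of g p g' p'] S g 2 by blast
      then show ?thesis using 2 g by blast
    qed
  qed
  then show ?thesis using J g(1,2) unfolding invar_def by auto
qed

lemma invar_new:
  assumes J: "invar h S P K c" and g: "g \<in> S" "p \<in> ad M g" "p \<notin> P" "M p \<notin> K"
    and S': "S' = S \<union> opp ` ({q\<in>Occ. M q = M p} - {p})"
  shows "invar h S' (insert p P) (insert (M p) K) c"
  unfolding invar_def
proof (intro conjI impI allI)
  show "{X, h} \<subseteq> S'" "0 \<in> insert (M p) K" using J S' by (auto simp: invar_def)
  have "S \<subseteq> Hdr" using J by (simp add: invar_def)
  moreover have "opp q \<in> Hdr" if "q \<in> {q\<in>Occ. M q = M p} - {p}" for q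
  proof -
    have "q \<in> Occ" using that by blast
    from opp_Occ[OF this] show ?thesis by blast
  qed
  ultimately show "S' \<subseteq> Hdr" unfolding S' by (intro Un_least image_subsetI)
  show "insert p P \<subseteq> cells S'" using J g S' by (auto simp: invar_def)
  assume c: "c = 0"
  then have K: "K = insert 0 (M ` P)" "inj_on M P" "0 \<notin> M ` P"
      "\<forall>p\<in>P. \<forall>q\<in>Occ. q \<noteq> p \<longrightarrow> M q = M p \<longrightarrow> opp q \<in> S"
    using J by (auto simp: invar_def)
  show "insert (M p) K = insert 0 (M ` insert p P)" using K by auto
  show "inj_on M (insert p P)" using K g by auto
  show "0 \<notin> M ` insert p P" using K g by auto
  show "\<forall>p\<in>insert p P. \<forall>q\<in>Occ. q \<noteq> p \<longrightarrow> M q = M p \<longrightarrow> opp q \<in> S'"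
    using K(4) S' by blast
next
  fix G assume G: "good G" "h \<in> G"
  then have S: "S \<subseteq> G" "c = 0" using J by (auto simp: invar_def)
  have "opp q \<in> G" if "q \<in> Occ" "q \<noteq> p" "M q = M p" for q
  proof -
    obtain k where "k \<in> Tm" "q \<in> ad M k" using \<open>q \<in> Occ\<close> by blast
    then show ?thesis using good_mate[OF G(1), of g p k q] g S that opp by auto
  qed
  then show "S' \<subseteq> G" using S S' by blast
  show "c = 0" by fact
qed

lemma invar_done:
  assumes J: "invar h S (cells S) K c"
  shows "c = 0 \<longleftrightarrow> (\<exists>G. good G \<and> h \<in> G)"
proof
  assume "c = 0"
  then have *: "inj_on M (cells S)" "0 \<notin> M ` cells S"
    "\<forall>p\<in>cells S. \<forall>q\<in>Occ. q \<noteq> p \<longrightarrow> M q = M p \<longrightarrow> opp q \<in> S" "{X, h} \<subseteq> S" "S \<subseteq> Hdr"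
    using J by (auto simp: invar_def)
  have "0 \<notin> S"
  proof
    assume "0 \<in> S"
    then have "Suc 0 \<in> cells S" using ad0 by blast
    then show False using *(2) M1 by force
  qed
  then have "good S" using * unfolding good_def by auto
  then show "\<exists>G. good G \<and> h \<in> G" using * by auto
qed (use J in \<open>auto simp: invar_def\<close>)

definition unmarked :: "state \<Rightarrow> nat" where
  "unmarked s = card {q\<in>Occ. snd s (ix B aMark (M q)) \<noteq> fst s rStamp}"

lemma unmarked_minv: "minv s K \<Longrightarrow> fst s rB = B \<Longrightarrow> unmarked s = card {q\<in>Occ. M q \<notin> K}"
  by (simp add: unmarked_def minv_def)

lemma runs_mark_var:
  assumes "env s" "qinv s Q" "minv s K" "invar h (set Q) P K (fst s rConf)"
    and g: "g \<in> set Q" "fst s rP \<in> ad M g" "fst s rP \<notin> P"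
  shows "runs mark_var s (\<lambda>\<tau> s'. \<tau> + 250 * unmarked s' \<le> 200 + 250 * unmarked s \<and>
     (\<exists>E K'. qinv s' (Q @ E) \<and> minv s' K' \<and>
             invar h (set (Q @ E)) (insert (fst s rP) P) K' (fst s' rConf)))"
proof -
  let ?p = "fst s rP" let ?x = "M ?p"
  have "g \<in> Hdr" using assms(4) g by (auto simp: invar_def)
  then have "?p < B" using low[of g] g by (auto simp: ad_def)
  then have x: "snd s ?p = ?x" and B: "fst s rB = B" using assms(1) by (auto simp: env_def)
  have mk: "snd s (ix B aMark y) = fst s rStamp \<longleftrightarrow> y \<in> K" for y
    using assms(3) B by (simp add: minv_def)
  show ?thesis
  proof (cases "?x \<in> K")
    case True
    have J: "invar h (set Q) (insert ?p P) K 1" using invar_clash[OF assms(4) g True] .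
    have "qinv ((fst s)(rV := ?x, rConf := Suc 0), snd s) Q"
      "minv ((fst s)(rV := ?x, rConf := Suc 0), snd s) K"
      "unmarked ((fst s)(rV := ?x, rConf := Suc 0), snd s) = unmarked s"
      using assms(2,3) by (auto simp: qinv_def minv_def unmarked_def)
    then show ?thesis unfolding mark_var_def using True J
      by (simp add: runs_simps x B mk) (rule exI[of _ "[]"], auto)
  next
    case False
    have "0 \<in> K" using assms(4) by (simp add: invar_def)
    then have "?x \<noteq> 0" using False by metis
    then obtain L where L: "occ_list s ?x L" using assms(1) unfolding env_def by blast
    have setL: "set L = {q\<in>Occ. M q = ?x}" "distinct L" using L by (auto simp: occ_list_def)
    let ?s = "((fst s)(rV := ?x, rQ := snd s (ix B aHead ?x)), (snd s)(ix B aMark ?x := fst s rStamp))"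
    let ?K = "insert ?x K"
    have s: "env ?s" "qinv ?s Q" "minv ?s ?K"
      using assms(1-3) B by (auto simp: qinv_def minv_def)
    have ch: "chain (\<lambda>p. snd ?s (ix B aNext p)) (fst ?s rQ) L" "set L \<subseteq> Occ"
      using L by (auto simp: occ_list_def)
    have card: "card {q\<in>Occ. M q \<notin> K} = card {q\<in>Occ. M q \<notin> ?K} + length L"
    proof -
      have "{q\<in>Occ. M q \<notin> K} = {q\<in>Occ. M q \<notin> ?K} \<union> set L" using setL False by auto
      moreover have "{q\<in>Occ. M q \<notin> ?K} \<inter> set L = {}" using setL by auto
      moreover have "finite {q\<in>Occ. M q \<notin> ?K}" by (rule finite_subset[OF _ finOcc]) auto
      ultimately show ?thesis
        using card_Un_disjoint[of _ "set L"] distinct_card[OF setL(2)] by (metis List.finite_set)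
    qed
    have "runs visit ?s (\<lambda>\<tau> s'. 160 + \<tau> + 250 * unmarked s' \<le> 200 + 250 * unmarked s \<and>
     (\<exists>E K'. qinv s' (Q @ E) \<and> minv s' K' \<and> invar h (set (Q @ E)) (insert ?p P) K' (fst s' rConf)))"
    proof (rule runs_frame[OF runs_visit[OF s(1,2) ch], where W = "{rO, rQt, rQ}" and A = "{aInq, aQueue}"])
      fix \<tau> s'
      assume a: "\<tau> \<le> 250 * length L + 10 \<and>
           (\<exists>E. qinv s' (Q @ E) \<and> set (Q @ E) = set Q \<union> opp ` (set L - {fst ?s rP}))"
        and fr: "frame {rO, rQt, rQ} {aInq, aQueue} ?s s'"
      then obtain E where E: "qinv s' (Q @ E)" "set (Q @ E) = set Q \<union> opp ` (set L - {?p})" by auto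
      have c: "fst s' rConf = fst s rConf" "fst s' rB = B" using fr B by (auto simp: frame_def)
      have K: "minv s' ?K" using s(3) fr B by (simp add: minv_def frame_def)
      have "invar h (set (Q @ E)) (insert ?p P) ?K (fst s' rConf)"
        unfolding c by (rule invar_new[OF assms(4) g False]) (simp only: E(2) setL)
      then have ex: "\<exists>E K'. qinv s' (Q @ E) \<and> minv s' K' \<and>
          invar h (set (Q @ E)) (insert ?p P) K' (fst s' rConf)"
        using E(1) K by blast
      have "unmarked s = unmarked s' + length L"
        using unmarked_minv[OF assms(3) B] unmarked_minv[OF K c(2)] card by simp
      then have "160 + \<tau> + 250 * unmarked s' \<le> 200 + 250 * unmarked s"
        using conjunct1[OF a] by simp
      then show "160 + \<tau> + 250 * unmarked s' \<le> 200 + 250 * unmarked s \<and>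
     (\<exists>E K'. qinv s' (Q @ E) \<and> minv s' K' \<and> invar h (set (Q @ E)) (insert ?p P) K' (fst s' rConf))"
        using ex by (rule conjI)
    qed auto
    then show ?thesis unfolding mark_var_def using False
      by (auto simp: runs_simps x B mk elim!: runs_mono)
  qed
qed

lemma runs_mark_term:
  assumes s: "env s" "qinv s Q" "minv s K" "fst s rQh < length Q"
    and J: "invar h (set Q) (cells (set (take (fst s rQh) Q))) K (fst s rConf)"
    and W: "\<And>h. h \<in> Hdr \<Longrightarrow> M h \<le> W"
  shows "runs mark_term s (\<lambda>\<tau> s'. \<tau> + 250 * unmarked s' \<le> 60 + 210 * W + 250 * unmarked s \<and>
     (\<exists>E K'. qinv s' (Q @ E) \<and> minv s' K' \<and>
        invar h (set (Q @ E)) (cells (set (take (Suc (fst s rQh)) (Q @ E)))) K' (fst s' rConf)))"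
proof -
  let ?i = "fst s rQh"
  define g where "g = Q ! ?i"
  define P where "P = cells (set (take ?i Q))"
  have gQ: "g \<in> set Q" using s(4) by (simp add: g_def)
  then have gH: "g \<in> Hdr" using J by (auto simp: invar_def)
  have B: "fst s rB = B" "snd s (ix B aQueue ?i) = g" "snd s g = M g"
    using s low[OF gH] by (auto simp: env_def qinv_def g_def)
  have g_fresh: "g \<notin> set (take ?i Q)"
    using s(2,4) unfolding g_def qinv_def
    by (auto simp: in_set_conv_nth nth_eq_iff_index_eq)
  have P_fresh: "p \<notin> P" if "p \<in> ad M g" for p
  proof
    assume "p \<in> P"
    then obtain g' where g': "g' \<in> set (take ?i Q)" "p \<in> ad M g'" by (auto simp: P_def)
    then have "g' \<in> Hdr" using J by (auto simp: invar_def dest!: in_set_takeD)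
    moreover have "g \<noteq> g'" using g' g_fresh by blast
    ultimately show False using disj[OF gH] g' that by blast
  qed
  let ?s = "((fst s)(rP := Suc g, rE := Suc (g + M g)), snd s)"
  define I where "I s' \<longleftrightarrow> env s' \<and> fst s' rE = Suc (g + M g) \<and> g < fst s' rP \<and> fst s' rP \<le> fst s' rE \<and>
     (\<exists>E K. qinv s' (Q @ E) \<and> minv s' K \<and>
        invar h (set (Q @ E)) (P \<union> {Suc g..<fst s' rP}) K (fst s' rConf))" for s'
  have I0: "I ?s"
  proof -
    have "qinv ?s Q" "minv ?s K" using s by (auto simp: qinv_def minv_def)
    then show ?thesis using s J unfolding I_def P_def
      by simp (rule exI[of _ "[]"], auto)
  qed
  have "runs (loop rP rE mark_var) ?s (\<lambda>\<tau> s'. (\<tau> + 250 * unmarked s' \<le> 10 + 210 * W + 250 * unmarked s) \<and>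
      I s' \<and> fst s' rP = fst s' rE)"
    unfolding loop_def
  proof (rule runs_While[where I = I and \<Phi> = "\<lambda>s. (fst s rE - fst s rP) * 210 + 250 * unmarked s"])
    fix u assume u: "I u" "val (Sub (Reg rE) (Reg rP)) u \<noteq> 0"
    then obtain E K where E: "qinv u (Q @ E)" "minv u K"
      "invar h (set (Q @ E)) (P \<union> {Suc g..<fst u rP}) K (fst u rConf)" by (auto simp: I_def)
    have p: "fst u rP \<in> ad M g" "g \<in> set (Q @ E)" "env u" using u gQ by (auto simp: I_def ad_def)
    have nP: "fst u rP \<notin> P \<union> {Suc g..<fst u rP}" using P_fresh[OF p(1)] by simp
    show "runs (mark_var ;; inc rP) u (\<lambda>\<tau> s'. I s' \<and>
       \<tau> + (1 + cost (Sub (Reg rE) (Reg rP))) + ((fst s' rE - fst s' rP) * 210 + 250 * unmarked s')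
       \<le> (fst u rE - fst u rP) * 210 + 250 * unmarked u)"
      unfolding runs_Seq
    proof (rule runs_frame[OF runs_mark_var[OF p(3) E p(2,1) nP],
          where W = "{rConf, rO, rQt, rQ, rV}" and A = "{aMark, aInq, aQueue}"], goal_cases)
      case (4 \<tau> s')
      then obtain E' K' where E': "qinv s' (Q @ (E @ E'))" "minv s' K'"
        "invar h (set (Q @ (E @ E'))) (insert (fst u rP) (P \<union> {Suc g..<fst u rP})) K' (fst s' rConf)"
        by auto
      have fr: "fst s' rP = fst u rP" "fst s' rE = fst u rE" using 4 by (auto simp: frame_def)
      have env: "env s'" using env_frame[OF 4(2) p(3)] by simp
      let ?t = "((fst s')(rP := Suc (fst s' rP)), snd s')"
      have "qinv ?t (Q @ (E @ E'))" "minv ?t K'" using E' by (auto simp: qinv_def minv_def)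
      moreover have "insert (fst u rP) (P \<union> {Suc g..<fst u rP}) = P \<union> {Suc g..<Suc (fst u rP)}"
        using u by (auto simp: I_def)
      ultimately have "\<exists>E K. qinv ?t (Q @ E) \<and> minv ?t K \<and>
          invar h (set (Q @ E)) (P \<union> {Suc g..<fst ?t rP}) K (fst ?t rConf)"
        using E'(3) fr by (intro exI[of _ "E @ E'"] exI[of _ K']) simp
      then have "I ?t" using env fr u by (simp add: I_def)
      moreover have "unmarked ?t = unmarked s'" by (simp add: unmarked_def)
      moreover have "fst u rE - fst u rP = Suc (fst u rE - Suc (fst u rP))" using u by auto
      ultimately show ?case using 4 fr by (simp add: runs_inc)
    qed auto
  next
    fix \<tau> s' assume a: "I s'" "val (Sub (Reg rE) (Reg rP)) s' = 0"
      "\<tau> + ((fst s' rE - fst s' rP) * 210 + 250 * unmarked s') \<le>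
       (fst ?s rE - fst ?s rP) * 210 + 250 * unmarked ?s + (1 + cost (Sub (Reg rE) (Reg rP)))"
    moreover have "unmarked ?s = unmarked s" by (simp add: unmarked_def)
    ultimately show "\<tau> + 250 * unmarked s' \<le> 10 + 210 * W + 250 * unmarked s \<and> I s' \<and> fst s' rP = fst s' rE"
      using W[OF gH] by (auto simp: I_def)
  qed (rule I0)
  then have "runs mark_term s (\<lambda>\<tau> s'. (\<tau> + 250 * unmarked s' \<le> 60 + 210 * W + 250 * unmarked s) \<and>
      I s' \<and> fst s' rP = fst s' rE)"
    unfolding mark_term_def
    by (simp add: runs_simps runs_inc B fun_upd_twist[of rP rE] add.commute) (erule runs_mono, auto)
  then show ?thesis
  proof (rule runs_mono, goal_cases)
    case (1 \<tau> s')
    then obtain E K where E: "qinv s' (Q @ E)" "minv s' K"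
      "invar h (set (Q @ E)) (P \<union> {Suc g..<Suc (g + M g)}) K (fst s' rConf)" by (auto simp: I_def)
    have "take (Suc ?i) (Q @ E) = take ?i Q @ [g]"
      using s(4) by (simp add: take_Suc_conv_app_nth g_def)
    then have "cells (set (take (Suc ?i) (Q @ E))) = P \<union> {Suc g..<Suc (g + M g)}"
      by (auto simp: P_def ad_def)
    then show ?case using 1 E by metis
  qed
qed

definition fresh :: "state \<Rightarrow> bool" where
  "fresh s \<longleftrightarrow> (\<forall>x. snd s (ix B aMark x) \<le> fst s rStamp) \<and> (\<forall>h. snd s (ix B aInq h) \<le> fst s rStamp)"

lemma runs_propagate:
  assumes s: "env s" "qinv s Q" "minv s K" "fst s rQh = 0"
    and J: "invar h (set Q) {} K (fst s rConf)"
    and W: "\<And>h. h \<in> Hdr \<Longrightarrow> M h \<le> W"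
  shows "runs propagate s (\<lambda>\<tau> s'. \<tau> \<le> 10 + card Hdr * (70 + 210 * W) + 250 * card Occ \<and>
     fresh s' \<and> (fst s' rConf = 0 \<longleftrightarrow> (\<exists>G. good G \<and> h \<in> G)))"
proof -
  define I where "I s' \<longleftrightarrow> env s' \<and> (\<exists>Q K. qinv s' Q \<and> minv s' K \<and> fst s' rQh \<le> length Q \<and>
     invar h (set Q) (cells (set (take (fst s' rQh) Q))) K (fst s' rConf))" for s'
  have finH: "finite Hdr" using finTm by simp
  show ?thesis
    unfolding propagate_def
  proof (rule runs_While[where I = I and \<Phi> = "\<lambda>s. (card Hdr - fst s rQh) * (70 + 210 * W) + 250 * unmarked s"])
    show "I s" using s J unfolding I_def by auto
  next
    fix u assume u: "I u" "val (Sub (Reg rQt) (Reg rQh)) u \<noteq> 0"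
    then obtain Q K where Q: "env u" "qinv u Q" "minv u K"
      "invar h (set Q) (cells (set (take (fst u rQh) Q))) K (fst u rConf)" by (auto simp: I_def)
    have l: "fst u rQh < length Q" using u(2) Q(2) by (simp add: qinv_def)
    have "length Q = card (set Q)" "set Q \<subseteq> Hdr"
      using Q by (auto simp: qinv_def distinct_card invar_def)
    then have "length Q \<le> card Hdr" using card_mono[OF finH] by metis
    then have pos: "card Hdr - fst u rQh = Suc (card Hdr - Suc (fst u rQh))" using l by simp
    show "runs (mark_term ;; inc rQh) u (\<lambda>\<tau> s'. I s' \<and>
       \<tau> + (1 + cost (Sub (Reg rQt) (Reg rQh))) + ((card Hdr - fst s' rQh) * (70 + 210 * W) + 250 * unmarked s')
       \<le> (card Hdr - fst u rQh) * (70 + 210 * W) + 250 * unmarked u)"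
      unfolding runs_Seq
    proof (rule runs_frame[OF runs_mark_term[OF Q(1-3) l Q(4) W],
          where W = "{rP, rE, rConf, rO, rQt, rQ, rV}" and A = "{aMark, aInq, aQueue}"], goal_cases)
      case (5 \<tau> s')
      then obtain E K' where E: "qinv s' (Q @ E)" "minv s' K'"
        "invar h (set (Q @ E)) (cells (set (take (Suc (fst u rQh)) (Q @ E)))) K' (fst s' rConf)" by auto
      have fr: "fst s' rQh = fst u rQh" using 5 by (auto simp: frame_def)
      have env: "env s'" using env_frame[OF 5(2) Q(1)] by simp
      let ?t = "((fst s')(rQh := Suc (fst s' rQh)), snd s')"
      have "qinv ?t (Q @ E)" "minv ?t K'" using E by (auto simp: qinv_def minv_def)
      then have "I ?t" using E(3) env fr l unfolding I_def
        by (intro conjI exI[of _ "Q @ E"] exI[of _ K']) auto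
      moreover have "unmarked ?t = unmarked s'" by (simp add: unmarked_def)
      ultimately show ?case using 5 fr pos by (simp add: runs_inc)
    qed auto
  next
    fix \<tau> s' assume a: "I s'" "val (Sub (Reg rQt) (Reg rQh)) s' = 0"
      "\<tau> + ((card Hdr - fst s' rQh) * (70 + 210 * W) + 250 * unmarked s') \<le>
       (card Hdr - fst s rQh) * (70 + 210 * W) + 250 * unmarked s + (1 + cost (Sub (Reg rQt) (Reg rQh)))"
    obtain Q K where Q: "env s'" "qinv s' Q" "minv s' K" "fst s' rQh \<le> length Q"
      "invar h (set Q) (cells (set (take (fst s' rQh) Q))) K (fst s' rConf)" using a(1) by (auto simp: I_def)
    have "fst s' rQh = length Q" using a(2) Q by (simp add: qinv_def)
    then have "invar h (set Q) (cells (set Q)) K (fst s' rConf)" using Q by simp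
    from invar_done[OF this] have "fst s' rConf = 0 \<longleftrightarrow> (\<exists>G. good G \<and> h \<in> G)" .
    moreover have "fresh s'" using Q by (simp add: fresh_def qinv_def minv_def env_def)
    moreover have "unmarked s \<le> card Occ" unfolding unmarked_def by (rule card_mono[OF finOcc]) auto
    ultimately show "\<tau> \<le> 10 + card Hdr * (70 + 210 * W) + 250 * card Occ \<and>
     fresh s' \<and> (fst s' rConf = 0 \<longleftrightarrow> (\<exists>G. good G \<and> h \<in> G))"
      using a(3) s(4) by simp
  qed
qed

lemma runs_check:
  assumes s: "env s" "fresh s" "fst s rH \<in> Hdr"
    and W: "\<And>h. h \<in> Hdr \<Longrightarrow> M h \<le> W"
  shows "runs check s (\<lambda>\<tau> s'. \<tau> \<le> 500 + card Hdr * (70 + 210 * W) + 250 * card Occ \<and>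
     env s' \<and> fresh s' \<and> (fst s' rConf = 0 \<longleftrightarrow> (\<exists>G. good G \<and> fst s rH \<in> G)))"
proof -
  let ?h = "fst s rH"
  let ?st = "Suc (fst s rStamp)"
  have B: "fst s rB = B" "fst s rX = X" using s(1) by (auto simp: env_def)
  define u where "u = ((fst s)(rStamp := ?st, rConf := 0, rQh := 0, rQt := 0, rO := X),
     (snd s)(ix B aMark 0 := ?st))"
  have fr: "snd s (ix B aMark x) \<noteq> ?st" "snd s (ix B aInq x) \<noteq> ?st"
    "snd s (ix B aMark x) \<le> ?st" "snd s (ix B aInq x) \<le> ?st" for x
    using s(2) by (auto simp: fresh_def le_Suc_eq Suc_n_not_le_n dest: spec[of _ x])
  have u: "env u" "qinv u []" "minv u {0}" "fst u rH = ?h" "fst u rO = X" "fst u rQh = 0" "fst u rConf = 0"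
    using s(1) B fr by (auto simp: u_def qinv_def minv_def)
  have ins_X: "ins X [] = [X]" by (simp add: ins_def)
  have J: "invar ?h (set (ins ?h [X])) {} {0} 0"
    using s(3) by (auto simp: invar_def ins_def good_def)
  have "runs (push ;; Assign rO (Reg rH) ;; push ;; propagate) u
    (\<lambda>\<tau> s'. \<tau> \<le> 400 + card Hdr * (70 + 210 * W) + 250 * card Occ \<and> fresh s' \<and>
      (fst s' rConf = 0 \<longleftrightarrow> (\<exists>G. good G \<and> ?h \<in> G)))"
    unfolding runs_Seq
  proof (rule runs_frame[OF runs_push[OF u(2)], where W = "{rQt}" and A = "{aInq, aQueue}"], goal_cases)
    case (4 \<tau>1 v)
    then have v: "env v" "qinv v [X]" "minv v {0}" "fst v rH = ?h" "fst v rQh = 0" "fst v rConf = 0"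
      using env_frame[OF 4(2) u(1)] u ins_X by (auto simp: minv_def frame_def)
    let ?v = "((fst v)(rO := ?h), snd v)"
    have v': "env ?v" "qinv ?v [X]" "minv ?v {0}"
      using v by (auto simp: qinv_def minv_def)
    show ?case
      unfolding runs_Assign val.simps v(4)
    proof (rule runs_frame[OF runs_push[OF v'(2)], where W = "{rQt}" and A = "{aInq, aQueue}"], goal_cases)
      case (4 \<tau>2 w)
      then have w: "env w" "qinv w (ins ?h [X])" "minv w {0}" "fst w rQh = 0" "fst w rConf = 0"
        using env_frame[OF 4(2) v'(1)] v v'(3) by (auto simp: minv_def frame_def)
      have J': "invar ?h (set (ins ?h [X])) {} {0} (fst w rConf)" using J w by simp
      show ?case
        by (rule runs_mono[OF runs_propagate[OF w(1-4) J' W]])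
          (use 4 \<open>\<tau>1 \<le> 160 \<and> _\<close> in auto)
    qed auto
  qed auto
  then have "runs check s (\<lambda>\<tau> s'. \<tau> \<le> 500 + card Hdr * (70 + 210 * W) + 250 * card Occ \<and> fresh s' \<and>
      (fst s' rConf = 0 \<longleftrightarrow> (\<exists>G. good G \<and> ?h \<in> G)))"
    unfolding check_def u_def
    by (simp add: runs_simps runs_inc B) (auto elim!: runs_mono)
  then show ?thesis
    by (rule runs_frame[where W = "{rStamp, rQh, rP, rE, rConf, rO, rQt, rQ, rV}"
          and A = "{aMark, aInq, aQueue}"]) (auto intro: env_frame[OF _ s(1)])
qed

end

section \<open>Solving one selection\<close>

definition test :: "nat \<Rightarrow> prog" where
  "test a = Assign rH (Mem (addr a (Reg rI))) ;; check ;; If (Reg rConf) Skip (Assign rF (Const 1))"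

definition solve :: prog where
  "solve = Assign rOk (Const 1) ;; Assign rI (Const 0) ;;
     loop rI rN (Assign rF (Const 0) ;; test aFst ;; test aSnd ;; If (Reg rF) Skip (Assign rOk (Const 0)))"

lemma wr_test [simp]: "wr (test a) = {rF, rH, rStamp, rQh, rP, rE, rConf, rO, rQt, rQ, rV}"
  by (auto simp: test_def)
lemma sto_test [simp]: "{aMark, aInq, aQueue} \<subseteq> A \<Longrightarrow> sto A (test a)"
  by (simp add: test_def)
lemma wr_solve [simp]: "wr solve = {rOk, rI, rF, rH, rStamp, rQh, rP, rE, rConf, rO, rQt, rQ, rV}"
  by (auto simp: solve_def)
lemma sto_solve [simp]: "{aMark, aInq, aQueue} \<subseteq> A \<Longrightarrow> sto A solve"
  by (simp add: solve_def)

context inst begin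

definition viable :: "nat \<Rightarrow> bool" where
  "viable h \<longleftrightarrow> (\<exists>G. good G \<and> h \<in> G)"

lemma fresh_reg [simp]: "r \<noteq> rStamp \<Longrightarrow> fresh (f(r := v), m) = fresh (f, m)"
  by (simp add: fresh_def)

lemma runs_test:
  assumes s: "env s" "fresh s" "snd s (ix B a (fst s rI)) = h" "h \<in> Hdr"
    and W: "\<And>h. h \<in> Hdr \<Longrightarrow> M h \<le> W"
  shows "runs (test a) s (\<lambda>\<tau> s'. \<tau> \<le> 550 + card Hdr * (70 + 210 * W) + 250 * card Occ \<and>
     env s' \<and> fresh s' \<and> fst s' rF = (if viable h then 1 else fst s rF))"
proof -
  let ?s = "((fst s)(rH := h), snd s)"
  have B: "fst s rB = B" using s(1) by (simp add: env_def)
  have s': "env ?s" "fresh ?s" "fst ?s rH \<in> Hdr" using s by auto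
  have "runs check ?s (\<lambda>\<tau> s'. \<tau> \<le> 500 + card Hdr * (70 + 210 * W) + 250 * card Occ \<and>
     env s' \<and> fresh s' \<and> (fst s' rConf = 0 \<longleftrightarrow> viable h) \<and> fst s' rF = fst s rF)"
    by (rule runs_frame[OF runs_check[OF s' W], where W = "{rStamp, rQh, rP, rE, rConf, rO, rQt, rQ, rV}"
          and A = "{aMark, aInq, aQueue}"]) (auto simp: frame_def viable_def)
  then show ?thesis unfolding test_def
    by (cases "viable h") (auto simp: runs_simps B s(3) elim!: runs_mono)
qed

lemma runs_solve:
  assumes s: "env s" "fresh s" "fst s rN = length ps"
    and ps: "\<And>i. i < length ps \<Longrightarrow> snd s (ix B aFst i) = fst (ps ! i)"
      "\<And>i. i < length ps \<Longrightarrow> snd s (ix B aSnd i) = snd (ps ! i)"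
      "\<And>u v. (u, v) \<in> set ps \<Longrightarrow> u \<in> Hdr \<and> v \<in> Hdr"
    and W: "\<And>h. h \<in> Hdr \<Longrightarrow> M h \<le> W"
  shows "runs solve s (\<lambda>\<tau> s'. \<tau> \<le> 20 + length ps * (1200 + 2 * (card Hdr * (70 + 210 * W) + 250 * card Occ)) \<and>
     fresh s' \<and> fst s' rOk = (if \<forall>(u, v)\<in>set ps. viable u \<or> viable v then 1 else 0))"
proof -
  let ?T = "card Hdr * (70 + 210 * W) + 250 * card Occ"
  let ?P = "\<lambda>(u, v). viable u \<or> viable v"
  let ?s = "((fst s)(rOk := 1, rI := 0), snd s)"
  define I where "I j s' \<longleftrightarrow> env s' \<and> fresh s' \<and>
     (\<forall>i<length ps. snd s' (ix B aFst i) = fst (ps ! i) \<and> snd s' (ix B aSnd i) = snd (ps ! i)) \<and>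
     fst s' rOk = (if \<forall>c\<in>set (take j ps). ?P c then 1 else 0)" for j :: nat and s'
  define ok where "ok \<longleftrightarrow> (\<forall>c\<in>set ps. ?P c)"
  have I0: "I 0 ?s" using s ps by (simp add: I_def)
  have "runs (loop rI rN (Assign rF (Const 0) ;; test aFst ;; test aSnd ;; If (Reg rF) Skip (Assign rOk (Const 0)))) ?s
      (\<lambda>\<tau> s'. \<tau> \<le> length ps * (1150 + 2 * ?T + 8) + 4 \<and> fresh s' \<and>
        fst s' rOk = (if ok then 1 else 0))"
  proof (rule runs_loop[where I = I and l = 0 and H = "length ps" and K = "1150 + 2 * ?T"])
    fix j u assume j: "j < length ps" "fst u rI = j" "I j u"
    obtain x y where xy: "ps ! j = (x, y)" by fastforce
    then have xyH: "x \<in> Hdr" "y \<in> Hdr" using ps(3) j(1) by (metis nth_mem)+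
    let ?u = "((fst u)(rF := 0), snd u)"
    have u: "env ?u" "fresh ?u" "snd ?u (ix B aFst (fst ?u rI)) = x" "snd u (ix B aSnd j) = y"
      using j xy by (auto simp: I_def)
    let ?W = "{rF, rH, rStamp, rQh, rP, rE, rConf, rO, rQt, rQ, rV}"
    let ?A = "{aMark, aInq, aQueue}"
    have take: "(\<forall>c\<in>set (take (Suc j) ps). ?P c) \<longleftrightarrow>
        (\<forall>c\<in>set (take j ps). ?P c) \<and> (viable x \<or> viable y)"
      using j(1) xy by (auto simp: take_Suc_conv_app_nth)
    have "runs (test aFst ;; test aSnd ;; If (Reg rF) Skip (Assign rOk (Const 0))) ?u
        (\<lambda>\<tau> s'. \<tau> + 2 \<le> 1150 + 2 * ?T \<and> I (Suc j) ((fst s')(rI := Suc j), snd s'))"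
      unfolding runs_Seq
    proof (rule runs_frame[OF runs_test[OF u(1-3) xyH(1) W], where W = ?W and A = ?A], goal_cases)
      case (5 \<tau>1 v)
      then have v: "env v" "fresh v" "snd v (ix B aSnd (fst v rI)) = y"
        using u j by (auto simp: frame_def env_def)
      show ?case
      proof (rule runs_frame[OF runs_test[OF v xyH(2) W], where W = ?W and A = ?A], goal_cases)
        case (5 \<tau>2 w)
        have low: "fst u rB = B" "fst v rB = B" using v u by (auto simp: env_def)
        have w: "\<forall>i<length ps. snd w (ix B aFst i) = fst (ps ! i) \<and> snd w (ix B aSnd i) = snd (ps ! i)"
          "fst w rOk = fst u rOk"
          using \<open>frame _ _ v w\<close> \<open>frame _ _ ?u v\<close> low j(3) by (auto simp: frame_def I_def)
        have F: "fst w rF = (if viable x \<or> viable y then 1 else 0)"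
          using 5(1) \<open>\<tau>1 \<le> _ \<and> _\<close> by auto
        have t: "\<tau>1 + \<tau>2 + 10 \<le> 1150 + 2 * ?T" using 5(1) \<open>\<tau>1 \<le> _ \<and> _\<close> by simp
        have Iu: "fst u rOk = (if \<forall>c\<in>set (take j ps). ?P c then 1 else 0)"
          using j(3) by (simp add: I_def)
        show ?case
          using 5(1) w F t Iu unfolding I_def take
          by (cases "viable x \<or> viable y") (simp_all add: runs_simps)
      qed auto
    qed auto
    then show "runs (Assign rF (Const 0) ;; test aFst ;; test aSnd ;; If (Reg rF) Skip (Assign rOk (Const 0))) u
       (\<lambda>\<tau> s'. \<tau> \<le> 1150 + 2 * ?T \<and> I (Suc j) ((fst s')(rI := Suc j), snd s'))"
      unfolding runs_Seq[of "Assign rF (Const 0)"] runs_Assign by (auto elim!: runs_mono)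
  qed (use s I0 in \<open>auto simp: I_def ok_def\<close>)
  then show ?thesis unfolding solve_def ok_def[symmetric]
    by (simp add: runs_simps split del: if_split) (erule runs_mono, simp add: algebra_simps)
qed

end

section \<open>Layout of the input\<close>

definition at :: "(nat \<Rightarrow> nat) \<Rightarrow> nat \<Rightarrow> nat list \<Rightarrow> bool" where
  "at M a ys \<longleftrightarrow> (\<forall>j < length ys. M (a + j) = ys ! j)"

lemma at_Nil [simp]: "at M a []" by (simp add: at_def)

lemma at_Cons [simp]: "at M a (y # ys) \<longleftrightarrow> M a = y \<and> at M (Suc a) ys"
  by (auto simp: at_def less_Suc_eq_0_disj)

lemma at_append [simp]: "at M a (xs @ ys) \<longleftrightarrow> at M a xs \<and> at M (a + length xs) ys"
  by (induction xs arbitrary: a) auto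

lemma at_map: "at M a ys \<Longrightarrow> map M [a..<a + length ys] = ys"
  by (rule nth_equalityI) (auto simp: at_def)

lemma at_cong: "at M a ys \<Longrightarrow> (\<And>j. a \<le> j \<Longrightarrow> j < a + length ys \<Longrightarrow> M' j = M j) \<Longrightarrow> at M' a ys"
  by (simp add: at_def)

definition enc_term :: "nat list \<Rightarrow> nat list" where "enc_term s = length s # s"

definition enc_clause :: "nat list list \<Rightarrow> nat list" where
  "enc_clause c = length c # concat (map enc_term c)"

lemma length_enc_term [simp]: "length (enc_term s) = Suc (length s)"
  by (simp add: enc_term_def)

lemma at_enc_term [simp]: "at M a (enc_term s) \<longleftrightarrow> M a = length s \<and> at M (Suc a) s"
  by (simp add: enc_term_def)

lemma at_enc_clause:
  "at M a (enc_clause c) \<longleftrightarrow> M a = length c \<and> at M (Suc a) (concat (map enc_term c))"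
  by (simp add: enc_clause_def)

lemma encode_eq:
  "encode n p1 p2 = n # length p1 # concat (map enc_clause p1) @ length p2 # concat (map enc_term p2)"
proof -
  have *: "enc_list (\<lambda>x. [x]) = enc_term" by (auto simp: enc_list_def enc_term_def)
  have **: "enc_list enc_term = enc_clause" by (auto simp: enc_list_def enc_clause_def)
  have "enc_list (enc_list enc_term) p1 = length p1 # concat (map enc_clause p1)"
    unfolding ** by (simp add: enc_list_def)
  moreover have "enc_list enc_term p2 = length p2 # concat (map enc_term p2)"
    by (simp add: enc_list_def)
  ultimately show ?thesis unfolding encode_def * by simp
qed

fun heads :: "nat \<Rightarrow> nat list list \<Rightarrow> nat list" where
  "heads a [] = []"
| "heads a (s # c) = a # heads (a + Suc (length s)) c"

fun pair :: "nat list \<Rightarrow> nat \<times> nat" where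
  "pair [] = (0, 0)"
| "pair [u] = (u, 0)"
| "pair (u # v # _) = (u, v)"

fun pairs :: "nat \<Rightarrow> nat list list list \<Rightarrow> (nat \<times> nat) list" where
  "pairs a [] = []"
| "pairs a (c # p) = pair (heads (Suc a) c) # pairs (a + length (enc_clause c)) p"

fun headers :: "nat \<Rightarrow> nat list list list \<Rightarrow> nat list" where
  "headers a [] = []"
| "headers a (c # p) = heads (Suc a) c @ headers (a + length (enc_clause c)) p"

fun partner :: "nat \<Rightarrow> nat list list list \<Rightarrow> nat \<Rightarrow> nat" where
  "partner a [] h = 0"
| "partner a (c # p) h = (let (u, v) = pair (heads (Suc a) c) in
     if h = u then v else if h = v then u else partner (a + length (enc_clause c)) p h)"

lemma length_pairs [simp]: "length (pairs a p) = length p"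
  by (induction p arbitrary: a) auto

definition vars :: "(nat \<Rightarrow> nat) \<Rightarrow> nat \<Rightarrow> nat list" where
  "vars M h = map M [Suc h..<Suc (h + M h)]"

lemma vars_at: "at M a (enc_term s) \<Longrightarrow> vars M a = s \<and> M a = length s"
  using at_map[of M "Suc a" s] by (simp add: vars_def)

lemma heads_at:
  "at M a (concat (map enc_term c)) \<Longrightarrow>
     sorted_wrt (\<lambda>h h'. h + M h < h') (heads a c) \<and>
     (\<forall>h\<in>set (heads a c). a \<le> h \<and> h + M h < a + length (concat (map enc_term c))) \<and>
     map (vars M) (heads a c) = c"
proof (induction c arbitrary: a)
  case (Cons s c)
  have at: "at M (a + Suc (length s)) (concat (map enc_term c))" "at M a (enc_term s)"
    using Cons.prems by (auto simp: add.assoc)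
  show ?case using Cons.IH[OF at(1)] vars_at[OF at(2)] by fastforce
qed auto

lemma length_heads [simp]: "length (heads a c) = length c"
  by (induction c arbitrary: a) auto

lemma pair_cases:
  assumes "length hs \<le> 2" "0 \<notin> set hs" "pair hs = (u, v)"
  shows "set hs = {u, v} - {0}"
  using assms by (cases hs rule: pair.cases) auto

lemma headers_at:
  "at M a (concat (map enc_clause p)) \<Longrightarrow>
     sorted_wrt (\<lambda>h h'. h + M h < h') (headers a p) \<and>
     (\<forall>h\<in>set (headers a p). a < h \<and> h + M h < a + length (concat (map enc_clause p)))"
proof (induction p arbitrary: a)
  case (Cons c p)
  let ?b = "a + length (enc_clause c)"
  have at: "at M ?b (concat (map enc_clause p))" using Cons.prems by auto
  have at': "at M (Suc a) (concat (map enc_term c))" using Cons.prems by (simp add: at_enc_clause)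
  have b: "?b = Suc a + length (concat (map enc_term c))" by (simp add: enc_clause_def)
  note IH = Cons.IH[OF at] and h = heads_at[OF at']
  have "h + M h < h'" if "h \<in> set (heads (Suc a) c)" "h' \<in> set (headers ?b p)" for h h'
    using h IH that b by fastforce
  moreover have "a < h \<and> h + M h < a + length (concat (map enc_clause (c # p)))"
    if "h \<in> set (headers a (c # p))" for h
    using h IH that b by fastforce
  ultimately show ?case using IH h by (simp add: sorted_wrt_append)
qed auto

lemma pairs_at:
  "at M a (concat (map enc_clause p)) \<Longrightarrow> \<forall>c\<in>set p. length c \<le> 2 \<Longrightarrow>
     list_all2 (\<lambda>(u, v) c. vars M ` ({u, v} - {0}) = set c) (pairs a p) p \<and>
     \<Union> ((\<lambda>(u, v). {u, v} - {0}) ` set (pairs a p)) = set (headers a p) \<and>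
     (\<forall>(u, v)\<in>set (pairs a p). (u \<noteq> 0 \<longrightarrow> partner a p u = v) \<and> (v \<noteq> 0 \<longrightarrow> partner a p v = u)) \<and>
     sorted_wrt (\<lambda>(u, v) (u', v'). {u, v} \<inter> {u', v'} \<subseteq> {0}) (pairs a p)"
proof (induction p arbitrary: a)
  case (Cons c p)
  let ?b = "a + length (enc_clause c)"
  have at: "at M ?b (concat (map enc_clause p))" and len: "\<forall>c\<in>set p. length c \<le> 2"
    using Cons.prems by auto
  have at': "at M (Suc a) (concat (map enc_term c))" using Cons.prems by (simp add: at_enc_clause)
  have b: "?b = Suc a + length (concat (map enc_term c))" by (simp add: enc_clause_def)
  note IH = Cons.IH[OF at len] and heads = heads_at[OF at']
  obtain x y where xy: "pair (heads (Suc a) c) = (x, y)" by fastforce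
  have hs: "set (heads (Suc a) c) = {x, y} - {0}"
    using pair_cases[OF _ _ xy] heads Cons.prems by force
  have later: "w \<noteq> x \<and> w \<noteq> y" if uv: "(u, v) \<in> set (pairs ?b p)" and w: "w \<in> {u, v}" "w \<noteq> 0" for u v w
  proof -
    have "w \<in> \<Union> ((\<lambda>(u, v). {u, v} - {0}) ` set (pairs ?b p))"
      using w by (intro UN_I[OF uv]) auto
    then have "w \<in> set (headers ?b p)" unfolding IH[THEN conjunct2, THEN conjunct1] .
    then have "?b < w" using headers_at[OF at] by blast
    moreover have "z \<le> ?b" if "z \<in> {x, y}" for z
    proof -
      have "z = 0 \<or> z \<in> set (heads (Suc a) c)" using hs that by blast
      then show ?thesis using heads b by fastforce
    qed
    ultimately show ?thesis by (metis insertCI leD)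
  qed
  have vars: "vars M ` ({x, y} - {0}) = set c" using heads hs by (metis set_map)
  have mates: "(u \<noteq> 0 \<longrightarrow> partner a (c # p) u = v) \<and> (v \<noteq> 0 \<longrightarrow> partner a (c # p) v = u)"
    if "(u, v) \<in> set (pairs a (c # p))" for u v
  proof (cases "(u, v) = (x, y)")
    case True
    have "x = 0 \<or> y \<noteq> x"
      using heads xy by (cases "heads (Suc a) c" rule: pair.cases) auto
    then show ?thesis using True xy by auto
  next
    case False
    then have uv: "(u, v) \<in> set (pairs ?b p)" using that xy by auto
    have "(u \<noteq> 0 \<longrightarrow> partner ?b p u = v) \<and> (v \<noteq> 0 \<longrightarrow> partner ?b p v = u)"
      using bspec[OF IH[THEN conjunct2, THEN conjunct2, THEN conjunct1] uv] by simp
    moreover have "u = 0 \<or> u \<noteq> x \<and> u \<noteq> y" "v = 0 \<or> v \<noteq> x \<and> v \<noteq> y" using later[OF uv] by blast+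
    ultimately show ?thesis using xy by (auto simp: Let_def)
  qed
  have dis: "{x, y} \<inter> {u, v} \<subseteq> {0}" if "(u, v) \<in> set (pairs ?b p)" for u v
    using later[OF that] by blast
  show ?case
  proof (intro conjI)
    show "list_all2 (\<lambda>(u, v) c. vars M ` ({u, v} - {0}) = set c) (pairs a (c # p)) (c # p)"
      using IH[THEN conjunct1] vars xy by simp
    show "\<Union> ((\<lambda>(u, v). {u, v} - {0}) ` set (pairs a (c # p))) = set (headers a (c # p))"
      using IH[THEN conjunct2, THEN conjunct1] hs xy by simp
    show "\<forall>(u, v)\<in>set (pairs a (c # p)).
        (u \<noteq> 0 \<longrightarrow> partner a (c # p) u = v) \<and> (v \<noteq> 0 \<longrightarrow> partner a (c # p) v = u)"
      using mates by blast
    show "sorted_wrt (\<lambda>(u, v) (u', v'). {u, v} \<inter> {u', v'} \<subseteq> {0}) (pairs a (c # p))"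
      unfolding pairs.simps xy sorted_wrt.simps
      using IH[THEN conjunct2, THEN conjunct2, THEN conjunct2] dis by blast
  qed
qed auto

lemma in_listset: "xs \<in> listset As \<longleftrightarrow> list_all2 (\<in>) xs As"
  by (induction As arbitrary: xs) (auto simp: set_Cons_def list_all2_Cons2)

definition cell_list :: "(nat \<Rightarrow> nat) \<Rightarrow> nat list \<Rightarrow> nat list" where
  "cell_list M hs = concat (map (\<lambda>h. [Suc h..<Suc (h + M h)]) hs)"

lemma set_cell_list: "set (cell_list M hs) = (\<Union>h\<in>set hs. ad M h)"
  by (auto simp: cell_list_def ad_def)

lemma concat_vars: "concat (map (vars M) hs) = map M (cell_list M hs)"
  by (induction hs) (auto simp: cell_list_def vars_def)

lemma distinct_cell_list:
  "distinct hs \<Longrightarrow> (\<And>h h'. h \<in> set hs \<Longrightarrow> h' \<in> set hs \<Longrightarrow> h \<noteq> h' \<Longrightarrow> ad M h \<inter> ad M h' = {}) \<Longrightarrow>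
   distinct (cell_list M hs)"
proof (induction hs)
  case (Cons h hs)
  have "distinct (cell_list M hs)" using Cons by simp
  moreover have "ad M h \<inter> set (cell_list M hs) = {}"
    using Cons.prems unfolding set_cell_list by fastforce
  moreover have "cell_list M (h # hs) = [Suc h..<Suc (h + M h)] @ cell_list M hs"
    by (simp add: cell_list_def)
  moreover have "set [Suc h..<Suc (h + M h)] = ad M h" by (auto simp: ad_def)
  ultimately show ?case by (metis distinct_append distinct_upt)
qed (simp add: cell_list_def)

locale layout =
  fixes M :: "nat \<Rightarrow> nat" and B X :: nat and p1 :: sigma_pi_poly and opp :: "nat \<Rightarrow> nat"
  assumes at: "at M 2 (concat (map enc_clause p1))" and len: "\<forall>c\<in>set p1. length c \<le> 2"
    and X: "X = 2 + length (concat (map enc_clause p1))" and XB: "X + M X < B"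
    and M0: "M 0 = Suc 0" and M1: "M (Suc 0) = 0"
    and opp: "\<And>h q. h \<in> set (headers 2 p1) \<Longrightarrow> q \<in> ad M h \<Longrightarrow> opp q = partner 2 p1 h"
begin

abbreviation "Tm \<equiv> set (headers 2 p1)"
abbreviation "mate \<equiv> partner 2 p1"

lemmas pairs_facts = pairs_at[OF at len]

lemma header_bound: "h \<in> Tm \<Longrightarrow> 2 < h \<and> h + M h < X"
  using headers_at[OF at] X by simp

lemma header_sorted: "h \<in> Tm \<Longrightarrow> h' \<in> Tm \<Longrightarrow> h \<noteq> h' \<Longrightarrow> h + M h < h' \<or> h' + M h' < h"
  using headers_at[OF at, THEN conjunct1]
  by (metis (no_types, lifting) in_set_conv_nth linorder_neqE_nat sorted_wrt_iff_nth_less)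

lemma pair_Tm: "(u, v) \<in> set (pairs 2 p1) \<Longrightarrow> w \<in> {u, v} \<Longrightarrow> w \<in> insert 0 Tm"
proof (cases "w = 0")
  case False
  assume uv: "(u, v) \<in> set (pairs 2 p1)" "w \<in> {u, v}"
  have "w \<in> \<Union> ((\<lambda>(u, v). {u, v} - {0}) ` set (pairs 2 p1))"
    by (rule UN_I[OF uv(1)]) (use uv False in simp)
  then show ?thesis unfolding pairs_facts[THEN conjunct2, THEN conjunct1] by simp
qed simp

lemma pair_mate:
  "(u, v) \<in> set (pairs 2 p1) \<Longrightarrow> (u \<noteq> 0 \<longrightarrow> mate u = v) \<and> (v \<noteq> 0 \<longrightarrow> mate v = u)"
  using bspec[OF pairs_facts[THEN conjunct2, THEN conjunct2, THEN conjunct1], of "(u, v)"] by simp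

lemma Tm_pair:
  assumes "h \<in> Tm"
  obtains u v where "(u, v) \<in> set (pairs 2 p1)" "h = u \<or> h = v" "h \<noteq> 0"
proof -
  have "h \<in> \<Union> ((\<lambda>(u, v). {u, v} - {0}) ` set (pairs 2 p1))"
    unfolding pairs_facts[THEN conjunct2, THEN conjunct1] by (rule assms)
  then obtain c where c: "c \<in> set (pairs 2 p1)" "h \<in> (case c of (u, v) \<Rightarrow> {u, v} - {0})" by blast
  obtain u v where "c = (u, v)" by fastforce
  with c have "(u, v) \<in> set (pairs 2 p1)" "h = u \<or> h = v" "h \<noteq> 0" by simp_all
  then show ?thesis by (rule that)
qed

sublocale inst M B X Tm mate opp
proof
  show "finite Tm" "X \<noteq> 0" using X by simp_all
  show "0 \<notin> Tm" "X \<notin> Tm" using header_bound by fastforce+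
  show "M 0 = Suc 0" "M (Suc 0) = 0" by (fact M0 M1)+
  show "h + M h < B" if "h \<in> insert 0 (insert X Tm)" for h
    using that header_bound[of h] XB M0 X by auto
  show "opp q = mate h" if "h \<in> Tm" "q \<in> ad M h" for h q using opp that .
next
  fix h h' assume h: "h \<in> insert 0 (insert X Tm)" "h' \<in> insert 0 (insert X Tm)" "h \<noteq> h'"
  have "h + M h < Suc h' \<or> h' + M h' < Suc h"
    using h header_bound[of h] header_bound[of h'] header_sorted[of h h'] M0 X by auto
  then show "ad M h \<inter> ad M h' = {}" by (auto simp: ad_def)
next
  fix h assume h: "h \<in> Tm"
  obtain u v where uv: "(u, v) \<in> set (pairs 2 p1)" "h = u \<or> h = v" "h \<noteq> 0"
    using Tm_pair[OF h] .
  have "mate h \<in> {u, v}" using pair_mate[OF uv(1)] uv(2,3) by auto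
  then show "mate h \<in> insert 0 Tm" by (rule pair_Tm[OF uv(1)])
  assume "mate h \<noteq> 0"
  then show "mate (mate h) = h" using uv pair_mate[OF uv(1)] by auto
qed


lemma solvable_if_viable:
  assumes "\<forall>(u, v)\<in>set (pairs 2 p1 @ [(X, 0)]). viable u \<or> viable v"
  shows "\<exists>ss\<in>listset (map set p1). distinct (concat ss @ vars M X) \<and> 0 \<notin> set (concat ss @ vars M X)"
proof -
  have n0: "\<not> viable 0" using zero_notin_good by (auto simp: viable_def)
  obtain S0 where "good S0" using assms n0 by (auto simp: viable_def)
  have "\<exists>S. good S \<and> (\<forall>(u, v)\<in>set (pairs 2 p1). u \<in> S \<or> v \<in> S)"
  proof (rule good_all[OF \<open>good S0\<close>])
    fix u v assume uv: "(u, v) \<in> set (pairs 2 p1)"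
    then show "\<exists>R. good R \<and> (u \<in> R \<or> v \<in> R)" using assms by (auto simp: viable_def)
    have "0 \<notin> Tm" by (rule zero_Tm)
    then show "{u, v} \<subseteq> insert 0 Tm \<and> (u \<in> Tm \<longrightarrow> mate u = v) \<and> (v \<in> Tm \<longrightarrow> mate v = u)"
      using pair_Tm[OF uv] pair_mate[OF uv] by (metis insert_subset empty_subsetI insertCI)
  qed
  then obtain S where S: "good S" "\<And>u v. (u, v) \<in> set (pairs 2 p1) \<Longrightarrow> u \<in> S \<or> v \<in> S" by blast
  define f where "f = (\<lambda>(u, v). if u \<in> S then u else v :: nat)"
  have f: "f c \<in> S" "f c \<in> {fst c, snd c}" if "c \<in> set (pairs 2 p1)" for c
    using S(2)[of "fst c" "snd c"] that unfolding f_def by (auto split: prod.splits if_splits)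
  have f0: "f c \<noteq> 0" if "c \<in> set (pairs 2 p1)" for c
    using f(1)[OF that] zero_notin_good[OF S(1)] by metis
  define hs where "hs = map f (pairs 2 p1)"
  have hsS: "set (hs @ [X]) \<subseteq> S" using f S(1) by (auto simp: hs_def good_def)
  have "distinct hs"
  proof -
    have "sorted_wrt (\<lambda>c c'. f c \<noteq> f c') (pairs 2 p1)"
    proof (rule sorted_wrt_mono_rel[OF _ pairs_facts[THEN conjunct2, THEN conjunct2, THEN conjunct2]])
      fix c c' assume c: "c \<in> set (pairs 2 p1)" "c' \<in> set (pairs 2 p1)"
        "(case c of (u, v) \<Rightarrow> \<lambda>(u', v'). {u, v} \<inter> {u', v'} \<subseteq> {0}) c'"
      then show "f c \<noteq> f c'" using f(2)[OF c(1)] f(2)[OF c(2)] f0[OF c(1)]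
        by (auto split: prod.splits)
    qed
    then show ?thesis unfolding hs_def distinct_conv_nth sorted_wrt_iff_nth_less
      by (metis length_map linorder_neqE_nat nth_map)
  qed
  moreover have "X \<notin> set hs"
  proof
    assume "X \<in> set hs"
    then obtain c where c: "c \<in> set (pairs 2 p1)" "X = f c" by (auto simp: hs_def)
    then have "X \<in> insert 0 Tm" using pair_Tm[of "fst c" "snd c" X] f(2)[OF c(1)] by simp
    then show False using X_Tm X_pos by blast
  qed
  ultimately have "distinct (hs @ [X])" by simp
  then have "distinct (cell_list M (hs @ [X]))"
  proof (rule distinct_cell_list)
    fix h h' assume h: "h \<in> set (hs @ [X])" "h' \<in> set (hs @ [X])" "h \<noteq> h'"
    have "S \<subseteq> insert X Tm" using S(1) by (simp add: good_def)
    then show "ad M h \<inter> ad M h' = {}" using hsS h by (intro disj) blast+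
  qed
  moreover have "set (cell_list M (hs @ [X])) \<subseteq> cells S"
    unfolding set_cell_list using hsS by blast
  ultimately have "distinct (map M (cell_list M (hs @ [X])))" "0 \<notin> set (map M (cell_list M (hs @ [X])))"
    using S(1) by (auto simp: distinct_map good_def intro: inj_on_subset)
  then have "distinct (concat (map (vars M) hs) @ vars M X)" "0 \<notin> set (concat (map (vars M) hs) @ vars M X)"
    unfolding concat_vars[symmetric] by simp_all
  moreover have "map (vars M) hs \<in> listset (map set p1)"
  proof -
    have "list_all2 (\<lambda>c d. vars M (f c) \<in> set d) (pairs 2 p1) p1"
      using pairs_facts[THEN conjunct1]
    proof (rule list.rel_mono_strong)
      fix c d assume "c \<in> set (pairs 2 p1)" "(case c of (u, v) \<Rightarrow> \<lambda>d. vars M ` ({u, v} - {0}) = set d) d"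
      then show "vars M (f c) \<in> set d" using f(2)[of c] f0[of c] by (auto split: prod.splits)
    qed
    then show ?thesis by (simp add: in_listset hs_def list_all2_map1 list_all2_map2)
  qed
  ultimately show ?thesis by blast
qed

lemma viable_if_solvable:
  assumes ss: "ss \<in> listset (map set p1)" "distinct (concat ss @ vars M X)" "0 \<notin> set (concat ss @ vars M X)"
    and c: "c \<in> set (pairs 2 p1 @ [(X, 0)])"
  shows "viable (fst c) \<or> viable (snd c)"
proof -
  let ?n = "length p1"
  have "list_all2 (\<lambda>s c. s \<in> set c) ss p1" using ss(1) by (simp add: in_listset list_all2_map2)
  then have lss: "length ss = ?n" and in_ss: "\<And>i. i < ?n \<Longrightarrow> ss ! i \<in> set (p1 ! i)"
    by (auto simp: list_all2_conv_all_nth)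
  have "\<exists>h. h \<noteq> 0 \<and> h \<in> {fst (pairs 2 p1 ! i), snd (pairs 2 p1 ! i)} \<and> vars M h = ss ! i" if "i < ?n" for i
  proof -
    obtain u v where uv: "pairs 2 p1 ! i = (u, v)" by fastforce
    have eq: "vars M ` ({u, v} - {0}) = set (p1 ! i)"
      using list_all2_nthD2[OF pairs_facts[THEN conjunct1] that] uv by simp
    have "ss ! i \<in> vars M ` ({u, v} - {0})" unfolding eq by (rule in_ss[OF that])
    then obtain h where "ss ! i = vars M h" "h \<in> {u, v} - {0}" by (rule imageE)
    then show ?thesis unfolding uv by auto
  qed
  then obtain f where f: "\<And>i. i < ?n \<Longrightarrow> f i \<noteq> 0" "\<And>i. i < ?n \<Longrightarrow> vars M (f i) = ss ! i"
    "\<And>i. i < ?n \<Longrightarrow> f i \<in> {fst (pairs 2 p1 ! i), snd (pairs 2 p1 ! i)}" by metis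
  define hs where "hs = map f [0..<?n] @ [X]"
  have "map (vars M) (map f [0..<?n]) = ss"
    using lss f(2) by (intro nth_equalityI) auto
  then have cv: "concat ss @ vars M X = map M (cell_list M hs)"
    unfolding concat_vars[symmetric] hs_def by simp
  have inj: "inj_on M (cells (set hs))" and nz: "0 \<notin> M ` cells (set hs)"
    using ss(2,3) unfolding cv by (simp_all add: distinct_map set_cell_list)
  have sub: "set hs \<subseteq> insert X Tm"
  proof -
    have "f i \<in> Tm" if "i < ?n" for i
      using pair_Tm[of "fst (pairs 2 p1 ! i)" "snd (pairs 2 p1 ! i)" "f i"] f(1,3) that by simp
    then show ?thesis by (auto simp: hs_def)
  qed
  have "good (set hs)"
  proof (rule goodI)
    fix g p h q assume a: "g \<in> set hs" "p \<in> ad M g" "h \<in> Tm" "q \<in> ad M h" "q \<noteq> p" "M q = M p"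
    have "h \<notin> set hs" using inj a unfolding inj_on_def by blast
    obtain u v where uv: "(u, v) \<in> set (pairs 2 p1)" "h = u \<or> h = v" "h \<noteq> 0"
      using Tm_pair[OF a(3)] .
    then obtain i where i: "i < ?n" "pairs 2 p1 ! i = (u, v)" by (metis in_set_conv_nth length_pairs)
    then have "f i \<in> {u, v}" "f i \<in> set hs" using f(3)[OF i(1)] by (auto simp: hs_def)
    moreover from this have "f i \<noteq> h" using \<open>h \<notin> set hs\<close> by blast
    ultimately show "mate h \<in> set hs" using pair_mate[OF uv(1)] uv(2,3) by auto
  qed (use inj nz sub in \<open>auto simp: hs_def inj_on_def\<close>)
  moreover have "fst c \<in> set hs \<or> snd c \<in> set hs"
  proof (cases "c = (X, 0)")
    case False
    then obtain i where "i < ?n" "c = pairs 2 p1 ! i" using c by (auto simp: in_set_conv_nth)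
    moreover from this have "f i \<in> set hs" by (simp add: hs_def)
    ultimately show ?thesis using f(3)[of i] by auto
  qed (simp add: hs_def)
  ultimately show ?thesis by (auto simp: viable_def)
qed

end

section \<open>Preprocessing\<close>

definition offs :: "('a \<Rightarrow> nat list) \<Rightarrow> 'a list \<Rightarrow> nat \<Rightarrow> nat" where
  "offs f xs j = length (concat (map f (take j xs)))"

lemma offs_0 [simp]: "offs f xs 0 = 0" by (simp add: offs_def)

lemma offs_Suc: "j < length xs \<Longrightarrow> offs f xs (Suc j) = offs f xs j + length (f (xs ! j))"
  by (simp add: offs_def take_Suc_conv_app_nth)

lemma offs_length: "offs f xs (length xs) = length (concat (map f xs))"
  by (simp add: offs_def)

lemma at_offs:
  assumes "at M a (concat (map f xs))" "j < length xs"
  shows "at M (a + offs f xs j) (f (xs ! j))"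
proof -
  have "concat (map f xs) = concat (map f (take j xs)) @ f (xs ! j) @ concat (map f (drop (Suc j) xs))"
    by (subst id_take_nth_drop[OF assms(2)]) simp
  then show ?thesis using assms(1) by (simp add: offs_def)
qed

definition clause_step :: prog where
  "clause_step = Assign rU (Const 0) ;; Assign rW (Const 0) ;; Assign rC (Mem (Reg rA)) ;; inc rA ;;
     If (Reg rC) (Assign rU (Reg rA) ;; Assign rA (Add (Add (Reg rA) (Mem (Reg rA))) (Const 1)) ;;
       If (Sub (Reg rC) (Const 1))
         (Assign rW (Reg rA) ;; Assign rA (Add (Add (Reg rA) (Mem (Reg rA))) (Const 1))) Skip) Skip"

lemma wr_clause_step [simp]: "wr clause_step = {rU, rW, rC, rA}"
  by (auto simp: clause_step_def)
lemma sto_clause_step [simp]: "sto A clause_step" by (simp add: clause_step_def)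

lemma runs_clause_step:
  assumes "at (snd s) (fst s rA) (enc_clause c)" "length c \<le> 2"
  shows "runs clause_step s (\<lambda>\<tau> s'. \<tau> \<le> 50 \<and> snd s' = snd s \<and>
     (fst s' rU, fst s' rW) = pair (heads (Suc (fst s rA)) c) \<and>
     fst s' rA = fst s rA + length (enc_clause c))"
proof -
  consider "c = []" | x where "c = [x]" | x y where "c = [x, y]"
    using assms(2) by (cases c; cases "tl c"; cases "tl (tl c)") auto
  then show ?thesis
    using assms(1)
    by cases (auto simp: clause_step_def runs_simps runs_inc at_enc_clause enc_clause_def)
qed

definition scan :: prog where
  "scan = Assign rM (Mem (Const 1)) ;; Assign rA (Const 2) ;; Assign rI (Const 0) ;;
     loop rI rM clause_step ;;
     Assign rX (Reg rA) ;; Assign rK (Mem (Reg rA)) ;; inc rA ;; Assign rJ (Const 0) ;;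
     loop rJ rK (Assign rA (Add (Add (Mem (Reg rA)) (Reg rA)) (Const 1))) ;;
     Assign rB (Reg rA) ;; Store (Const 0) (Const 1) ;; Store (Const 1) (Const 0)"

lemma wr_scan [simp]: "wr scan = {rM, rA, rI, rU, rW, rC, rX, rK, rJ, rB}"
  by (auto simp: scan_def)

lemma runs_scan:
  assumes M: "snd s (Suc 0) = length p1"
    "at (snd s) 2 (concat (map enc_clause p1) @ length p2 # concat (map enc_term p2))"
    and len: "\<forall>c\<in>set p1. length c \<le> 2"
    and X: "X = 2 + length (concat (map enc_clause p1))"
    and B: "B = Suc (X + length (concat (map enc_term p2)))"
  shows "runs scan s (\<lambda>\<tau> s'. \<tau> \<le> 100 + 60 * length p1 + 20 * length p2 \<and>
     fst s' rX = X \<and> fst s' rB = B \<and> fst s' rM = length p1 \<and> fst s' rK = length p2 \<and>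
     snd s' = (snd s)(0 := Suc 0, Suc 0 := 0))"
proof -
  define N where "N = snd s"
  have N1: "N (Suc 0) = length p1" using M(1) by (simp add: N_def)
  have at1: "at N 2 (concat (map enc_clause p1))" and NX: "N X = length p2"
    and at2: "at N (Suc X) (concat (map enc_term p2))"
    using M(2) by (auto simp: N_def X)
  have l1: "runs (loop rI rM clause_step) u (\<lambda>\<tau> v. \<tau> \<le> length p1 * 58 + 4 \<and> snd v = N \<and> fst v rA = X \<and>
      fst v rM = length p1)"
    if "snd u = N" "fst u rA = 2" "fst u rI = 0" "fst u rM = length p1" for u
  proof (rule runs_loop[where l = 0 and H = "length p1" and K = 50 and
        I = "\<lambda>j u. snd u = N \<and> fst u rA = 2 + offs enc_clause p1 j"])
    fix j u assume u: "j < length p1" "snd u = N \<and> fst u rA = 2 + offs enc_clause p1 j"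
    then have c: "at (snd u) (fst u rA) (enc_clause (p1 ! j))" "length (p1 ! j) \<le> 2"
      using at_offs[OF at1] len by auto
    show "runs clause_step u (\<lambda>\<tau> s'. \<tau> \<le> 50 \<and>
             snd ((fst s')(rI := Suc j), snd s') = N \<and>
             fst ((fst s')(rI := Suc j), snd s') rA = 2 + offs enc_clause p1 (Suc j))"
      by (rule runs_mono[OF runs_clause_step[OF c]]) (use u in \<open>auto simp: offs_Suc\<close>)
  qed (use that in \<open>auto simp: X offs_length\<close>)
  have l2: "runs (loop rJ rK (Assign rA (Add (Add (Mem (Reg rA)) (Reg rA)) (Const 1)))) u
      (\<lambda>\<tau> v. \<tau> \<le> length p2 * 16 + 4 \<and> snd v = N \<and> fst v rA = B \<and> (\<forall>r. r \<notin> {rJ, rA} \<longrightarrow> fst v r = fst u r))"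
    if "snd u = N" "fst u rA = Suc X" "fst u rJ = 0" "fst u rK = length p2" for u
  proof (rule runs_loop[where l = 0 and H = "length p2" and K = 8 and
        I = "\<lambda>j v. snd v = N \<and> fst v rA = Suc X + offs enc_term p2 j \<and> (\<forall>r. r \<notin> {rJ, rA} \<longrightarrow> fst v r = fst u r)"])
    fix j v assume v: "j < length p2"
      "snd v = N \<and> fst v rA = Suc X + offs enc_term p2 j \<and> (\<forall>r. r \<notin> {rJ, rA} \<longrightarrow> fst v r = fst u r)"
    have "at N (Suc X + offs enc_term p2 j) (enc_term (p2 ! j))" using at_offs[OF at2 v(1)] .
    then show "runs (Assign rA (Add (Add (Mem (Reg rA)) (Reg rA)) (Const 1))) v (\<lambda>\<tau> s'. \<tau> \<le> 8 \<and>
         snd ((fst s')(rJ := Suc j), snd s') = N \<and>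
         fst ((fst s')(rJ := Suc j), snd s') rA = Suc X + offs enc_term p2 (Suc j) \<and>
         (\<forall>r. r \<notin> {rJ, rA} \<longrightarrow> fst ((fst s')(rJ := Suc j), snd s') r = fst u r))"
      using v by (auto simp: runs_simps offs_Suc)
  qed (use that in \<open>auto simp: B offs_length\<close>)
  let ?u = "((fst s)(rM := length p1, rA := 2, rI := 0), N)"
  have "runs scan s (\<lambda>\<tau> s'. \<tau> \<le> 100 + 60 * length p1 + 20 * length p2 \<and>
     fst s' rX = X \<and> fst s' rB = B \<and> fst s' rM = length p1 \<and> fst s' rK = length p2 \<and>
     snd s' = N(0 := Suc 0, Suc 0 := 0))"
    unfolding scan_def
    by (simp add: runs_simps runs_inc N1 N_def[symmetric])
      (rule runs_mono[OF l1], simp_all add: N1, rule runs_mono[OF l2[unfolded One_nat_def]], auto simp: NX)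
  then show ?thesis by (simp add: N_def)
qed

definition linked :: "nat \<Rightarrow> (nat \<Rightarrow> nat) \<Rightarrow> nat list \<Rightarrow> (nat \<times> nat) set \<Rightarrow> state \<Rightarrow> bool" where
  "linked B M cs R s \<longleftrightarrow>
     (\<forall>x. x \<noteq> 0 \<longrightarrow> chain (\<lambda>p. snd s (ix B aNext p)) (snd s (ix B aHead x)) (rev (filter (\<lambda>p. M p = x) cs)) \<and>
        distinct (filter (\<lambda>p. M p = x) cs)) \<and>
     (\<forall>(q, h)\<in>R. snd s (ix B aOpp q) = h)"

lemma linked_cong:
  assumes "linked B M cs R s" "\<And>c i. c \<in> {aOpp, aNext, aHead} \<Longrightarrow> snd s' (ix B c i) = snd s (ix B c i)"
  shows "linked B M cs R s'"
  using assms unfolding linked_def by simp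

lemma linked_reg [simp]: "linked B M cs R (f(r := v), m) = linked B M cs R (f, m)"
  by (simp add: linked_def)

lemma chain_upd: "p \<notin> set L \<Longrightarrow> chain (f(p := v)) q L = chain f q L"
  by (induction L arbitrary: q) auto

lemma linked_mono: "linked B M cs R s \<Longrightarrow> R' \<subseteq> R \<Longrightarrow> linked B M cs R' s"
  unfolding linked_def by (elim conjE, intro conjI, assumption, intro ballI, drule subsetD, assumption, erule bspec)

definition link :: prog where
  "link = Assign rP (Reg rU) ;; Assign rE (Add (Add (Mem (Reg rP)) (Reg rP)) (Const 1)) ;; inc rP ;;
     loop rP rE (Store (addr aOpp (Reg rP)) (Reg rW) ;;
       Store (addr aNext (Reg rP)) (Mem (addr aHead (Mem (Reg rP)))) ;;
       Store (addr aHead (Mem (Reg rP))) (Reg rP))"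

lemma wr_link [simp]: "wr link = {rP, rE}" by (auto simp: link_def)
lemma sto_link [simp]: "{aOpp, aNext, aHead} \<subseteq> A \<Longrightarrow> sto A link" by (auto simp: link_def)

lemma linked_step:
  assumes "linked B M cs R (f, m)" "p \<notin> fst ` R" "M p = 0 \<or> p \<notin> set cs" "p \<noteq> 0"
  shows "linked B M (cs @ [p]) (insert (p, h) R)
     (g, m(ix B aOpp p := h, ix B aNext p := m (ix B aHead (M p)), ix B aHead (M p) := p))"
    (is "linked _ _ _ _ (g, ?m)")
proof -
  have nx: "(\<lambda>q. ?m (ix B aNext q)) = (\<lambda>q. m (ix B aNext q))(p := m (ix B aHead (M p)))"
    by (auto simp: fun_eq_iff)
  have "chain (\<lambda>q. ?m (ix B aNext q)) (?m (ix B aHead x)) (rev (filter (\<lambda>q. M q = x) (cs @ [p]))) \<and>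
     distinct (filter (\<lambda>q. M q = x) (cs @ [p]))" if "x \<noteq> 0" for x
  proof -
    let ?L = "rev (filter (\<lambda>q. M q = x) cs)"
    have L: "chain (\<lambda>p. m (ix B aNext p)) (m (ix B aHead x)) ?L" "distinct ?L"
      using assms(1) that by (auto simp: linked_def)
    have p: "p \<notin> set ?L" using assms(3) that by auto
    then have "chain (\<lambda>q. ?m (ix B aNext q)) (m (ix B aHead x)) ?L"
      unfolding nx using L(1) by (subst chain_upd) auto
    then show ?thesis using L(2) p assms(4) by auto
  qed
  moreover have "?m (ix B aOpp q) = h'" if "(q, h') \<in> insert (p, h) R" for q h'
  proof (cases "(q, h') = (p, h)")
    case False
    then have qR: "(q, h') \<in> R" using that by blast
    then have "q \<noteq> p" using assms(2) by (metis fst_conv imageI)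
    moreover have "m (ix B aOpp q) = h'" using qR assms(1) by (auto simp: linked_def)
    ultimately show ?thesis by simp
  qed simp
  ultimately show ?thesis unfolding linked_def snd_conv by blast
qed

lemma runs_link:
  assumes s: "linked B M cs R s" "fst s rB = B" "\<And>a. a < B \<Longrightarrow> snd s a = M a"
    and h: "fst s rU = h" "fst s rW = v" "h + M h < B"
    and new: "\<And>p. p \<in> ad M h \<Longrightarrow> p \<notin> fst ` R \<and> (M p = 0 \<or> p \<notin> set cs)"
  shows "runs link s (\<lambda>\<tau> s'. \<tau> \<le> 30 + 200 * M h \<and>
     linked B M (cs @ [Suc h..<Suc (h + M h)]) (R \<union> ad M h \<times> {v}) s')"
proof -
  let ?s = "((fst s)(rP := Suc h, rE := Suc (h + M h)), snd s)"
  define I where "I j u \<longleftrightarrow> linked B M (cs @ [Suc h..<j]) (R \<union> {Suc h..<j} \<times> {v}) u \<and>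
     fst u rB = B \<and> fst u rW = v \<and> (\<forall>a<B. snd u a = M a)" for j :: nat and u
  have "runs (loop rP rE (Store (addr aOpp (Reg rP)) (Reg rW) ;;
       Store (addr aNext (Reg rP)) (Mem (addr aHead (Mem (Reg rP)))) ;;
       Store (addr aHead (Mem (Reg rP))) (Reg rP))) ?s
     (\<lambda>\<tau> s'. \<tau> \<le> M h * 198 + 4 \<and> I (Suc (h + M h)) s')"
  proof (rule runs_loop[where l = "Suc h" and H = "Suc (h + M h)" and K = 190 and I = I])
    show "I (Suc h) ?s" using s h by (simp add: I_def)
  next
    fix j u assume j: "Suc h \<le> j" "j < Suc (h + M h)" "fst u rP = j" "I j u"
    then have u: "linked B M (cs @ [Suc h..<j]) (R \<union> {Suc h..<j} \<times> {v}) (fst u, snd u)"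
      "fst u rB = B" "fst u rW = v" "\<forall>a<B. snd u a = M a" by (auto simp: I_def)
    have jh: "j \<in> ad M h" using j by (auto simp: ad_def)
    have ju: "snd u j = M j" using j(2) h(3) u(4) by simp
    have "linked B M ((cs @ [Suc h..<j]) @ [j]) (insert (j, v) (R \<union> {Suc h..<j} \<times> {v}))
       (fst u, (snd u)(ix B aOpp j := v, ix B aNext j := snd u (ix B aHead (M j)), ix B aHead (M j) := j))"
      by (rule linked_step[OF u(1)]) (use new[OF jh] j in auto)
    moreover have "(cs @ [Suc h..<j]) @ [j] = cs @ [Suc h..<Suc j]"
      "insert (j, v) (R \<union> {Suc h..<j} \<times> {v}) = R \<union> {Suc h..<Suc j} \<times> {v}" using j(1) by auto
    ultimately have "linked B M (cs @ [Suc h..<Suc j]) (R \<union> {Suc h..<Suc j} \<times> {v})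
       (fst u, (snd u)(ix B aOpp j := v, ix B aNext j := snd u (ix B aHead (M j)), ix B aHead (M j) := j))"
      by (simp only:)
    then show "runs (Store (addr aOpp (Reg rP)) (Reg rW) ;;
       Store (addr aNext (Reg rP)) (Mem (addr aHead (Mem (Reg rP)))) ;;
       Store (addr aHead (Mem (Reg rP))) (Reg rP)) u
      (\<lambda>\<tau> s'. \<tau> \<le> 190 \<and> I (Suc j) ((fst s')(rP := Suc j), snd s'))"
      using u(2-4) j(3) ju h(3) j(2) by (simp add: runs_simps I_def)
  qed auto
  moreover have "{Suc h..<Suc (h + M h)} = ad M h" by (auto simp: ad_def)
  ultimately show ?thesis
    unfolding link_def using h s
    by (simp add: runs_simps runs_inc fun_upd_twist[of rP rE] add.commute del: upt_Suc)
       (erule runs_mono, simp add: I_def add.commute del: upt_Suc)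
qed


definition build :: prog where
  "build = Assign rA (Const 2) ;; Assign rI (Const 0) ;;
     loop rI rM (clause_step ;; Store (addr aFst (Reg rI)) (Reg rU) ;; Store (addr aSnd (Reg rI)) (Reg rW) ;;
       link ;; Assign rC (Reg rU) ;; Assign rU (Reg rW) ;; Assign rW (Reg rC) ;; link) ;;
     Store (addr aFst (Reg rM)) (Reg rX) ;; Assign rN (Add (Reg rM) (Const 1))"

lemma wr_build [simp]: "wr build = {rA, rI, rU, rW, rC, rP, rE, rN}"
  by (auto simp: build_def)
lemma sto_build [simp]: "{aOpp, aNext, aHead, aFst, aSnd} \<subseteq> A \<Longrightarrow> sto A build"
  by (simp add: build_def)

lemma nth_pairs:
  "i < length p \<Longrightarrow> pairs a p ! i = pair (heads (Suc (a + offs enc_clause p i)) (p ! i))"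
proof (induction p arbitrary: a i)
  case (Cons c p)
  then show ?case by (cases i) (auto simp: offs_def add.assoc)
qed simp

lemma take_pairs: "take i (pairs a p) = pairs a (take i p)"
proof (induction p arbitrary: a i)
  case (Cons c p)
  then show ?case by (cases i) auto
qed simp

definition links :: "(nat \<Rightarrow> nat) \<Rightarrow> (nat \<times> nat) list \<Rightarrow> (nat \<times> nat) set" where
  "links M ps = (\<Union>(u, v)\<in>set ps. (if u = 0 then {} else ad M u \<times> {v}) \<union> (if v = 0 then {} else ad M v \<times> {u}))"

definition flat :: "(nat \<times> nat) list \<Rightarrow> nat list" where
  "flat ps = concat (map (\<lambda>(u, v). [u, v]) ps)"

lemma set_flat: "set (flat ps) = (\<Union>(u, v)\<in>set ps. {u, v})"
  by (auto simp: flat_def)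

lemma flat_append [simp]: "flat (ps @ qs) = flat ps @ flat qs" "flat [(u, v)] = [u, v]"
  by (simp_all add: flat_def)

lemma pair_bound:
  assumes "at M a (concat (map enc_clause p))" "\<forall>c\<in>set p. length c \<le> 2"
    "(u, v) \<in> set (pairs a p)" "w \<in> {u, v}" "w \<noteq> 0"
  shows "a < w \<and> w + M w < a + length (concat (map enc_clause p))"
proof -
  have "w \<in> \<Union> ((\<lambda>(u, v). {u, v} - {0}) ` set (pairs a p))"
    by (rule UN_I[OF assms(3)]) (use assms(4,5) in simp)
  then have "w \<in> set (headers a p)"
    unfolding pairs_at[OF assms(1,2), THEN conjunct2, THEN conjunct1] .
  then show ?thesis using headers_at[OF assms(1)] by blast
qed

lemma pair_heads_bound:
  assumes "at M a (concat (map enc_term c))" "length c \<le> 2" "pair (heads a c) = (u, v)" "0 < a"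
  shows "u \<noteq> 0 \<Longrightarrow> a \<le> u \<and> u + M u < a + length (concat (map enc_term c))"
    and "v \<noteq> 0 \<Longrightarrow> u \<noteq> 0 \<and> u + M u < v \<and> v + M v < a + length (concat (map enc_term c))"
  using assms heads_at[OF assms(1)] length_heads[of a c]
  by (cases "heads a c" rule: pair.cases; force)+

lemma runs_build:
  assumes s: "fst s rB = B" "\<And>a. a < B \<Longrightarrow> snd s a = M a" "\<And>c i. snd s (ix B c i) = 0"
    "fst s rM = length p1" "fst s rX = X"
    and at: "at M 2 (concat (map enc_clause p1))" and len: "\<forall>c\<in>set p1. length c \<le> 2"
    and X: "X = 2 + length (concat (map enc_clause p1))" and XB: "X < B"
    and M01: "M 0 = Suc 0" "M (Suc 0) = 0"
    and T: "\<And>c s. c \<in> set p1 \<Longrightarrow> s \<in> set c \<Longrightarrow> length s \<le> t"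
  shows "runs build s (\<lambda>\<tau> s'. \<tau> \<le> 100 + length p1 * (700 + 400 * t) \<and>
     fst s' rN = Suc (length p1) \<and>
     (\<forall>i < length (pairs 2 p1 @ [(X, 0)]).
        snd s' (ix B aFst i) = fst ((pairs 2 p1 @ [(X, 0)]) ! i) \<and>
        snd s' (ix B aSnd i) = snd ((pairs 2 p1 @ [(X, 0)]) ! i)) \<and>
     linked B M (cell_list M (flat (pairs 2 p1))) (links M (pairs 2 p1)) s')"
proof -
  let ?n = "length p1" and ?ps = "pairs 2 p1"
  let ?body = "clause_step ;; Store (addr aFst (Reg rI)) (Reg rU) ;; Store (addr aSnd (Reg rI)) (Reg rW) ;;
       link ;; Assign rC (Reg rU) ;; Assign rU (Reg rW) ;; Assign rW (Reg rC) ;; link"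
  define I where "I j u \<longleftrightarrow> fst u rB = B \<and> (\<forall>a<B. snd u a = M a) \<and> fst u rA = 2 + offs enc_clause p1 j \<and>
     fst u rX = X \<and> (\<forall>i<j. snd u (ix B aFst i) = fst (?ps ! i) \<and> snd u (ix B aSnd i) = snd (?ps ! i)) \<and>
     (\<forall>i\<ge>j. snd u (ix B aSnd i) = 0) \<and>
     linked B M (cell_list M (flat (take j ?ps))) (links M (take j ?ps)) u" for j :: nat and u
  let ?s = "((fst s)(rA := 2, rI := 0), snd s)"
  have "linked B M [] {} ?s" by (simp add: linked_def s(3))
  moreover have "cell_list M (flat []) = []" "links M [] = {}"
    by (simp_all add: links_def flat_def cell_list_def)
  ultimately have "linked B M (cell_list M (flat (take 0 ?ps))) (links M (take 0 ?ps)) ?s" unfolding take_0 by metis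
  moreover have "\<forall>a<B. snd ?s a = M a" using s(2) by (metis snd_conv)
  ultimately have I0: "I 0 ?s" unfolding I_def using s(1,5) by (simp add: s(3))
  have "runs (loop rI rM ?body) ?s (\<lambda>\<tau> u. \<tau> \<le> ?n * (600 + 400 * t + 8) + 4 \<and> I ?n u \<and> fst u rM = ?n)"
  proof (rule runs_loop[where l = 0 and H = ?n and I = I and K = "600 + 400 * t"])
    fix j u assume j: "j < ?n" "fst u rI = j" "I j u"
    have u: "fst u rB = B" "\<forall>a<B. snd u a = M a" "fst u rA = 2 + offs enc_clause p1 j" "fst u rX = X"
      "\<forall>i<j. snd u (ix B aFst i) = fst (?ps ! i) \<and> snd u (ix B aSnd i) = snd (?ps ! i)"
      "\<forall>i\<ge>j. snd u (ix B aSnd i) = 0"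
      "linked B M (cell_list M (flat (take j ?ps))) (links M (take j ?ps)) u"
      using j(3)[unfolded I_def] by - (elim conjE, assumption)+
    let ?c = "p1 ! j" and ?a = "2 + offs enc_clause p1 j"
    have c: "at M ?a (enc_clause ?c)" "length ?c \<le> 2" using at_offs[OF at j(1)] len j(1) by auto
    have end_c: "?a + length (enc_clause ?c) \<le> X"
    proof -
      have "offs enc_clause p1 (Suc j) \<le> length (concat (map enc_clause p1))"
      proof -
        have "p1 = take (Suc j) p1 @ drop (Suc j) p1" by simp
        then have "concat (map enc_clause p1) =
           concat (map enc_clause (take (Suc j) p1)) @ concat (map enc_clause (drop (Suc j) p1))"
          by (metis concat_append map_append)
        then show ?thesis by (simp add: offs_def)
      qed
      then show ?thesis using offs_Suc[OF j(1), of enc_clause] X by simp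
    qed
    have atu: "at (snd u) (fst u rA) (enc_clause ?c)"
      unfolding u(3) by (rule at_cong[OF c(1)]) (use u(2) end_c XB in auto)
    obtain x y where xy: "pair (heads (Suc ?a) ?c) = (x, y)" by fastforce
    have psj: "?ps ! j = (x, y)" using nth_pairs[OF j(1), of 2] xy by simp
    have atc: "at M (Suc ?a) (concat (map enc_term ?c))" using c(1) by (simp add: at_enc_clause)
    have lc: "length (enc_clause ?c) = Suc (length (concat (map enc_term ?c)))" by (simp add: enc_clause_def)
    have bx: "x \<noteq> 0 \<Longrightarrow> ?a < x \<and> x + M x < X" and
      bnd_y: "y \<noteq> 0 \<Longrightarrow> x \<noteq> 0 \<and> x + M x < y \<and> y + M y < X"
      using pair_heads_bound[OF atc c(2) xy] lc end_c by auto
    have Mt: "M w \<le> t + 1" if "w \<in> {x, y}" for w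
    proof (cases "w = 0")
      case False
      then have "w \<in> set (heads (Suc ?a) ?c)"
        using that xy c(2) by (cases "heads (Suc ?a) ?c" rule: pair.cases) auto
      then have "vars M w \<in> set (map (vars M) (heads (Suc ?a) ?c))" by simp
      then have "vars M w \<in> set ?c" unfolding heads_at[OF atc, THEN conjunct2, THEN conjunct2] .
      then have "length (vars M w) \<le> t" by (rule T[OF nth_mem[OF j(1)]])
      then show ?thesis by (simp add: vars_def del: upt_Suc)
    qed (simp add: M01)
    have old: "z + M z < ?a \<or> z = 0" if "z \<in> set (flat (take j ?ps))" for z
    proof -
      have "at M 2 (concat (map enc_clause (take j p1)))"
      proof -
        have "concat (map enc_clause p1) =
           concat (map enc_clause (take j p1)) @ concat (map enc_clause (drop j p1))"
          by (metis append_take_drop_id concat_append map_append)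
        then show ?thesis using at by simp
      qed
      moreover have "\<forall>c\<in>set (take j p1). length c \<le> 2" using len by (meson in_set_takeD)
      moreover obtain v w where "(v, w) \<in> set (pairs 2 (take j p1))" "z \<in> {v, w}"
        using \<open>z \<in> _\<close> unfolding set_flat take_pairs by auto
      ultimately show ?thesis using pair_bound[of M 2 "take j p1" v w z] by (auto simp: offs_def)
    qed
    have oldcell: "q < ?a" if "q \<in> set (cell_list M (flat (take j ?ps)))" for q
    proof -
      from that[unfolded set_cell_list] obtain z where z: "z \<in> set (flat (take j ?ps))" "q \<in> ad M z"
        by blast
      then show ?thesis using old[OF z(1)] M01 by (auto simp: ad_def)
    qed
    have oldlink: "q < ?a \<and> 1 < q" if "q \<in> fst ` links M (take j ?ps)" for q
    proof -
      from that obtain c where "c \<in> links M (take j ?ps)" "q = fst c" by blast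
      then obtain v w where vw: "(v, w) \<in> set (take j ?ps)"
        "v \<noteq> 0 \<and> q \<in> ad M v \<or> w \<noteq> 0 \<and> q \<in> ad M w"
        unfolding links_def by (auto split: if_splits)
      moreover have "v \<in> set (flat (take j ?ps))" "w \<in> set (flat (take j ?ps))"
        unfolding set_flat by (rule UN_I[OF vw(1)], simp)+
      ultimately show ?thesis using old[of v] old[of w] by (auto simp: ad_def)
    qed
    let ?cs = "cell_list M (flat (take j ?ps))" and ?R = "links M (take j ?ps)"
    let ?cs1 = "?cs @ [Suc x..<Suc (x + M x)]"
    let ?R1 = "?R \<union> (if x = 0 then {} else ad M x \<times> {y})"
    have ad0: "ad M 0 = {Suc 0}" by (auto simp: ad_def M01)
    have new_x: "p \<notin> fst ` ?R \<and> (M p = 0 \<or> p \<notin> set ?cs)" if "p \<in> ad M x" for p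
    proof (cases "x = 0")
      case True
      then show ?thesis using that oldlink[of p] ad0 M01 by auto
    next
      case False
      then have "?a < p" using bx that by (auto simp: ad_def)
      then show ?thesis using oldlink[of p] oldcell[of p] by auto
    qed
    have new_y: "p \<notin> fst ` ?R1 \<and> (M p = 0 \<or> p \<notin> set ?cs1)" if "p \<in> ad M y" for p
    proof (cases "y = 0")
      case True
      then have "p = Suc 0" using that ad0 by auto
      moreover have "p \<notin> fst ` (if x = 0 then {} else ad M x \<times> {y})"
        using bx calculation by (auto simp: ad_def)
      ultimately show ?thesis using oldlink[of p] M01 by (auto simp del: upt_Suc)
    next
      case False
      then have *: "x \<noteq> 0" "x + M x < p" using bnd_y that by (auto simp: ad_def)
      then have "?a < p" using bx by auto
      then show ?thesis using oldlink[of p] oldcell[of p] * by (auto simp: ad_def)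
    qed
    have R1: "?R1 \<subseteq> ?R \<union> ad M x \<times> {y}" by auto
    have take: "take (Suc j) ?ps = take j ?ps @ [(x, y)]"
      using j(1) psj by (simp add: take_Suc_conv_app_nth)
    have cs2: "cell_list M (flat (take (Suc j) ?ps)) = ?cs1 @ [Suc y..<Suc (y + M y)]"
      unfolding take by (simp add: cell_list_def del: upt_Suc)
    have R2: "links M (take (Suc j) ?ps) \<subseteq> ?R1 \<union> ad M y \<times> {x}"
      unfolding take by (auto simp: links_def)
    show "runs ?body u (\<lambda>\<tau> s'. \<tau> \<le> 600 + 400 * t \<and> I (Suc j) ((fst s')(rI := Suc j), snd s'))"
      unfolding runs_Seq
    proof (rule runs_frame[OF runs_clause_step[OF atu c(2)], where W = "{rU, rW, rC, rA}" and A = "{}"], goal_cases)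
      case (4 \<tau>1 v)
      then have v: "snd v = snd u" "fst v rU = x" "fst v rW = y" "fst v rA = 2 + offs enc_clause p1 (Suc j)"
        "fst v rB = B" "fst v rX = X" "fst v rI = j" "\<tau>1 \<le> 50"
        using xy u(1,3,4) j(2) offs_Suc[OF j(1), of enc_clause] by (auto simp: frame_def)
      let ?m = "(snd u)(ix B aFst j := x, ix B aSnd j := y)"
      let ?v = "(fst v, ?m)"
      have lv: "linked B M ?cs ?R ?v" by (rule linked_cong[OF u(7)]) auto
      have lowv: "snd ?v a = M a" if "a < B" for a using that u(2) by simp
      have xB: "x + M x < B" and yB: "y + M y < B"
        using bx bnd_y XB X M01 by (cases "x = 0"; cases "y = 0"; simp)+
      have "runs (link ;; Assign rC (Reg rU) ;; Assign rU (Reg rW) ;; Assign rW (Reg rC) ;; link) ?v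
         (\<lambda>\<tau> s'. \<tau> \<le> 70 + 200 * M x + 200 * M y \<and> I (Suc j) ((fst s')(rI := Suc j), snd s'))"
        unfolding runs_Seq
      proof (rule runs_frame[OF runs_link[OF lv _ lowv _ _ xB new_x, of y],
            where W = "{rP, rE}" and A = "{aOpp, aNext, aHead}"], goal_cases)
        case (9 \<tau>2 w)
        let ?w = "((fst w)(rC := x, rU := y, rW := x), snd w)"
        have w: "fst w rU = x" "fst w rW = y" "fst w rB = B" "fst w rA = fst v rA" "fst w rX = X"
          "fst w rI = j" "\<And>a. a < B \<Longrightarrow> snd w a = M a" "\<tau>2 \<le> 30 + 200 * M x"
          "\<And>i. snd w (ix B aFst i) = ?m (ix B aFst i)" "\<And>i. snd w (ix B aSnd i) = ?m (ix B aSnd i)"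
          using 9 v lowv by (auto simp: frame_def)
        have "linked B M ?cs1 ?R1 w" by (rule linked_mono[OF _ R1]) (use 9 in simp)
        then have lw: "linked B M ?cs1 ?R1 ?w" by (rule linked_cong) simp
        have "runs link ?w (\<lambda>\<tau> s'. \<tau> \<le> 30 + 200 * M y \<and> I (Suc j) ((fst s')(rI := Suc j), snd s'))"
        proof (rule runs_frame[OF runs_link[OF lw _ _ _ _ yB new_y, of x],
              where W = "{rP, rE}" and A = "{aOpp, aNext, aHead}"], goal_cases)
          case (9 \<tau>3 z)
          have l: "linked B M (cell_list M (flat (take (Suc j) ?ps))) (links M (take (Suc j) ?ps)) z"
            unfolding cs2 by (rule linked_mono[OF _ R2]) (use 9 in simp)
          have z: "fst z rB = B" "\<forall>a<B. snd z a = M a" "fst z rA = 2 + offs enc_clause p1 (Suc j)" "fst z rX = X"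
            "\<And>i. snd z (ix B aFst i) = ?m (ix B aFst i)" "\<And>i. snd z (ix B aSnd i) = ?m (ix B aSnd i)"
            using 9(2) w v by (auto simp: frame_def)
          have "\<forall>i<Suc j. snd z (ix B aFst i) = fst (?ps ! i) \<and> snd z (ix B aSnd i) = snd (?ps ! i)"
            using u(5) psj by (auto simp: z(5,6) less_Suc_eq)
          moreover have "\<forall>i\<ge>Suc j. snd z (ix B aSnd i) = 0" using u(6) by (auto simp: z(6))
          ultimately have "I (Suc j) ((fst z)(rI := Suc j), snd z)"
            unfolding I_def using z l by simp
          then show ?case using 9 by simp
        qed (use w in auto)
        then show ?case
          using w(1,2,8) by (simp add: runs_simps) (erule runs_mono, auto)
      qed (use v in auto)
      then show ?case
        using v Mt[of x] Mt[of y] by (auto simp: runs_simps elim!: runs_mono)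
    qed auto
  qed (use I0 s(4) in auto)
  moreover have I_eq: "fst v rB = B" "fst v rX = X" if "I ?n v" for v using that by (simp_all add: I_def)
  ultimately have "runs build s (\<lambda>\<tau> u. \<tau> \<le> 100 + length p1 * (700 + 400 * t) \<and>
      (\<exists>v. I ?n v \<and> u = ((fst v)(rN := Suc ?n), (snd v)(ix B aFst ?n := X))))"
    unfolding build_def
    by (simp add: runs_simps) (erule runs_mono, fastforce simp: algebra_simps dest: I_eq)
  then show ?thesis
  proof (rule runs_mono, goal_cases)
    case (1 \<tau> z)
    then obtain v where v: "I ?n v" "z = ((fst v)(rN := Suc ?n), (snd v)(ix B aFst ?n := X))" by blast
    have "linked B M (cell_list M (flat ?ps)) (links M ?ps) v" using v(1) by (simp add: I_def)
    then have "linked B M (cell_list M (flat ?ps)) (links M ?ps) z"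
      by (rule linked_cong) (auto simp: v(2))
    moreover have "snd z (ix B aFst i) = fst ((?ps @ [(X, 0)]) ! i) \<and> snd z (ix B aSnd i) = snd ((?ps @ [(X, 0)]) ! i)"
      if "i < length (?ps @ [(X, 0)])" for i
      using v(1) that by (auto simp: v(2) I_def nth_append less_Suc_eq)
    ultimately show ?case using 1 v(2) by simp
  qed
qed

section \<open>Enumeration of the selections\<close>

definition pick :: "nat list \<Rightarrow> nat \<Rightarrow> nat" where
  "pick c d = (if d < length c then c ! d else 0)"

definition load :: prog where
  "load = Assign rA (Add (Reg rX) (Const 1)) ;; Assign rJ (Const 0) ;;
     loop rJ rK (Assign rC (Mem (Reg rA)) ;;
       If (Reg rC) (Store (addr aVar (Reg rJ)) (Mem (Add (Reg rA) (Const 1))) ;;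
         If (Sub (Reg rC) (Const 1)) (Store (addr 6 (Reg rJ)) (Mem (Add (Reg rA) (Const 2))) ;;
           If (Sub (Reg rC) (Const 2)) (Store (addr 7 (Reg rJ)) (Mem (Add (Reg rA) (Const 3)))) Skip) Skip) Skip ;;
       Assign rA (Add (Add (Reg rA) (Reg rC)) (Const 1)))"

lemma wr_load [simp]: "wr load = {rA, rJ, rC}" by (auto simp: load_def)
lemma sto_load [simp]: "{5, 6, 7} \<subseteq> A \<Longrightarrow> sto A load" by (simp add: load_def)

lemma runs_load:
  assumes s: "fst s rB = B" "\<And>a. a < B \<Longrightarrow> snd s a = M a" "fst s rX = X" "fst s rK = length p2"
    "\<And>d i. d < 3 \<Longrightarrow> snd s (ix B (aVar + d) i) = 0"
    and at: "at M (Suc X) (concat (map enc_term p2))"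
    and B: "B = Suc (X + length (concat (map enc_term p2)))"
    and len: "\<forall>c\<in>set p2. length c \<le> 3"
  shows "runs load s (\<lambda>\<tau> s'. \<tau> \<le> 20 + 200 * length p2 \<and>
     (\<forall>j<length p2. \<forall>d<3. snd s' (ix B (aVar + d) j) = pick (p2 ! j) d))"
proof -
  let ?n = "length p2"
  let ?body = "Assign rC (Mem (Reg rA)) ;;
       If (Reg rC) (Store (addr aVar (Reg rJ)) (Mem (Add (Reg rA) (Const 1))) ;;
         If (Sub (Reg rC) (Const 1)) (Store (addr 6 (Reg rJ)) (Mem (Add (Reg rA) (Const 2))) ;;
           If (Sub (Reg rC) (Const 2)) (Store (addr 7 (Reg rJ)) (Mem (Add (Reg rA) (Const 3)))) Skip) Skip) Skip ;;
       Assign rA (Add (Add (Reg rA) (Reg rC)) (Const 1))"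
  define I where "I j u \<longleftrightarrow> fst u rB = B \<and> (\<forall>a<B. snd u a = M a) \<and> fst u rA = Suc X + offs enc_term p2 j \<and>
     (\<forall>i. snd u (ix B 5 i) = (if i < j then pick (p2 ! i) 0 else 0)) \<and>
     (\<forall>i. snd u (ix B 6 i) = (if i < j then pick (p2 ! i) 1 else 0)) \<and>
     (\<forall>i. snd u (ix B 7 i) = (if i < j then pick (p2 ! i) 2 else 0))" for j u
  let ?s = "((fst s)(rA := Suc X, rJ := 0), snd s)"
  have I0: "I 0 ?s"
    using s(1,2) s(5)[of 0] s(5)[of 1] s(5)[of 2] by (simp add: I_def)
  have "runs (loop rJ rK ?body) ?s (\<lambda>\<tau> u. \<tau> \<le> ?n * (180 + 8) + 4 \<and> I ?n u)"
  proof (rule runs_loop[where l = 0 and H = ?n and I = I and K = 180])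
    fix j u assume j: "j < ?n" "fst u rJ = j" "I j u"
    have u: "fst u rB = B" "\<forall>a<B. snd u a = M a" "fst u rA = Suc X + offs enc_term p2 j"
      "\<And>i. snd u (ix B 5 i) = (if i < j then pick (p2 ! i) 0 else 0)"
      "\<And>i. snd u (ix B 6 i) = (if i < j then pick (p2 ! i) 1 else 0)"
      "\<And>i. snd u (ix B 7 i) = (if i < j then pick (p2 ! i) 2 else 0)"
      using j(3) by (simp_all add: I_def)
    let ?c = "p2 ! j" and ?a = "Suc X + offs enc_term p2 j"
    have c: "at M ?a (enc_term ?c)" "length ?c \<le> 3" using at_offs[OF at j(1)] len j(1) by auto
    have "offs enc_term p2 (Suc j) \<le> length (concat (map enc_term p2))"
    proof -
      have "concat (map enc_term p2) =
         concat (map enc_term (take (Suc j) p2)) @ concat (map enc_term (drop (Suc j) p2))"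
        by (metis append_take_drop_id concat_append map_append)
      then show ?thesis by (simp add: offs_def)
    qed
    then have aB: "?a + Suc (length ?c) \<le> B" using offs_Suc[OF j(1), of enc_term] B by simp
    have atu: "at (snd u) ?a (enc_term ?c)"
      by (intro at_cong[OF c(1)]) (use u(2) aB in auto)
    then have m: "snd u ?a = length ?c" "at (snd u) (Suc ?a) ?c" by auto
    consider "?c = []" | x where "?c = [x]" | x y where "?c = [x, y]" | x y z where "?c = [x, y, z]"
      using c(2) by (cases ?c; cases "tl ?c"; cases "tl (tl ?c)"; cases "tl (tl (tl ?c))") auto
    moreover define A where "A = ?a"
    have A: "A + Suc (length ?c) \<le> B" "snd u A = length ?c" "at (snd u) (Suc A) ?c" "fst u rA = A"
      "Suc X + offs enc_term p2 (Suc j) = A + Suc (length ?c)"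
      using m aB u(3) offs_Suc[OF j(1), of enc_term] by (simp_all add: A_def)
    have I': "I (Suc j) v \<longleftrightarrow> fst v rB = B \<and> (\<forall>a<B. snd v a = M a) \<and> fst v rA = A + Suc (length ?c) \<and>
       (\<forall>i. snd v (ix B 5 i) = (if i < Suc j then pick (p2 ! i) 0 else 0)) \<and>
       (\<forall>i. snd v (ix B 6 i) = (if i < Suc j then pick (p2 ! i) 1 else 0)) \<and>
       (\<forall>i. snd v (ix B 7 i) = (if i < Suc j then pick (p2 ! i) 2 else 0))" for v
      unfolding I_def A(5) ..
    have plus: "A + 2 = Suc (Suc A)" "A + 3 = Suc (Suc (Suc A))" by simp_all
    ultimately show "runs ?body u (\<lambda>\<tau> s'. \<tau> \<le> 180 \<and> I (Suc j) ((fst s')(rJ := Suc j), snd s'))"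
      using A(1-4) u(1,2,4-6) j(2)
      by cases (auto simp: runs_simps I' less_Suc_eq pick_def plus)
  qed (use I0 s in auto)
  then have "runs load s (\<lambda>\<tau> u. \<tau> \<le> 20 + 200 * ?n \<and> I ?n u)"
    unfolding load_def using s(3) by (simp add: runs_simps) (erule runs_mono, simp)
  then show ?thesis
  proof (rule runs_mono)
    fix \<tau> u assume a: "\<tau> \<le> 20 + 200 * ?n \<and> I ?n u"
    have "snd u (ix B (aVar + d) j) = pick (p2 ! j) d" if "j < ?n" "d < 3" for j d
    proof -
      have "d = 0 \<or> d = 1 \<or> d = 2" using that(2) by auto
      then show ?thesis using a that(1) by (auto simp: I_def)
    qed
    then show "\<tau> \<le> 20 + 200 * ?n \<and> (\<forall>j<?n. \<forall>d<3. snd u (ix B (aVar + d) j) = pick (p2 ! j) d)"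
      using a by blast
  qed
qed

definition pow3 :: prog where
  "pow3 = Assign rT (Const 1) ;; Assign rJ (Const 0) ;;
     loop rJ rK (Assign rT (Add (Add (Reg rT) (Reg rT)) (Reg rT)))"

lemma wr_pow3 [simp]: "wr pow3 = {rT, rJ}" by (auto simp: pow3_def)
lemma sto_pow3 [simp]: "sto A pow3" by (simp add: pow3_def)

lemma runs_pow3:
  assumes "fst s rK = k"
  shows "runs pow3 s (\<lambda>\<tau> s'. \<tau> \<le> 20 + 20 * k \<and> fst s' rT = 3 ^ k)"
proof -
  have "runs (loop rJ rK (Assign rT (Add (Add (Reg rT) (Reg rT)) (Reg rT))))
     ((fst s)(rT := 1, rJ := 0), snd s) (\<lambda>\<tau> u. \<tau> \<le> k * (10 + 8) + 4 \<and> fst u rT = 3 ^ k)"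
    by (rule runs_loop[where l = 0 and H = k and K = 10 and I = "\<lambda>j u. fst u rT = 3 ^ j"])
      (use assms in \<open>auto simp: runs_simps\<close>)
  then show ?thesis unfolding pow3_def
    by (simp add: runs_simps) (erule runs_mono, simp)
qed

definition digit :: "nat \<Rightarrow> nat \<Rightarrow> nat" where "digit r j = r div 3 ^ j mod 3"

lemma digit_less: "digit r j < 3" by (simp add: digit_def)

lemma digits_exist: "\<forall>j<k. d j < 3 \<Longrightarrow> \<exists>r < 3 ^ k. \<forall>j<k. digit r j = d j"
proof (induction k arbitrary: d)
  case (Suc k)
  obtain r where r: "r < 3 ^ k" "\<forall>j<k. digit r j = d (Suc j)"
    using Suc.IH[of "\<lambda>j. d (Suc j)"] Suc.prems by auto
  have d0: "d 0 < 3" using Suc.prems by blast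
  have "digit (d 0 + 3 * r) j = d j" if "j < Suc k" for j
    using r(2) d0 that by (cases j) (auto simp: digit_def div_mult2_eq)
  moreover have "d 0 + 3 * r < 3 ^ Suc k" using r(1) d0 by simp
  ultimately show ?case by blast
qed simp

text \<open>
  The selected variables overwrite the cells behind the length \<open>k\<close> of the second polynomial
  (there are enough, as each clause has its own length cell), so that \<open>X\<close> becomes a term with
  header address \<open>X\<close>.  A missing third, second or first variable of a clause is selected as \<open>0\<close>.
\<close>

definition select :: prog where
  "select = Assign rJ (Const 0) ;;
     loop rJ rK (Store (Add (Add (Reg rX) (Const 1)) (Reg rJ))
       (Mem (Add (addr aVar (Reg rJ)) (Mem (addr aDig (Reg rJ))))))"

lemma wr_select [simp]: "wr select = {rJ}" by (auto simp: select_def)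

lemma ix_add: "ix B c i + d = ix B (c + d) i" by (simp add: ix_def)

lemma runs_select:
  assumes s: "fst s rB = B" "fst s rX = X" "fst s rK = length p2" "X + length p2 < B"
    "\<forall>j<length p2. snd s (ix B aDig j) = digit r j"
    "\<forall>j<length p2. \<forall>d<3. snd s (ix B (aVar + d) j) = pick (p2 ! j) d"
  shows "runs select s (\<lambda>\<tau> s'. \<tau> \<le> 20 + 100 * length p2 \<and> (\<forall>q. q \<noteq> rJ \<longrightarrow> fst s' q = fst s q) \<and>
     snd s' = (\<lambda>a. if X < a \<and> a \<le> X + length p2 then pick (p2 ! (a - Suc X)) (digit r (a - Suc X)) else snd s a))"
proof -
  let ?n = "length p2"
  define m where "m j = (\<lambda>a. if X < a \<and> a \<le> X + j then pick (p2 ! (a - Suc X)) (digit r (a - Suc X)) else snd s a)" for j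
  let ?I = "\<lambda>j u. (\<forall>q. q \<noteq> rJ \<longrightarrow> fst u q = fst s q) \<and> snd u = m j"
  have "runs (loop rJ rK (Store (Add (Add (Reg rX) (Const 1)) (Reg rJ))
       (Mem (Add (addr aVar (Reg rJ)) (Mem (addr aDig (Reg rJ))))))) ((fst s)(rJ := 0), snd s)
     (\<lambda>\<tau> u. \<tau> \<le> ?n * (90 + 8) + 4 \<and> ?I ?n u)"
  proof (rule runs_loop[where l = 0 and H = ?n and K = 90 and I = ?I])
    fix j u assume j: "j < ?n" "fst u rJ = j" "?I j u"
    have hi: "m j (ix B c i) = snd s (ix B c i)" for c i
      using s(4) j(1) by (auto simp: m_def ix_def)
    have d: "m j (ix B aDig j) = digit r j" "m j (ix B (aVar + digit r j) j) = pick (p2 ! j) (digit r j)"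
      unfolding hi using s(5,6) j(1) digit_less by auto
    have "m (Suc j) = (m j)(Suc (X + j) := pick (p2 ! j) (digit r j))"
      by (auto simp: m_def fun_eq_iff)
    then show "runs (Store (Add (Add (Reg rX) (Const 1)) (Reg rJ))
       (Mem (Add (addr aVar (Reg rJ)) (Mem (addr aDig (Reg rJ)))))) u
       (\<lambda>\<tau> s'. \<tau> \<le> 90 \<and> ?I (Suc j) ((fst s')(rJ := Suc j), snd s'))"
      using j d s(1,2) by (simp add: runs_simps ix_add)
  qed (use s in \<open>auto simp: m_def fun_eq_iff\<close>)
  then show ?thesis unfolding select_def m_def
    by (simp add: runs_simps) (erule runs_mono, auto)
qed

definition advance :: prog where
  "advance = Assign rC (Const 1) ;; Assign rJ (Const 0) ;;
     loop rJ rK (If (Reg rC)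
       (If (Sub (Mem (addr aDig (Reg rJ))) (Const 1)) (Store (addr aDig (Reg rJ)) (Const 0))
         (Store (addr aDig (Reg rJ)) (Add (Mem (addr aDig (Reg rJ))) (Const 1)) ;; Assign rC (Const 0))) Skip)"

lemma wr_advance [simp]: "wr advance = {rC, rJ}" by (auto simp: advance_def)
lemma sto_advance [simp]: "aDig \<in> A \<Longrightarrow> sto A advance" by (simp add: advance_def)

lemma runs_advance:
  assumes s: "fst s rB = B" "fst s rK = k" "\<forall>j<k. snd s (ix B aDig j) = digit r j"
  shows "runs advance s (\<lambda>\<tau> s'. \<tau> \<le> 20 + 200 * k \<and> (\<forall>j<k. snd s' (ix B aDig j) = digit (Suc r) j))"
proof -
  let ?body = "If (Reg rC)
       (If (Sub (Mem (addr aDig (Reg rJ))) (Const 1)) (Store (addr aDig (Reg rJ)) (Const 0))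
         (Store (addr aDig (Reg rJ)) (Add (Mem (addr aDig (Reg rJ))) (Const 1)) ;; Assign rC (Const 0))) Skip"
  let ?I = "\<lambda>j u. fst u rB = B \<and> Suc r div 3 ^ j = r div 3 ^ j + fst u rC \<and> fst u rC \<le> 1 \<and>
     (\<forall>i<j. snd u (ix B aDig i) = digit (Suc r) i) \<and> (\<forall>i. j \<le> i \<and> i < k \<longrightarrow> snd u (ix B aDig i) = digit r i)"
  have "runs (loop rJ rK ?body) ((fst s)(rC := 1, rJ := 0), snd s) (\<lambda>\<tau> u. \<tau> \<le> k * (180 + 8) + 4 \<and> ?I k u)"
  proof (rule runs_loop[where l = 0 and H = k and K = 180 and I = ?I])
    fix j u assume j: "j < k" "fst u rJ = j" "?I j u"
    define a where "a = r div 3 ^ j"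
    have a: "r div 3 ^ Suc j = a div 3" "Suc r div 3 ^ Suc j = (a + fst u rC) div 3"
      "digit r j = a mod 3" "digit (Suc r) j = (a + fst u rC) mod 3" "snd u (ix B aDig j) = a mod 3"
      using j by (simp_all add: a_def digit_def power_Suc2 div_mult2_eq del: power_Suc)
    have c: "fst u rC = 0 \<or> fst u rC = 1" using j(3) by auto
    have m: "a mod 3 = 2 \<Longrightarrow> Suc a div 3 = Suc (a div 3) \<and> Suc a mod 3 = 0"
      "a mod 3 \<le> 1 \<Longrightarrow> Suc a div 3 = a div 3 \<and> Suc a mod 3 = Suc (a mod 3)" by presburger+
    have m2: "\<not> a mod 3 \<le> Suc 0 \<longleftrightarrow> a mod 3 = 2" by presburger
    show "runs ?body u (\<lambda>\<tau> s'. \<tau> \<le> 180 \<and> ?I (Suc j) ((fst s')(rJ := Suc j), snd s'))"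
    proof (cases "fst u rC = 0")
      case True
      then show ?thesis using j a by (auto simp: runs_simps less_Suc_eq simp del: power_Suc)
    next
      case False
      then have c1: "fst u rC = 1" using c by simp
      show ?thesis
      proof (cases "a mod 3 = 2")
        case True
        then show ?thesis using j a c1 m(1) by (auto simp: runs_simps less_Suc_eq simp del: power_Suc)
      next
        case False
        then have "a mod 3 \<le> 1" using m2 by simp
        then show ?thesis using j a c1 m(2) by (auto simp: runs_simps less_Suc_eq simp del: power_Suc)
      qed
    qed
  qed (use s in auto)
  then show ?thesis unfolding advance_def
    by (simp add: runs_simps) (erule runs_mono, simp)
qed

lemma in_links:
  assumes "at M a (concat (map enc_clause p))" "\<forall>c\<in>set p. length c \<le> 2"
    "h \<in> set (headers a p)" "q \<in> ad M h"
  shows "(q, partner a p h) \<in> links M (pairs a p)"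
proof -
  note f = pairs_at[OF assms(1,2), THEN conjunct2]
  have "h \<in> \<Union> ((\<lambda>(u, v). {u, v} - {0}) ` set (pairs a p))"
    unfolding f[THEN conjunct1] by (rule assms)
  then obtain c where c: "c \<in> set (pairs a p)" "h \<in> (case c of (u, v) \<Rightarrow> {u, v} - {0})" by blast
  obtain u v where uv: "c = (u, v)" by fastforce
  have "(u \<noteq> 0 \<longrightarrow> partner a p u = v) \<and> (v \<noteq> 0 \<longrightarrow> partner a p v = u)"
    using bspec[OF f[THEN conjunct2, THEN conjunct1] c(1)] uv by simp
  then have "(q, partner a p h) \<in> (if u = 0 then {} else ad M u \<times> {v}) \<union> (if v = 0 then {} else ad M v \<times> {u})"
    using c(2) uv assms(4) by auto
  then show ?thesis unfolding links_def by (intro UN_I[OF c(1)]) (simp add: uv)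
qed

lemma headers_vars:
  assumes "at M a (concat (map enc_clause p))" "h \<in> set (headers a p)"
  shows "\<exists>c\<in>set p. vars M h \<in> set c"
  using assms
proof (induction p arbitrary: a)
  case (Cons c p)
  have at: "at M (a + length (enc_clause c)) (concat (map enc_clause p))"
    "at M (Suc a) (concat (map enc_term c))"
    using Cons.prems by (auto simp: at_enc_clause)
  from Cons.prems(2) consider "h \<in> set (heads (Suc a) c)" | "h \<in> set (headers (a + length (enc_clause c)) p)"
    by auto
  then show ?case
  proof cases
    case 1
    then have "vars M h \<in> set (map (vars M) (heads (Suc a) c))" by simp
    then have "vars M h \<in> set c" unfolding heads_at[OF at(2), THEN conjunct2, THEN conjunct2] .
    then show ?thesis by simp
  next
    case 2
    then show ?thesis using Cons.IH[OF at(1)] by auto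
  qed
qed simp

lemma length_headers: "\<forall>c\<in>set p. length c \<le> 2 \<Longrightarrow> length (headers a p) \<le> 2 * length p"
proof (induction p arbitrary: a)
  case (Cons c p)
  then show ?case using Cons.IH[of "a + length (enc_clause c)"] by fastforce
qed simp

lemma length_vars: "length (vars M h) = M h"
  by (simp add: vars_def del: upt_Suc)

context layout begin

lemma M_le:
  assumes "\<And>c s. c \<in> set p1 \<Longrightarrow> s \<in> set c \<Longrightarrow> length s \<le> t" "h \<in> Hdr"
  shows "M h \<le> Suc (t + M X)"
proof -
  have "M h \<le> t" if h: "h \<in> Tm"
  proof -
    obtain c where "c \<in> set p1" "vars M h \<in> set c" using headers_vars[OF at h] by blast
    then show ?thesis using assms(1)[of c "vars M h"] by (simp add: length_vars)
  qed
  then show ?thesis using assms(2) M0 by fastforce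
qed

lemma card_Hdr: "card Hdr \<le> 2 * length p1 + 2"
proof -
  have "card Tm \<le> 2 * length p1"
    using card_length[of "headers 2 p1"] length_headers[OF len, of 2] by linarith
  then show ?thesis
    using card_insert_le_m1[of "Suc (Suc (2 * length p1))" "insert X Tm" 0]
      card_insert_le_m1[of "Suc (2 * length p1)" Tm X] by simp
qed

lemma card_Occ:
  assumes "\<And>c s. c \<in> set p1 \<Longrightarrow> s \<in> set c \<Longrightarrow> length s \<le> t"
  shows "card Occ \<le> 2 * length p1 * t"
proof -
  have "card (ad M h) \<le> t" if h: "h \<in> Tm" for h
  proof -
    obtain c where "c \<in> set p1" "vars M h \<in> set c" using headers_vars[OF at h] by blast
    then show ?thesis using assms[of c "vars M h"] by (simp add: length_vars ad_def)
  qed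
  then have "card Occ \<le> (\<Sum>h\<in>Tm. t)"
    using card_UN_le[of Tm "ad M"] sum_mono[of Tm "\<lambda>h. card (ad M h)" "\<lambda>_. t"] by fastforce
  also have "\<dots> \<le> 2 * length p1 * t"
    using card_length[of "headers 2 p1"] length_headers[OF len, of 2] by simp
  finally show ?thesis .
qed

lemma set_flat_pairs: "Tm \<subseteq> set (flat (pairs 2 p1))" "set (flat (pairs 2 p1)) \<subseteq> insert 0 Tm"
proof -
  show "Tm \<subseteq> set (flat (pairs 2 p1))"
  proof
    fix h assume "h \<in> Tm"
    then obtain u v where uv: "(u, v) \<in> set (pairs 2 p1)" "h = u \<or> h = v" by (rule Tm_pair)
    then show "h \<in> set (flat (pairs 2 p1))" unfolding set_flat by (intro UN_I[OF uv(1)]) auto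
  qed
  show "set (flat (pairs 2 p1)) \<subseteq> insert 0 Tm"
  proof
    fix h assume "h \<in> set (flat (pairs 2 p1))"
    then obtain c where c: "c \<in> set (pairs 2 p1)" "h \<in> {fst c, snd c}"
      unfolding set_flat by (auto simp: case_prod_unfold)
    then show "h \<in> insert 0 Tm" using pair_Tm[of "fst c" "snd c" h] by simp
  qed
qed

lemma env_linked:
  assumes "fst s rB = B" "fst s rX = X" "\<forall>a<B. snd s a = M a"
    and l: "linked B M (cell_list M (flat (pairs 2 p1))) (links M (pairs 2 p1)) s"
    and o: "opp = (\<lambda>q. snd s (ix B aOpp q))"
  shows "env s"
proof -
  let ?cs = "cell_list M (flat (pairs 2 p1))"
  have occ: "occ_list s x (rev (filter (\<lambda>p. M p = x) ?cs))" if "x \<noteq> 0" for x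
  proof -
    have "{q \<in> set ?cs. M q = x} = {q\<in>Occ. M q = x}"
    proof (intro Collect_cong iffI conjI; elim conjE)
      fix q assume q: "q \<in> set ?cs" and x: "M q = x"
      from q[unfolded set_cell_list] obtain h where h: "h \<in> set (flat (pairs 2 p1))" "q \<in> ad M h"
        by (rule UN_E)
      have "h \<noteq> 0"
      proof
        assume "h = 0"
        then have "q = Suc 0" using h(2) ad0 by simp
        then show False using x that M1 by simp
      qed
      then have "h \<in> Tm" using subsetD[OF set_flat_pairs(2) h(1)] by simp
      then show "q \<in> Occ" using h(2) by (rule UN_I)
    next
      fix q assume "q \<in> Occ" "M q = x"
      from this(1) show "q \<in> set ?cs" unfolding set_cell_list using UN_mono[OF set_flat_pairs(1) order_refl] by (rule rev_subsetD)
    qed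
    then show ?thesis using l that unfolding occ_list_def linked_def by simp
  qed
  show ?thesis
    unfolding env_def
  proof (intro conjI ballI allI impI)
    show "snd s a = M a" if "a < B" for a using assms(3) that by blast
    show "snd s (ix B aOpp p) = opp p" for p by (simp add: o)
    show "\<exists>L. occ_list s x L" if "x \<noteq> 0" for x using occ[OF that] by (rule exI)
  qed (rule assms)+
qed

end

definition solvable :: "sigma_pi_poly \<Rightarrow> nat list \<Rightarrow> bool" where
  "solvable p1 xs \<longleftrightarrow> (\<exists>ss\<in>listset (map set p1). distinct (concat ss @ xs) \<and> 0 \<notin> set (concat ss @ xs))"

definition solve_time :: "nat \<Rightarrow> nat \<Rightarrow> nat \<Rightarrow> nat" where
  "solve_time m k t = 20 + Suc m * (1200 + 2 * ((2 * m + 2) * (70 + 210 * Suc (t + k)) + 250 * (2 * m * t)))"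

lemma runs_solve_layout:
  assumes s: "fst s rB = B" "fst s rX = X" "fst s rN = Suc (length p1)" "\<forall>a<B. snd s a = M a"
    and at: "at M 2 (concat (map enc_clause p1))" and len: "\<forall>c\<in>set p1. length c \<le> 2"
    and X: "X = 2 + length (concat (map enc_clause p1))" and XB: "X + M X < B"
    and M0: "M 0 = Suc 0" and M1: "M (Suc 0) = 0"
    and T: "\<And>c s. c \<in> set p1 \<Longrightarrow> s \<in> set c \<Longrightarrow> length s \<le> t"
    and l: "linked B M (cell_list M (flat (pairs 2 p1))) (links M (pairs 2 p1)) s"
    and ps: "\<forall>i < length (pairs 2 p1 @ [(X, 0)]).
        snd s (ix B aFst i) = fst ((pairs 2 p1 @ [(X, 0)]) ! i) \<and>
        snd s (ix B aSnd i) = snd ((pairs 2 p1 @ [(X, 0)]) ! i)"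
    and fr: "\<forall>x. snd s (ix B aMark x) \<le> fst s rStamp \<and> snd s (ix B aInq x) \<le> fst s rStamp"
  shows "runs solve s (\<lambda>\<tau> s'. \<tau> \<le> solve_time (length p1) (M X) t \<and>
     (\<forall>x. snd s' (ix B aMark x) \<le> fst s' rStamp \<and> snd s' (ix B aInq x) \<le> fst s' rStamp) \<and>
     fst s' rOk = (if solvable p1 (vars M X) then 1 else 0))"
proof -
  interpret layout M B X p1 "\<lambda>q. snd s (ix B aOpp q)"
  proof
    show "snd s (ix B aOpp q) = partner 2 p1 h" if "h \<in> set (headers 2 p1)" "q \<in> ad M h" for h q
    proof -
      have "\<forall>(q, h)\<in>links M (pairs 2 p1). snd s (ix B aOpp q) = h" using l by (simp add: linked_def)
      from bspec[OF this in_links[OF at len that]] show ?thesis by simp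
    qed
  qed fact+
  let ?ps = "pairs 2 p1 @ [(X, 0)]"
  have env: "env s" by (rule env_linked[OF s(1,2,4) l refl])
  have fresh: "fresh s" using fr by (simp add: fresh_def)
  have iff: "(\<forall>(u, v)\<in>set ?ps. viable u \<or> viable v) \<longleftrightarrow> solvable p1 (vars M X)"
  proof
    assume "\<forall>(u, v)\<in>set ?ps. viable u \<or> viable v"
    from solvable_if_viable[OF this] show "solvable p1 (vars M X)" unfolding solvable_def .
  next
    assume "solvable p1 (vars M X)"
    then obtain ss where "ss \<in> listset (map set p1)" "distinct (concat ss @ vars M X)"
      "0 \<notin> set (concat ss @ vars M X)" unfolding solvable_def by blast
    from viable_if_solvable[OF this] show "\<forall>(u, v)\<in>set ?ps. viable u \<or> viable v"
      by (simp only: case_prod_unfold) blast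
  qed
  have H: "u \<in> Hdr \<and> v \<in> Hdr" if "(u, v) \<in> set ?ps" for u v
  proof (cases "(u, v) \<in> set (pairs 2 p1)")
    case True
    have "u \<in> insert 0 Tm" "v \<in> insert 0 Tm" by (rule pair_Tm[OF True], simp)+
    then show ?thesis by blast
  qed (use that in simp)
  have N: "fst s rN = length ?ps" using s(3) by simp
  have "length ?ps * (1200 + 2 * (card Hdr * (70 + 210 * Suc (t + M X)) + 250 * card Occ)) + 20
     \<le> solve_time (length p1) (M X) t"
    unfolding solve_time_def using card_Hdr card_Occ[OF T]
    by (simp only: length_append length_pairs list.size One_nat_def add_Suc_right add_0_right add.commute[of _ 20])
       (intro add_mono mult_mono order_refl, simp_all)
  then show ?thesis
    by (intro runs_mono[OF runs_solve[OF env fresh N _ _ H M_le[OF T], unfolded iff]])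
       (use ps in \<open>auto simp: fresh_def\<close>)
qed

lemma linked_agree:
  assumes "\<And>h. h \<in> set (flat ps) \<Longrightarrow> h + M h \<le> X" "\<And>a. a \<le> X \<Longrightarrow> M' a = M a"
    "linked B M (cell_list M (flat ps)) (links M ps) s"
  shows "linked B M' (cell_list M' (flat ps)) (links M' ps) s"
proof -
  have h: "M' h = M h" if "h \<in> set (flat ps)" for h
    using assms(1)[OF that] assms(2)[of h] by simp
  have c: "cell_list M' (flat ps) = cell_list M (flat ps)"
    unfolding cell_list_def by (intro arg_cong[of _ _ concat] map_cong refl) (simp add: h)
  have "M' q = M q" if "q \<in> set (cell_list M (flat ps))" for q
  proof -
    obtain h where "h \<in> set (flat ps)" "q \<in> ad M h" using \<open>q \<in> _\<close> unfolding set_cell_list by blast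
    then show ?thesis using assms(1)[of h] assms(2)[of q] by (simp add: ad_def)
  qed
  then have f: "filter (\<lambda>q. M' q = x) (cell_list M (flat ps)) = filter (\<lambda>q. M q = x) (cell_list M (flat ps))" for x
    by (intro filter_cong) auto
  have "ad M' h = ad M h" if "h \<in> set (flat ps)" for h using h[OF that] by (simp add: ad_def)
  then have "links M' ps = links M ps"
    unfolding links_def by (intro SUP_cong refl) (auto simp: set_flat split: prod.splits; blast)
  then show ?thesis using assms(3) unfolding linked_def c f by simp
qed

section \<open>The algorithm\<close>

definition selection :: "sigma_poly \<Rightarrow> nat \<Rightarrow> nat list" where
  "selection p2 r = map (\<lambda>j. pick (p2 ! j) (digit r j)) [0..<length p2]"

definition round :: prog where
  "round = select ;; solve ;; If (Reg rOk) (Assign rAns (Const 1)) Skip ;; advance"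

lemma wr_round [simp]:
  "wr round = {rAns, rJ, rC, rOk, rI, rF, rH, rStamp, rQh, rP, rE, rConf, rO, rQt, rQ, rV}"
  by (auto simp: round_def)

lemma runs_search:
  assumes s: "fst s rB = B" "fst s rX = X" "fst s rK = length p2" "fst s rN = Suc (length p1)"
    "fst s rT = 3 ^ length p2" "fst s rAns = 0" "\<forall>a<B. snd s a = M a"
    and at: "at M 2 (concat (map enc_clause p1))" and len: "\<forall>c\<in>set p1. length c \<le> 2"
    and X: "X = 2 + length (concat (map enc_clause p1))" and XB: "X + length p2 < B"
    and MX: "M X = length p2" and M0: "M 0 = Suc 0" and M1: "M (Suc 0) = 0"
    and T: "\<And>c s. c \<in> set p1 \<Longrightarrow> s \<in> set c \<Longrightarrow> length s \<le> t"
    and l: "linked B M (cell_list M (flat (pairs 2 p1))) (links M (pairs 2 p1)) s"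
    and ps: "\<forall>i < length (pairs 2 p1 @ [(X, 0)]).
        snd s (ix B aFst i) = fst ((pairs 2 p1 @ [(X, 0)]) ! i) \<and>
        snd s (ix B aSnd i) = snd ((pairs 2 p1 @ [(X, 0)]) ! i)"
    and vars: "\<forall>j<length p2. \<forall>d<3. snd s (ix B (aVar + d) j) = pick (p2 ! j) d"
    and zero: "\<And>c i. c \<in> {aDig, aMark, aInq} \<Longrightarrow> snd s (ix B c i) = 0"
  shows "runs (Assign rR (Const 0) ;; loop rR rT round) s
     (\<lambda>\<tau> s'. \<tau> \<le> 20 + 3 ^ length p2 * (solve_time (length p1) (length p2) t + 300 * length p2 + 70) \<and>
        fst s' rAns = (if \<exists>r < 3 ^ length p2. solvable p1 (selection p2 r) then 1 else 0))"
proof -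
  let ?m = "length p1" and ?k = "length p2" and ?ps = "pairs 2 p1"
  let ?S = "solve_time (length p1) (length p2) t"
  let ?K = "?S + 300 * ?k + 60"
  let ?P = "\<lambda>u. \<forall>i < length (?ps @ [(X, 0)]). snd u (ix B aFst i) = fst ((?ps @ [(X, 0)]) ! i) \<and>
        snd u (ix B aSnd i) = snd ((?ps @ [(X, 0)]) ! i)"
  let ?F = "\<lambda>u. \<forall>x. snd u (ix B aMark x) \<le> fst u rStamp \<and> snd u (ix B aInq x) \<le> fst u rStamp"
  let ?V = "\<lambda>u. \<forall>j<?k. \<forall>d<3. snd u (ix B (aVar + d) j) = pick (p2 ! j) d"
  let ?L = "linked B M (cell_list M (flat ?ps)) (links M ?ps)"
  define low where "low u \<longleftrightarrow> (\<forall>a<B. \<not> (X < a \<and> a \<le> X + ?k) \<longrightarrow> snd u a = M a)" for u :: state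
  define ans where "ans r = (if \<exists>r'<r. solvable p1 (selection p2 r') then 1 else 0 :: nat)" for r :: nat
  define I where "I r u \<longleftrightarrow> fst u rB = B \<and> fst u rX = X \<and> fst u rK = ?k \<and> fst u rN = Suc ?m \<and>
     low u \<and> ?P u \<and> ?L u \<and> ?V u \<and> (\<forall>j<?k. snd u (ix B aDig j) = digit r j) \<and> ?F u \<and> fst u rAns = ans r" for r u
  let ?s = "((fst s)(rR := 0), snd s)"
  have "low ?s" using s(7) by (simp add: low_def)
  moreover have "?L ?s" using l by (rule linked_cong) simp
  moreover have "\<forall>j<?k. snd ?s (ix B aDig j) = digit 0 j" using zero by (simp add: digit_def)
  moreover have "?F ?s" using zero by simp
  ultimately have I0: "I 0 ?s" unfolding I_def using s ps vars by (simp add: ans_def)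
  have "runs (loop rR rT round) ?s (\<lambda>\<tau> u. \<tau> \<le> 3 ^ ?k * (?K + 8) + 4 \<and> fst u rAns = ans (3 ^ ?k))"
  proof (rule runs_loop[where l = 0 and H = "3 ^ ?k" and I = I and K = ?K])
    fix r u assume r: "I r u"
    have u: "fst u rB = B" "fst u rX = X" "fst u rK = ?k" "fst u rN = Suc ?m"
      "low u" "?P u" "?L u" "?V u" "\<forall>j<?k. snd u (ix B aDig j) = digit r j" "?F u" "fst u rAns = ans r"
      using r[unfolded I_def] by - (elim conjE, assumption)+
    define N where "N = (\<lambda>a. if X < a \<and> a \<le> X + ?k then pick (p2 ! (a - Suc X)) (digit r (a - Suc X)) else M a)"
    have NM: "N a = M a" if "a \<le> X" for a using that by (simp add: N_def)
    have NX: "N X = ?k" using MX by (simp add: NM)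
    have vN: "vars N X = selection p2 r"
    proof (rule nth_equalityI)
      fix i assume "i < length (vars N X)"
      then have "i < ?k" by (simp add: length_vars NX)
      moreover have "N (Suc X + i) = pick (p2 ! i) (digit r i)" if "i < ?k"
        using that by (simp add: N_def)
      ultimately show "vars N X ! i = selection p2 r ! i"
        by (simp add: vars_def NX selection_def del: upt_Suc)
    qed (simp add: length_vars NX selection_def)
    have atN: "at N 2 (concat (map enc_clause p1))"
      by (rule at_cong[OF at]) (use NM X in auto)
    have flat: "h + M h \<le> X" if "h \<in> set (flat ?ps)" for h
    proof (cases "h = 0")
      case False
      from that obtain c where c: "c \<in> set ?ps" "h \<in> {fst c, snd c}"
        unfolding set_flat by (auto simp: case_prod_unfold)
      then show ?thesis using pair_bound[OF at len, of "fst c" "snd c" h] False X by simp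
    qed (use M0 X in simp)
    let ?post = "\<lambda>\<tau> s'. \<tau> \<le> ?K \<and> I (Suc r) ((fst s')(rR := Suc r), snd s')"
    show "runs round u ?post"
      unfolding round_def runs_Seq[of select]
    proof (rule runs_mono[OF runs_select[OF u(1-3) XB u(9,8)]])
      fix \<tau>1 v
      assume v0: "\<tau>1 \<le> 20 + 100 * ?k \<and> (\<forall>q. q \<noteq> rJ \<longrightarrow> fst v q = fst u q) \<and>
        snd v = (\<lambda>a. if X < a \<and> a \<le> X + ?k then pick (p2 ! (a - Suc X)) (digit r (a - Suc X)) else snd u a)"
      have vix: "snd v (ix B c i) = snd u (ix B c i)" for c i
        using v0 XB by (auto simp: ix_def)
      have vlow: "\<forall>a<B. snd v a = N a" using v0 u(5) by (auto simp: N_def low_def)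
      have v: "fst v rB = B" "fst v rX = X" "fst v rN = Suc ?m" "fst v rK = ?k" "fst v rAns = ans r"
        using v0 u by auto
      have stamp: "fst v rStamp = fst u rStamp" using v0 by simp
      have vP: "?P v" unfolding vix by (rule u(6))
      have vF: "?F v" unfolding vix stamp by (rule u(10))
      have vV: "?V v" unfolding vix by (rule u(8))
      have lv: "?L v" by (rule linked_cong[OF u(7)]) (rule vix)
      have lN: "linked B N (cell_list N (flat ?ps)) (links N ?ps) v"
        by (rule linked_agree[OF flat NM lv])
      have "X + N X < B" "N 0 = Suc 0" "N (Suc 0) = 0" using NX XB M0 M1 NM X by auto
      note solve = runs_solve_layout[OF v(1-3) vlow atN len X this T lN vP vF, unfolded NX vN]
      show "runs (solve ;; If (Reg rOk) (Assign rAns (Const 1)) Skip ;; advance) v (\<lambda>\<sigma>. ?post (\<tau>1 + \<sigma>))"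
        unfolding runs_Seq[of solve]
      proof (rule runs_frame[OF solve, where
            W = "{rOk, rI, rF, rH, rStamp, rQh, rP, rE, rConf, rO, rQt, rQ, rV}" and A = "{aMark, aInq, aQueue}"],
          goal_cases)
        case (6 \<tau>2 w)
        let ?a = "ans (Suc r)"
        let ?w = "((fst w)(rAns := ?a), snd w)"
        have ans: "?a = (if solvable p1 (selection p2 r) then 1 else ans r)"
          by (auto simp: ans_def less_Suc_eq)
        have wix: "snd w (ix B c i) = snd v (ix B c i)" if "c < 16" "c \<notin> {aMark, aInq, aQueue}" for c i
          using 6(2) v(1) that by (simp add: frame_def)
        have wlow: "snd w a = snd v a" if "a < B" for a using 6(2) v(1) that by (simp add: frame_def)
        have w: "fst ?w rB = B" "fst ?w rX = X" "fst ?w rN = Suc ?m" "fst ?w rK = ?k" "fst w rAns = ans r"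
          using 6(2) v by (auto simp: frame_def)
        have dig: "\<forall>j<?k. snd ?w (ix B aDig j) = digit r j" using u(9) by (simp add: wix vix)
        have adv: "runs advance ?w (\<lambda>\<tau>3 z. \<tau>3 \<le> 20 + 200 * ?k \<and> I (Suc r) ((fst z)(rR := Suc r), snd z))"
        proof (rule runs_frame[OF runs_advance[OF w(1,4) dig], where W = "{rC, rJ}" and A = "{aDig}"], goal_cases)
          case (4 \<tau>3 z)
          have zix: "snd z (ix B c i) = snd w (ix B c i)" if "c < 16" "c \<noteq> aDig" for c i
            using 4(2) w(1) that by (simp add: frame_def)
          have zlow: "snd z a = snd w a" if "a < B" for a using 4(2) w(1) that by (simp add: frame_def)
          have z: "fst z rB = B" "fst z rX = X" "fst z rN = Suc ?m" "fst z rK = ?k" "fst z rAns = ?a"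
             "fst z rStamp = fst w rStamp"
            using 4(2) w by (auto simp: frame_def)
          have "low z" using vlow by (simp add: low_def zlow wlow N_def)
          moreover have "?P z" using vP by (simp add: zix wix)
          moreover have "?V z" using vV by (simp add: zix wix)
          moreover have "?L z" by (rule linked_cong[OF lv]) (auto simp: zix wix)
          moreover have "?F z" using 6(1) by (simp add: zix z)
          ultimately show ?case using 4(1) z unfolding I_def by (simp add: low_def)
        qed auto
        show ?case
        proof (cases "solvable p1 (selection p2 r)")
          case True
          then show ?thesis using 6(1) v0 ans adv by (auto simp: runs_simps elim!: runs_mono)
        next
          case False
          then have "?w = w" using ans w(5) by (cases w) auto
          then show ?thesis using False 6(1) v0 adv by (auto simp: runs_simps elim!: runs_mono)
        qed
      qed auto
    qed
  qed (use I0 s(5) in \<open>auto simp: I_def\<close>)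
  then show ?thesis
    unfolding ans_def by (simp add: runs_simps split del: if_split) (erule runs_mono, simp add: algebra_simps)
qed

lemma multilinear_mset: "multilinear (mset ys) \<longleftrightarrow> distinct ys"
  by (simp add: multilinear_def distinct_count_atmost_1 count_eq_zero_iff flip: set_mset_mset) 
    (metis count_eq_zero_iff set_mset_mset)

lemma ex_solvable_iff:
  assumes p1: "\<forall>c\<in>set p1. \<forall>s\<in>set c. 0 \<notin> set s"
    and p2: "\<forall>c\<in>set p2. length c \<le> 3 \<and> 0 \<notin> set c"
  shows "(\<exists>r < 3 ^ length p2. solvable p1 (selection p2 r)) \<longleftrightarrow> has_multilinear_monomial p1 p2"
proof
  assume "\<exists>r < 3 ^ length p2. solvable p1 (selection p2 r)"
  then obtain r ss where ss: "ss \<in> listset (map set p1)" "distinct (concat ss @ selection p2 r)"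
    "0 \<notin> set (selection p2 r)" by (auto simp: solvable_def)
  have "pick (p2 ! j) (digit r j) \<in> set (p2 ! j)" if "j < length p2" for j
  proof -
    have "pick (p2 ! j) (digit r j) \<noteq> 0"
      using ss(3) that by (auto simp: selection_def)
    then show ?thesis by (auto simp: pick_def split: if_splits)
  qed
  then have "selection p2 r \<in> listset (map set p2)"
    by (auto simp: in_listset list_all2_conv_all_nth selection_def)
  then have "mset (concat ss) + mset (selection p2 r) \<in> expansion p1 p2"
    using ss(1) by (auto simp: expansion_def)
  moreover have "multilinear (mset (concat ss) + mset (selection p2 r))"
    using ss(2) multilinear_mset[of "concat ss @ selection p2 r"] by (simp only: mset_append)
  ultimately show "has_multilinear_monomial p1 p2"
    unfolding has_multilinear_monomial_def by blast
next
  assume "has_multilinear_monomial p1 p2"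
  then obtain ss xs where ss: "ss \<in> listset (map set p1)" "xs \<in> listset (map set p2)"
    and "multilinear (mset (concat ss) + mset xs)"
    unfolding has_multilinear_monomial_def expansion_def by blast
  then have d: "distinct (concat ss @ xs)"
    using multilinear_mset[of "concat ss @ xs"] by (simp only: mset_append)
  have xs: "length xs = length p2" "\<And>j. j < length p2 \<Longrightarrow> xs ! j \<in> set (p2 ! j)"
    using ss(2) by (auto simp: in_listset list_all2_conv_all_nth)
  have "\<exists>d. d < 3 \<and> pick (p2 ! j) d = xs ! j" if j: "j < length p2" for j
  proof -
    obtain d where "d < length (p2 ! j)" "p2 ! j ! d = xs ! j"
      using xs(2)[OF j] by (meson in_set_conv_nth)
    moreover have "length (p2 ! j) \<le> 3" using p2 j by simp
    ultimately show ?thesis by (intro exI[of _ d]) (simp add: pick_def)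
  qed
  then obtain d where d: "\<And>j. j < length p2 \<Longrightarrow> d j < 3" "\<And>j. j < length p2 \<Longrightarrow> pick (p2 ! j) (d j) = xs ! j"
    by metis
  obtain r where r: "r < 3 ^ length p2" "\<forall>j<length p2. digit r j = d j"
    using digits_exist[of "length p2" d] d(1) by blast
  have "selection p2 r = xs"
    using r(2) d(2) xs(1) by (intro nth_equalityI) (auto simp: selection_def)
  moreover have "0 \<notin> set xs"
    using xs p2 by (auto simp: in_set_conv_nth) (metis nth_mem)
  moreover have "0 \<notin> set (concat ss)"
  proof
    assume "0 \<in> set (concat ss)"
    then obtain x where x: "x \<in> set ss" "0 \<in> set x" by auto
    then obtain i where i: "i < length ss" "0 \<in> set (ss ! i)" by (metis in_set_conv_nth)
    then have "ss ! i \<in> set (p1 ! i)" "i < length p1"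
      using ss(1) by (auto simp: in_listset list_all2_conv_all_nth)
    then show False using p1 i(2) nth_mem by blast
  qed
  ultimately have "solvable p1 (selection p2 r)"
    using ss(1) \<open>distinct (concat ss @ xs)\<close> unfolding solvable_def by auto
  then show "\<exists>r < 3 ^ length p2. solvable p1 (selection p2 r)" using r(1) by blast
qed

definition decide :: prog where
  "decide = scan ;; build ;; load ;; pow3 ;; Assign rR (Const 0) ;; loop rR rT round"

lemma runs_wr:
  assumes "runs P s Q" "\<And>\<tau> s'. Q \<tau> s' \<Longrightarrow> (\<And>r. r \<notin> wr P \<Longrightarrow> fst s' r = fst s r) \<Longrightarrow> Q' \<tau> s'"
  shows "runs P s Q'"
  using assms exec_wr unfolding runs_def by blast

lemma length_enc_terms: "length p \<le> length (concat (map enc_term p))"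
  by (induction p) auto

lemma runs_decide:
  assumes len1: "\<forall>c\<in>set p1. length c \<le> 2" and T: "\<And>c s. c \<in> set p1 \<Longrightarrow> s \<in> set c \<Longrightarrow> length s \<le> t"
    and len2: "\<forall>c\<in>set p2. length c \<le> 3"
  shows "runs decide (init_state (encode n p1 p2)) (\<lambda>\<tau> s.
     \<tau> \<le> 300 + length p1 * (760 + 400 * t) + 240 * length p2 +
          3 ^ length p2 * (solve_time (length p1) (length p2) t + 300 * length p2 + 70) \<and>
     fst s rAns = (if \<exists>r < 3 ^ length p2. solvable p1 (selection p2 r) then 1 else 0))"
proof -
  let ?w = "encode n p1 p2" and ?m = "length p1" and ?k = "length p2"
  let ?s = "init_state ?w"
  let ?time = "\<lambda>\<tau>. \<tau> \<le> 300 + ?m * (760 + 400 * t) + 240 * ?k +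
          3 ^ ?k * (solve_time ?m ?k t + 300 * ?k + 70)"
  define X where "X = 2 + length (concat (map enc_clause p1))"
  define B where "B = Suc (X + length (concat (map enc_term p2)))"
  define M where "M = (snd ?s)(0 := Suc 0, Suc 0 := 0)"
  have lw: "length ?w = B" by (simp add: encode_eq B_def X_def)
  have "at (snd ?s) 0 ?w" by (simp add: at_def init_state_def)
  then have w: "snd ?s (Suc 0) = ?m"
    "at (snd ?s) 2 (concat (map enc_clause p1) @ ?k # concat (map enc_term p2))"
    unfolding encode_eq by (simp_all add: numeral_2_eq_2)
  have atM: "at M 2 (concat (map enc_clause p1) @ ?k # concat (map enc_term p2))"
    by (rule at_cong[OF w(2)]) (simp add: M_def)
  then have at1: "at M 2 (concat (map enc_clause p1))" and MX: "M X = ?k"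
    and at2: "at M (Suc X) (concat (map enc_term p2))"
    by (auto simp: X_def)
  have XB: "X + ?k < B" using length_enc_terms[of p2] by (simp add: B_def)
  have M01: "M 0 = Suc 0" "M (Suc 0) = 0" by (simp_all add: M_def)
  have Mix: "M (ix B c i) = 0" for c i
  proof -
    have "ix B c i \<ge> B" "2 \<le> B" by (simp_all add: ix_def B_def X_def)
    then show ?thesis by (simp add: M_def init_state_def lw)
  qed
  have "fst ?s rAns = 0" by (simp add: init_state_def)
  show ?thesis
    unfolding decide_def runs_Seq[of scan] runs_Seq[of build] runs_Seq[of load] runs_Seq[of pow3]
  proof (rule runs_wr[OF runs_scan[OF w len1 X_def B_def]], goal_cases)
    case (1 \<tau>1 s1)
    then have s1: "fst s1 rB = B" "fst s1 rX = X" "fst s1 rM = ?m" "fst s1 rK = ?k" "snd s1 = M" "fst s1 rAns = 0"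
      using \<open>fst ?s rAns = 0\<close> by (auto simp: M_def)
    have l1: "snd s1 a = M a" "snd s1 (ix B c i) = 0" for a c i using s1(5) Mix by auto
    show ?case
    proof (rule runs_frame[OF runs_build[OF s1(1) l1(1) l1(2) s1(3,2) at1 len1 X_def _ M01 T],
          where W = "{rA, rI, rU, rW, rC, rP, rE, rN}" and A = "{aOpp, aNext, aHead, aFst, aSnd}"], goal_cases)
      case (7 \<tau>2 s2)
      have r2: "fst s2 rB = B" "fst s2 rX = X" "fst s2 rK = ?k" "fst s2 rAns = 0" "fst s2 rN = Suc ?m"
        using 7 s1 by (auto simp: frame_def)
      have l2: "snd s2 a = M a" if "a < B" for a using 7(2) s1(1,5) that by (simp add: frame_def)
      have z2: "snd s2 (ix B c i) = 0" if "c < 16" "c \<notin> {aOpp, aNext, aHead, aFst, aSnd}" for c i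
        using 7(2) s1(1,5) that Mix by (simp add: frame_def)
      have v2: "snd s2 (ix B (aVar + d) i) = 0" if "d < 3" for d i using that by (intro z2) auto
      show ?case
      proof (rule runs_frame[OF runs_load[OF r2(1) l2 r2(2,3) v2 at2 B_def len2],
            where W = "{rA, rJ, rC}" and A = "{5, 6, 7}"], goal_cases)
        case (6 \<tau>3 s3)
        have r3: "fst s3 rB = B" "fst s3 rX = X" "fst s3 rK = ?k" "fst s3 rAns = 0" "fst s3 rN = Suc ?m"
          using 6(2) r2 by (auto simp: frame_def)
        have l3: "snd s3 a = snd s2 a" if "a < B" for a using 6(2) r2(1) that by (simp add: frame_def)
        have i3: "snd s3 (ix B c i) = snd s2 (ix B c i)" if "c < 16" "c \<notin> {5, 6, 7}" for c i
          using 6(2) r2(1) that by (simp add: frame_def)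
        show ?case
        proof (rule runs_frame[OF runs_pow3[OF r3(3)], where W = "{rT, rJ}" and A = "{}"], goal_cases)
          case (4 \<tau>4 s4)
          have r4: "fst s4 rB = B" "fst s4 rX = X" "fst s4 rK = ?k" "fst s4 rN = Suc ?m" "fst s4 rT = 3 ^ ?k" "fst s4 rAns = 0"
            using 4 r3 by (auto simp: frame_def)
          have l4: "\<forall>a<B. snd s4 a = M a" using 4(2) r3(1) l3 l2 by (simp add: frame_def)
          have i4: "snd s4 (ix B c i) = snd s3 (ix B c i)" if "c < 16" for c i
            using 4(2) r3(1) that by (simp add: frame_def)
          have "linked B M (cell_list M (flat (pairs 2 p1))) (links M (pairs 2 p1)) s2" using 7(1) by blast
          then have l: "linked B M (cell_list M (flat (pairs 2 p1))) (links M (pairs 2 p1)) s4"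
            by (rule linked_cong) (auto simp: i4 i3)
          have ps: "\<forall>i < length (pairs 2 p1 @ [(X, 0)]).
            snd s4 (ix B aFst i) = fst ((pairs 2 p1 @ [(X, 0)]) ! i) \<and>
            snd s4 (ix B aSnd i) = snd ((pairs 2 p1 @ [(X, 0)]) ! i)"
            using 7(1) by (simp add: i4 i3)
          have v: "\<forall>j<?k. \<forall>d<3. snd s4 (ix B (aVar + d) j) = pick (p2 ! j) d"
            using 6(1) by (simp add: i4)
          have z: "snd s4 (ix B c i) = 0" if "c \<in> {aDig, aMark, aInq}" for c i
            using that z2 by (auto simp: i4 i3)
          show ?case
            by (rule runs_mono[OF runs_search[OF r4 l4 at1 len1 X_def XB MX M01 T l ps v z]])
              (use 1 7(1) 6(1) 4(1) in \<open>auto simp: algebra_simps\<close>)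
        qed auto
      qed auto
    qed (use XB in auto)
  qed
qed

lemma time_bound:
  fixes m k t :: nat
  assumes "1 \<le> m" "1 \<le> k"
  shows "300 + m * (760 + 400 * t) + 240 * k + 3 ^ k * (solve_time m k t + 300 * k + 70)
     \<le> (13000 + 6000 * t) * ((m * k)\<^sup>2 * 3 ^ k)"
proof -
  define N where "N = m * k"
  have N: "1 \<le> N" "m \<le> N" "k \<le> N" using assms by (auto simp: N_def)
  then have N2: "N \<le> N\<^sup>2" by (simp add: power2_eq_square)
  have "70 + 210 * Suc (t + k) \<le> (490 + 210 * t) * k"
    using assms(2) by (cases k) (simp_all add: algebra_simps)
  then have "(2 * m + 2) * (70 + 210 * Suc (t + k)) \<le> (4 * m) * ((490 + 210 * t) * k)"
    using assms(1) by (intro mult_mono) auto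
  also have "\<dots> = (1960 + 840 * t) * N" by (simp add: N_def algebra_simps)
  finally have a: "(2 * m + 2) * (70 + 210 * Suc (t + k)) \<le> (1960 + 840 * t) * N" .
  have b: "250 * (2 * m * t) \<le> 500 * t * N" using N(2) by simp
  have "1200 + 2 * ((2 * m + 2) * (70 + 210 * Suc (t + k)) + 250 * (2 * m * t))
      \<le> 1200 * N + 2 * ((1960 + 840 * t) * N + 500 * t * N)"
    using N(1) by (intro add_mono mult_le_mono2 a b) simp
  also have "\<dots> = (5120 + 2680 * t) * N" by (simp add: algebra_simps)
  finally have "Suc m * (1200 + 2 * ((2 * m + 2) * (70 + 210 * Suc (t + k)) + 250 * (2 * m * t)))
      \<le> (2 * N) * ((5120 + 2680 * t) * N)"
    using assms(1) N(2) by (intro mult_mono) auto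
  also have "\<dots> = (10240 + 5360 * t) * N\<^sup>2" by (simp add: power2_eq_square algebra_simps)
  finally have "solve_time m k t \<le> 20 * N\<^sup>2 + (10240 + 5360 * t) * N\<^sup>2"
    using N(1) unfolding solve_time_def by (intro add_mono) simp_all
  moreover have "300 * k \<le> 300 * N\<^sup>2" "70 \<le> 70 * N\<^sup>2" using N N2 by simp_all
  ultimately have "solve_time m k t + 300 * k + 70
      \<le> 20 * N\<^sup>2 + (10240 + 5360 * t) * N\<^sup>2 + 300 * N\<^sup>2 + 70 * N\<^sup>2"
    by (intro add_mono)
  also have "\<dots> = (10630 + 5360 * t) * N\<^sup>2" by (simp add: algebra_simps)
  finally have S: "solve_time m k t + 300 * k + 70 \<le> (10630 + 5360 * t) * N\<^sup>2" .
  have "300 \<le> 300 * N\<^sup>2" "240 * k \<le> 240 * N\<^sup>2" using N N2 by simp_all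
  moreover have "m * (760 + 400 * t) \<le> N\<^sup>2 * (760 + 400 * t)" using N(2) N2 by (intro mult_mono) auto
  ultimately have "300 + m * (760 + 400 * t) + 240 * k
      \<le> 300 * N\<^sup>2 + N\<^sup>2 * (760 + 400 * t) + 240 * N\<^sup>2"
    by (intro add_mono)
  also have "\<dots> = (1300 + 400 * t) * N\<^sup>2" by (simp add: algebra_simps)
  also have "\<dots> \<le> (1300 + 400 * t) * N\<^sup>2 * 3 ^ k" by simp
  finally have "300 + m * (760 + 400 * t) + 240 * k + 3 ^ k * (solve_time m k t + 300 * k + 70)
     \<le> (1300 + 400 * t) * N\<^sup>2 * 3 ^ k + 3 ^ k * ((10630 + 5360 * t) * N\<^sup>2)"
    using mult_le_mono2[OF S, of "3 ^ k"] by linarith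
  also have "\<dots> = (11930 + 5760 * t) * (N\<^sup>2 * 3 ^ k)" by (simp add: algebra_simps)
  also have "\<dots> \<le> (13000 + 6000 * t) * (N\<^sup>2 * 3 ^ k)" by (intro mult_mono) auto
  finally show ?thesis by (simp add: N_def)
qed

theorem theorem9:
  "\<exists>P :: prog. \<forall>t :: nat. \<exists>C :: nat. \<forall>(n :: nat) (m :: nat) (k :: nat) p1 p2.
     is_Pi_Sigma2_Pi n m t p1 \<longrightarrow> is_Pi_Sigma3 n k p2 \<longrightarrow>
     (\<exists>\<tau> s. exec P (init_state (encode n p1 p2)) \<tau> s \<and>
            answer s = (if has_multilinear_monomial p1 p2 then 1 else 0) \<and>
            (1 \<le> m \<and> 1 \<le> k \<longrightarrow> \<tau> \<le> C * ((m * k)\<^sup>2 * 3 ^ k)))"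
proof (rule exI[of _ decide], rule allI, rule exI, intro allI impI)
  fix t n m k :: nat and p1 p2
  assume p: "is_Pi_Sigma2_Pi n m t p1" "is_Pi_Sigma3 n k p2"
  then have mk: "length p1 = m" "length p2 = k" by (auto simp: is_Pi_Sigma2_Pi_def is_Pi_Sigma3_def)
  have len: "\<forall>c\<in>set p1. length c \<le> 2" "\<And>c s. c \<in> set p1 \<Longrightarrow> s \<in> set c \<Longrightarrow> length s \<le> t"
    "\<forall>c\<in>set p2. length c \<le> 3"
    using p by (auto simp: is_Pi_Sigma2_Pi_def is_Pi_Sigma3_def)
  have nz: "\<forall>c\<in>set p1. \<forall>s\<in>set c. 0 \<notin> set s" "\<forall>c\<in>set p2. length c \<le> 3 \<and> 0 \<notin> set c"
    using p by (fastforce simp: is_Pi_Sigma2_Pi_def is_Pi_Sigma3_def)+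
  have "runs decide (init_state (encode n p1 p2)) (\<lambda>\<tau> s.
     \<tau> \<le> 300 + length p1 * (760 + 400 * t) + 240 * length p2 +
          3 ^ length p2 * (solve_time (length p1) (length p2) t + 300 * length p2 + 70) \<and>
     fst s rAns = (if \<exists>r < 3 ^ length p2. solvable p1 (selection p2 r) then 1 else 0))"
    by (rule runs_decide) (use len in auto)
  then obtain \<tau> s where "exec decide (init_state (encode n p1 p2)) \<tau> s"
    "\<tau> \<le> 300 + m * (760 + 400 * t) + 240 * k + 3 ^ k * (solve_time m k t + 300 * k + 70)"
    "fst s rAns = (if has_multilinear_monomial p1 p2 then 1 else 0)"
    unfolding mk ex_solvable_iff[OF nz, unfolded mk] runs_def by blast
  then show "\<exists>\<tau> s. exec decide (init_state (encode n p1 p2)) \<tau> s \<and>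
            answer s = (if has_multilinear_monomial p1 p2 then 1 else 0) \<and>
            (1 \<le> m \<and> 1 \<le> k \<longrightarrow> \<tau> \<le> (13000 + 6000 * t) * ((m * k)\<^sup>2 * 3 ^ k))"
    unfolding answer_def using time_bound order_trans by blast
qed

end
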